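(* Let $G=(V,E)$ be a graph with a cofinite free $\mathbb Z^d$-symmetry and Laplacian polynomial $\Delta$. If $\Delta\neq 0$, then $$\lim_{\langle \Lambda\rangle\to\infty}\frac{1}{|\mathbb Z^d/\Lambda|}\log T(G_\Lambda)=m(\Delta),$$ where $\Lambda$ ranges over all finite-index subgroups of $\mathbb Z^d$; that is, for every $\varepsilon>0$ there is $N$ such that $\left|\frac{1}{|\mathbb Z^d/\Lambda|}\log T(G_\Lambda)-m(\Delta)\right|<\varepsilon$ for every finite-index subgroup $\Lambda$ with $\langle\Lambda\rangle>N$.
   Context: Regard $\mathbb Z^d$ as the multiplicative free abelian group on $x_1,\ldots,x_d$, writing $x^{\mathbf s}=x_1^{s_1}\cdots x_d^{s_d}$ for $\mathbf s\in\mathbb Z^d$, and let $\mathcal R_d=\mathbb Z[x_1^{\pm1},\ldots,x_d^{\pm1}]$. A graph $G=(V,E)$ (multiple edges and loops allowed) has a cofinite free $\mathbb Z^d$-symmetry if $\mathbb Z^d$ acts freely on its vertices and edges by graph automorphisms with finite quotient graph $\overline G$. Then $V$ is a finite union of orbits $\{v_{i,\mathbf s}:\mathbf s\in\mathbb Z^d\}$, $i=1,\ldots,n$, with $x^{\mathbf s'}\cdot v_{i,\mathbf s}=v_{i,\mathbf s+\mathbf s'}$. The Laplacian matrix of $G$ is the $n\times n$ matrix $L=D-A$ over $\mathcal R_d$, where $D$ is diagonal with $D_{ii}$ the degree of $v_{i,\mathbf 0}$, and $A_{ij}$ is the sum, over all edges of $G$ joining $v_{i,\mathbf 0}$ to some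 $v_{j,\mathbf s}$, of the monomial $x^{\mathbf s}$ (loops are ignored). The Laplacian polynomial is $\Delta=\det L$, well defined up to units of $\mathcal R_d$. For nonzero $f\in\mathcal R_d$, the logarithmic Mahler measure is $m(f)=\int_0^1\cdots\int_0^1\log|f(e^{2\pi i\theta_1},\ldots,e^{2\pi i\theta_d})|\,d\theta_1\cdots d\theta_d$. For a finite-index subgroup $\Lambda\subset\mathbb Z^d$, $G_\Lambda$ denotes the finite quotient graph $G/\Lambda$, and $\langle\Lambda\rangle$ is the minimum Euclidean length of a nonzero vector of $\Lambda$ (viewing $\Lambda$ as a sublattice of $\mathbb Z^d\subset\mathbb R^d$). For a finite graph $H$ with connected components $H_1,\ldots,H_\mu$, its complexity is $T(H)=\tau(H_1)\cdots\tau(H_\mu)$, where $\tau$ denotes the number of spanning trees. *)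

theory Defs
  imports
    "HOL-Analysis.Analysis"
    "HOL-Algebra.Group_Action"
    "HOL-Library.Poly_Mapping"
    "Jordan_Normal_Form.Determinant"
begin

text \<open>
  The end map of a multigraph sends an edge to the set of its endpoints: a two-element set,
  or a singleton when the edge is a loop. Distinct edges may have the same endpoints.
\<close>

record ('v, 'e) multigraph =
  verts :: "'v set"
  edges :: "'e set"
  ends :: "'e \<Rightarrow> 'v set"

definition wf_multigraph :: "('v, 'e) multigraph \<Rightarrow> bool" where
  "wf_multigraph H \<longleftrightarrow> (\<forall>e\<in>edges H. \<exists>u\<in>verts H. \<exists>v\<in>verts H. ends H e = {u, v})"

definition connected_rel :: "('v, 'e) multigraph \<Rightarrow> ('v \<times> 'v) set" where
  "connected_rel H =
     {(u, v). u \<in> verts H \<and> v \<in> verts H \<and>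
              (u, v) \<in> {(a, b). \<exists>e\<in>edges H. ends H e = {a, b}}\<^sup>*}"

definition connected_multigraph :: "('v, 'e) multigraph \<Rightarrow> bool" where
  "connected_multigraph H \<longleftrightarrow>
     verts H \<noteq> {} \<and> (\<forall>u\<in>verts H. \<forall>v\<in>verts H. (u, v) \<in> connected_rel H)"

text \<open>
  A cycle is a closed walk with pairwise distinct vertices \<open>vs\<close> and pairwise distinct edges
  \<open>es\<close>; a loop is a cycle of length 1 and a pair of parallel edges is a cycle of length 2.
\<close>

definition is_cycle :: "('v, 'e) multigraph \<Rightarrow> 'v list \<Rightarrow> 'e list \<Rightarrow> bool" where
  "is_cycle H vs es \<longleftrightarrow>
     es \<noteq> [] \<and> length vs = length es \<and> distinct vs \<and> distinct es \<and>
     set vs \<subseteq> verts H \<and> set es \<subseteq> edges H \<and>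
     (\<forall>i<length es. ends H (es ! i) = {vs ! i, vs ! (Suc i mod length es)})"

definition is_tree :: "('v, 'e) multigraph \<Rightarrow> bool" where
  "is_tree H \<longleftrightarrow> connected_multigraph H \<and> \<not> (\<exists>vs es. is_cycle H vs es)"

definition spanning_trees :: "('v, 'e) multigraph \<Rightarrow> 'e set set" where
  "spanning_trees H = {F. F \<subseteq> edges H \<and> is_tree (H\<lparr>edges := F\<rparr>)}"

definition components_of :: "('v, 'e) multigraph \<Rightarrow> ('v, 'e) multigraph set" where
  "components_of H =
     (\<lambda>C. H\<lparr>verts := C, edges := {e \<in> edges H. ends H e \<subseteq> C}\<rparr>) ` (verts H // connected_rel H)"

definition complexity :: "('v, 'e) multigraph \<Rightarrow> nat" where
  "complexity H = (\<Prod>K\<in>components_of H. card (spanning_trees K))"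


definition lattice_group :: "(int ^ 'd::finite) monoid" where
  "lattice_group = \<lparr>carrier = UNIV, mult = (+), one = 0\<rparr>"

definition finite_index_sublattice :: "(int ^ 'd::finite) set \<Rightarrow> bool" where
  "finite_index_sublattice \<Lambda> \<longleftrightarrow>
     subgroup \<Lambda> lattice_group \<and> finite (rcosets\<^bsub>lattice_group\<^esub> \<Lambda>)"

definition lattice_index :: "(int ^ 'd::finite) set \<Rightarrow> nat" where
  "lattice_index \<Lambda> = card (rcosets\<^bsub>lattice_group\<^esub> \<Lambda>)"

definition euclidean_length :: "int ^ 'd::finite \<Rightarrow> real" where
  "euclidean_length s = norm (\<chi> i. real_of_int (vec_nth s i))"

text \<open>
  The minimum is attained for every \<open>\<Lambda>\<close> containing a nonzero vector, in particular for every
  finite-index subgroup, since only finitely many integer vectors lie in a given ball.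
\<close>

definition min_length :: "(int ^ 'd::finite) set \<Rightarrow> real" where
  "min_length \<Lambda> = (LEAST r. \<exists>s\<in>\<Lambda>. s \<noteq> 0 \<and> r = euclidean_length s)"


text \<open>
  The locale \<open>group_action\<close> makes each \<open>\<phi> s\<close> a bijection of the vertex set and each \<open>\<psi> s\<close> a
  bijection of the edge set; the third conjunct says that the pair is a graph automorphism.
\<close>

definition cofinite_free_symmetry ::
  "('v, 'e) multigraph \<Rightarrow> (int ^ 'd::finite \<Rightarrow> 'v \<Rightarrow> 'v) \<Rightarrow> (int ^ 'd \<Rightarrow> 'e \<Rightarrow> 'e) \<Rightarrow> bool" where
  "cofinite_free_symmetry G \<phi> \<psi> \<longleftrightarrow>
     group_action lattice_group (verts G) \<phi> \<and>
     group_action lattice_group (edges G) \<psi> \<and>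
     (\<forall>s. \<forall>e\<in>edges G. ends G (\<psi> s e) = \<phi> s ` ends G e) \<and>
     (\<forall>v\<in>verts G. stabilizer lattice_group \<phi> v = {0}) \<and>
     (\<forall>e\<in>edges G. stabilizer lattice_group \<psi> e = {0}) \<and>
     finite (orbits lattice_group (verts G) \<phi>) \<and>
     finite (orbits lattice_group (edges G) \<psi>)"

text \<open>
  In the quotient by \<open>\<Lambda>\<close> the endpoints of an edge orbit are the orbits of the endpoints of
  its members (any two members give the same set, by equivariance). An edge joining two
  vertices of the same orbit becomes a loop.
\<close>

definition quotient_graph ::
  "('v, 'e) multigraph \<Rightarrow> (int ^ 'd::finite \<Rightarrow> 'v \<Rightarrow> 'v) \<Rightarrow> (int ^ 'd \<Rightarrow> 'e \<Rightarrow> 'e) \<Rightarrow>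
     (int ^ 'd) set \<Rightarrow> ('v set, 'e set) multigraph" where
  "quotient_graph G \<phi> \<psi> \<Lambda> =
     \<lparr>verts = orbits (lattice_group\<lparr>carrier := \<Lambda>\<rparr>) (verts G) \<phi>,
      edges = orbits (lattice_group\<lparr>carrier := \<Lambda>\<rparr>) (edges G) \<psi>,
      ends = (\<lambda>X. \<Union>e\<in>X. orbit (lattice_group\<lparr>carrier := \<Lambda>\<rparr>) \<phi> ` ends G e)\<rparr>"

text \<open>
  The vertices \<open>r 0, \<dots>, r (n - 1)\<close> form a system of representatives of the vertex orbits;
  they play the role of the base vertices of the orbits, the general vertex of the \<open>i\<close>-th
  orbit being \<open>\<phi> s (r i)\<close>.
\<close>

definition orbit_representatives ::
  "('v, 'e) multigraph \<Rightarrow> (int ^ 'd::finite \<Rightarrow> 'v \<Rightarrow> 'v) \<Rightarrow> nat \<Rightarrow> (nat \<Rightarrow> 'v) \<Rightarrow> bool" where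
  "orbit_representatives G \<phi> n r \<longleftrightarrow>
     r ` {..<n} \<subseteq> verts G \<and>
     bij_betw (\<lambda>i. orbit lattice_group \<phi> (r i)) {..<n} (orbits lattice_group (verts G) \<phi>)"


text \<open>
  The Laurent polynomial ring in the variables indexed by \<open>'d\<close> is the group ring of
  \<open>int ^ 'd\<close> over the integers; \<open>Poly_Mapping.single s 1\<close> is the monomial with exponent
  vector \<open>s\<close>.
\<close>

type_synonym 'd laurent = "(int ^ 'd) \<Rightarrow>\<^sub>0 int"

definition laurent_eval :: "'d::finite laurent \<Rightarrow> ('d \<Rightarrow> complex) \<Rightarrow> complex" where
  "laurent_eval f z =
     (\<Sum>s\<in>Poly_Mapping.keys f.
        of_int (Poly_Mapping.lookup f s) * (\<Prod>i\<in>UNIV. z i powi vec_nth s i))"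

text \<open>
  For \<open>f \<noteq> 0\<close> the integrand is Lebesgue integrable and the zero set of \<open>f\<close> on the torus,
  where the library convention \<open>ln 0 = 0\<close> applies, is a null set.
\<close>

definition mahler_measure :: "'d::finite laurent \<Rightarrow> real" where
  "mahler_measure f =
     (LINT \<theta> : {\<theta> :: real ^ 'd. \<forall>i. 0 \<le> vec_nth \<theta> i \<and> vec_nth \<theta> i \<le> 1} | lborel.
        ln (cmod (laurent_eval f (\<lambda>i. exp (2 * of_real pi * \<i> * of_real (vec_nth \<theta> i))))))"

text \<open>
  Loops of \<open>G\<close> are ignored both in the degrees and in the adjacency entries. An edge joining
  \<open>r i\<close> to a different vertex of its own orbit is not a loop of \<open>G\<close>: it contributes a
  monomial to the diagonal entry.
\<close>

definition nonloop_degree :: "('v, 'e) multigraph \<Rightarrow> 'v \<Rightarrow> nat" where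
  "nonloop_degree G v = card {e \<in> edges G. v \<in> ends G e \<and> ends G e \<noteq> {v}}"

definition adjacency_entry ::
  "('v, 'e) multigraph \<Rightarrow> (int ^ 'd::finite \<Rightarrow> 'v \<Rightarrow> 'v) \<Rightarrow> 'v \<Rightarrow> 'v \<Rightarrow> 'd laurent" where
  "adjacency_entry G \<phi> u v =
     (\<Sum>(e, s)\<in>{(e, s). e \<in> edges G \<and> ends G e = {u, \<phi> s v} \<and> \<phi> s v \<noteq> u}.
        Poly_Mapping.single s 1)"

definition laplacian_matrix ::
  "('v, 'e) multigraph \<Rightarrow> (int ^ 'd::finite \<Rightarrow> 'v \<Rightarrow> 'v) \<Rightarrow> nat \<Rightarrow> (nat \<Rightarrow> 'v) \<Rightarrow>
     'd laurent mat" where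
  "laplacian_matrix G \<phi> n r =
     mat n n (\<lambda>(i, j). (if i = j then of_nat (nonloop_degree G (r i)) else 0)
                        - adjacency_entry G \<phi> (r i) (r j))"

definition laplacian_polynomial ::
  "('v, 'e) multigraph \<Rightarrow> (int ^ 'd::finite \<Rightarrow> 'v \<Rightarrow> 'v) \<Rightarrow> nat \<Rightarrow> (nat \<Rightarrow> 'v) \<Rightarrow>
     'd laurent" where
  "laplacian_polynomial G \<phi> n r = Determinant.det (laplacian_matrix G \<phi> n r)"

end

theory Submission
  imports Defs "Jordan_Normal_Form.Schur_Decomposition"
begin

text \<open>
  Let \<open>B\<close> exceed all degrees, so that \<open>W = B - L\<close> has nonnegative coefficients and constant row
  sums \<open>B\<close>. For \<open>t > 0\<close> the regularized quantity \<open>log det (L + t)\<close> is a power series in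
  \<open>1 / (B + t)\<close> whose coefficients are numbers of closed walks. These numbers agree on the infinite
  graph and on its quotient by \<open>\<Lambda>\<close> for walks that are short compared with the minimal length of
  \<open>\<Lambda>\<close>, and on the infinite graph they are the torus integrals of the traces of powers of \<open>W\<close>. Hence
  \<open>log det (L\<^sub>\<Lambda> + t)\<close>, normalized by the index, tends to the torus integral of
  \<open>log det (L + t)\<close>.

  It remains to remove \<open>t\<close> uniformly in \<open>\<Lambda>\<close>. For a finite connected graph on \<open>m\<close> vertices the matrix
  tree theorem gives \<open>det (L + t) / t \<longlonglongrightarrow> m \<tau>\<close> as \<open>t\<close> tends to \<open>0\<close>, and the derivative of
  \<open>log (det (L + t) / t)\<close> is the sum over the vertices of \<open>g x - 1 / (t m)\<close>, where \<open>g x\<close> is the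
  diagonal value of the Green function \<open>(L + t)\<^sup>-\<^sup>1\<close>. An energy estimate along a shortest path bounds
  each summand by \<open>8 / sqrt t\<close>, so the error is at most \<open>16 m sqrt t\<close>. As the Laplacian polynomial
  does not vanish, every component of the infinite graph is stabilized by a nonzero translation;
  therefore the components of the quotients grow, and the terms \<open>log t\<close> and \<open>log m\<close> contributed by
  each component are negligible. On the torus \<open>t\<close> is removed by monotone convergence, since
  \<open>\<bar>det (L + t)\<bar>\<close> increases with \<open>t\<close>.
\<close>

section \<open>Logarithm of a determinant as a power series of traces\<close>

text \<open>At \<open>t = 0\<close> the logarithmic series sits on its circle of convergence:
  constant vectors make every quotient Laplacian singular, and eigenvalues near 0, where the
  logarithm is unbounded, are invisible to counts of short closed walks. Agreement of moments thus
  settles each fixed \<open>t\<close> but says nothing at 0; uniform control of the small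
  eigenvalues is the real task. The rate \<open>sqrt t\<close> reflects the length
  \<open>1 / sqrt t\<close>: a column of the Green function sums to \<open>1 / t\<close>, so among
  \<open>1 / sqrt t\<close> vertices one has value at most \<open>1 / sqrt t\<close>, and the
  variation over that distance is paid for by the Dirichlet energy. Only connectedness and edge
  weights at least 1 enter, hence the independence of \<Lambda>. Monotone convergence on the torus
  requires the regularized integrals to stay bounded below. That bound comes back from the finite
  side: a complexity is a natural number, its logarithm is nonnegative, and the uniform error
  estimate transfers this to the integrals for all \<open>t\<close> in (0, 1]. Integrability of the
  logarithm of |\<Delta>| on the torus is therefore a by-product of counting trees.\<close>

lemma trace_mult_commute:
  fixes A B :: "'a::comm_ring_1 mat"
  assumes "A \<in> carrier_mat n n" "B \<in> carrier_mat n n"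
  shows "(\<Sum>i<n. (A * B) $$ (i, i)) = (\<Sum>i<n. (B * A) $$ (i, i))"
proof -
  have "(\<Sum>i<n. (A * B) $$ (i, i)) = (\<Sum>i<n. \<Sum>j<n. A $$ (i, j) * B $$ (j, i))"
    using assms by (intro sum.cong refl) (auto simp: times_mat_def scalar_prod_def atLeast0LessThan)
  also have "\<dots> = (\<Sum>j<n. \<Sum>i<n. B $$ (j, i) * A $$ (i, j))"
    by (subst sum.swap) (simp add: mult.commute)
  also have "\<dots> = (\<Sum>i<n. (B * A) $$ (i, i))"
    using assms by (intro sum.cong refl) (auto simp: times_mat_def scalar_prod_def atLeast0LessThan)
  finally show ?thesis .
qed

lemma upper_triangular_mult_diag:
  fixes A B :: "'a::comm_ring_1 mat"
  assumes A: "A \<in> carrier_mat n n" and B: "B \<in> carrier_mat n n"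
    and uA: "upper_triangular A" and uB: "upper_triangular B"
  shows "upper_triangular (A * B)" "\<And>i. i < n \<Longrightarrow> (A * B) $$ (i, i) = A $$ (i, i) * B $$ (i, i)"
proof -
  have e: "(A * B) $$ (i, j) = (\<Sum>k<n. A $$ (i, k) * B $$ (k, j))" if "i < n" "j < n" for i j
    using that A B by (auto simp: times_mat_def scalar_prod_def atLeast0LessThan)
  have zA: "A $$ (i, j) = 0" if "j < i" "i < n" for i j using uA A that by auto
  have zB: "B $$ (i, j) = 0" if "j < i" "i < n" for i j using uB B that by auto
  show "upper_triangular (A * B)"
  proof (rule upper_triangularI)
    fix i j assume ij: "j < i" "i < dim_row (A * B)"
    then have "i < n" "j < n" using A by auto
    moreover have "A $$ (i, k) * B $$ (k, j) = 0" if "k < n" for k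
      using zA[of k i] zB[of j k] ij that \<open>i < n\<close> by (cases "k < i") auto
    ultimately show "(A * B) $$ (i, j) = 0" by (simp add: e)
  qed
  fix i assume i: "i < n"
  have "(\<Sum>k<n. A $$ (i, k) * B $$ (k, i)) = (\<Sum>k\<in>{i}. A $$ (i, k) * B $$ (k, i))"
  proof (rule sum.mono_neutral_right)
    show "\<forall>k\<in>{..<n} - {i}. A $$ (i, k) * B $$ (k, i) = 0"
    proof
      fix k assume "k \<in> {..<n} - {i}"
      then show "A $$ (i, k) * B $$ (k, i) = 0"
        using zA[of k i] zB[of i k] i by (cases "k < i") auto
    qed
  qed (use i in auto)
  then show "(A * B) $$ (i, i) = A $$ (i, i) * B $$ (i, i)" using e i by simp
qed

lemma upper_triangular_pow_diag:
  fixes A :: "'a::comm_ring_1 mat"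
  assumes A: "A \<in> carrier_mat n n" and uA: "upper_triangular A"
  shows "upper_triangular (A ^\<^sub>m k) \<and> (\<forall>i<n. (A ^\<^sub>m k) $$ (i, i) = (A $$ (i, i)) ^ k)"
proof (induction k)
  case 0
  then show ?case using A by auto
next
  case (Suc k)
  then show ?case
    using upper_triangular_mult_diag[OF pow_carrier_mat[OF A, of k] A _ uA] A by auto
qed

lemma det_char_roots:
  fixes W :: "complex mat"
  assumes W: "W \<in> carrier_mat n n"
    and ch: "char_poly W = (\<Prod>a\<leftarrow>es. [:- a, 1:])"
  shows "det (c \<cdot>\<^sub>m 1\<^sub>m n - W) = (\<Prod>a\<leftarrow>es. c - a)"
proof -
  have h: "comm_ring_hom (\<lambda>p::complex poly. poly p c)" by unfold_locales auto
  have "poly (char_poly W) c = det (map_mat (\<lambda>p. poly p c) (char_poly_matrix W))"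
    unfolding char_poly_def by (simp add: comm_ring_hom.hom_det[OF h])
  also have "map_mat (\<lambda>p. poly p c) (char_poly_matrix W) = c \<cdot>\<^sub>m 1\<^sub>m n - W"
    using W by (intro eq_matI) (auto simp: char_poly_matrix_def)
  finally have "det (c \<cdot>\<^sub>m 1\<^sub>m n - W) = poly (\<Prod>a\<leftarrow>es. [:- a, 1:]) c" using ch by simp
  also have "\<dots> = (\<Prod>a\<leftarrow>es. c - a)" by (induction es) (auto simp: algebra_simps)
  finally show ?thesis .
qed

text \<open>Schur's triangular form serves an arbitrary complex matrix: its diagonal lists the
  eigenvalues with algebraic multiplicity, and powers of the triangular factor carry powers of that
  diagonal. Determinant and traces thus become functions of one list.\<close>

lemma spectral_list:
  fixes W :: "complex mat"
  assumes W: "W \<in> carrier_mat n n"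
  obtains es where "length es = n"
    and "\<And>c. det (c \<cdot>\<^sub>m 1\<^sub>m n - W) = (\<Prod>a\<leftarrow>es. c - a)"
    and "\<And>k. (\<Sum>i<n. (W ^\<^sub>m k) $$ (i, i)) = (\<Sum>a\<leftarrow>es. a ^ k)"
    and "\<And>a. a \<in> set es \<Longrightarrow> eigenvalue W a"
proof -
  obtain es where ch: "char_poly W = (\<Prod>a\<leftarrow>es. [:- a, 1:])" and len: "length es = n"
    using char_poly_factorized[OF W] by blast
  obtain B P Q where sd: "schur_decomposition W es = (B, P, Q)" by (cases "schur_decomposition W es")
  have sim: "similar_mat_wit W B P Q" and up: "upper_triangular B" and di: "diag_mat B = es"
    using schur_decomposition[OF W ch sd] by auto
  note sD = similar_mat_witD2[OF W sim]
  have tr: "(\<Sum>i<n. (W ^\<^sub>m k) $$ (i, i)) = (\<Sum>a\<leftarrow>es. a ^ k)" for k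
  proof -
    have Bk: "B ^\<^sub>m k \<in> carrier_mat n n" using sD by simp
    have "(\<Sum>i<n. (W ^\<^sub>m k) $$ (i, i)) = (\<Sum>i<n. ((P * B ^\<^sub>m k) * Q) $$ (i, i))"
      by (simp add: similar_mat_wit_pow_id[OF sim])
    also have "\<dots> = (\<Sum>i<n. (Q * (P * B ^\<^sub>m k)) $$ (i, i))"
      by (rule trace_mult_commute) (use sD Bk in auto)
    also have "Q * (P * B ^\<^sub>m k) = (Q * P) * B ^\<^sub>m k"
      by (rule assoc_mult_mat[symmetric]) (use sD Bk in auto)
    also have "\<dots> = B ^\<^sub>m k" using left_mult_one_mat[OF Bk] by (simp only: sD(2))
    also have "(\<Sum>i<n. (B ^\<^sub>m k) $$ (i, i)) = (\<Sum>i<n. (B $$ (i, i)) ^ k)"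
      using upper_triangular_pow_diag[OF sD(5) up, of k] by simp
    also have "\<dots> = (\<Sum>a\<leftarrow>es. a ^ k)"
      using sD(5) unfolding di[symmetric] diag_mat_def
      by (simp add: sum_list_sum_nth atLeast0LessThan)
    finally show ?thesis .
  qed
  have ev: "eigenvalue W a" if "a \<in> set es" for a
    using that ch by (auto simp: eigenvalue_root_char_poly[OF W] poly_prod_list o_def prod_list_zero_iff)
  show ?thesis by (rule that[OF len det_char_roots[OF W ch] tr ev])
qed

text \<open>The eigenvector equation is read at a coordinate of maximal modulus, which dominates all
  the others.\<close>

lemma eigenvalue_row_sum_bound:
  fixes W :: "complex mat"
  assumes W: "W \<in> carrier_mat n n" and ev: "eigenvalue W a"
    and rows: "\<And>i. i < n \<Longrightarrow> (\<Sum>j<n. cmod (W $$ (i, j))) \<le> B"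
  shows "cmod a \<le> B"
proof -
  obtain v where v: "v \<in> carrier_vec n" "v \<noteq> 0\<^sub>v n" "W *\<^sub>v v = a \<cdot>\<^sub>v v"
    using ev W unfolding eigenvalue_def eigenvector_def by auto
  have n0: "n > 0" using eigenvalue_imp_nonzero_dim[OF W ev] .
  define M where "M = Max ((\<lambda>i. cmod (vec_index v i)) ` {..<n})"
  have le: "cmod (vec_index v i) \<le> M" if "i < n" for i
    unfolding M_def using that by (intro Max_ge) auto
  have "M \<in> (\<lambda>i. cmod (vec_index v i)) ` {..<n}"
    unfolding M_def using n0 by (intro Max_in) auto
  then obtain i where i: "i < n" "M = cmod (vec_index v i)" by auto
  have "M > 0"
  proof (rule ccontr)
    assume "\<not> M > 0"
    then have "vec_index v j = 0" if "j < n" for j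
      using le[OF that] by (metis norm_le_zero_iff not_less order_trans)
    then show False using v(1,2) by (metis carrier_vecD eq_vecI index_zero_vec)
  qed
  have "a * vec_index v i = vec_index (W *\<^sub>v v) i" using v i by simp
  also have "\<dots> = (\<Sum>j<n. W $$ (i, j) * vec_index v j)"
    using W v(1) i by (auto simp: scalar_prod_def atLeast0LessThan intro!: sum.cong)
  finally have "cmod a * M = cmod (\<Sum>j<n. W $$ (i, j) * vec_index v j)"
    using i by (metis norm_mult)
  also have "\<dots> \<le> (\<Sum>j<n. cmod (W $$ (i, j)) * M)"
    by (rule order_trans[OF norm_sum sum_mono]) (auto simp: norm_mult intro!: mult_left_mono le)
  also have "\<dots> \<le> B * M" using rows[OF i(1)] \<open>M > 0\<close>
    by (simp add: sum_distrib_right[symmetric])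
  finally show ?thesis using \<open>M > 0\<close> by simp
qed

lemma Ln_one_minus_sums:
  assumes "cmod z < 1"
  shows "(\<lambda>k. z ^ Suc k / of_nat (Suc k)) sums (- Ln (1 - z))"
proof -
  have "(\<lambda>n. (-1)^Suc n / of_nat n * (-z)^n) sums Ln (1 + (-z))"
    using assms by (intro Ln_series) auto
  then have "(\<lambda>n. - ((-1)^Suc n / of_nat n * (-z)^n)) sums (- Ln (1 - z))"
    using sums_minus by fastforce
  moreover have "- ((-1)^Suc n / of_nat n * (-z)^n) = z ^ n / of_nat n" for n
    by (subst power_minus[of z]) (simp add: power_mult_distrib[symmetric])
  ultimately have "(\<lambda>n. z ^ n / of_nat n) sums (- Ln (1 - z))" by (simp only:)
  then show ?thesis by (subst sums_Suc_iff) simp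
qed

text \<open>Real parts are taken because the modulus of a number determines the real part of its
  logarithm on every branch; such terms can be added over all eigenvalues.\<close>

lemma ln_cmod_diff_sums:
  assumes "c > 0" "cmod a < c"
  shows "(\<lambda>k. Re (a ^ Suc k) / (real (Suc k) * c ^ Suc k)) sums (ln c - ln (cmod (of_real c - a)))"
proof -
  let ?z = "a / of_real c"
  have z: "cmod ?z < 1" using assms by (simp add: norm_divide)
  have ne: "1 - ?z \<noteq> 0" using z by auto
  have "(\<lambda>k. Re (?z ^ Suc k / of_nat (Suc k))) sums Re (- Ln (1 - ?z))"
    by (rule sums_Re[OF Ln_one_minus_sums[OF z]])
  moreover have "Re (?z ^ Suc k / of_nat (Suc k)) = Re (a ^ Suc k) / (real (Suc k) * c ^ Suc k)" for k
  proof -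
    have "?z ^ Suc k / of_nat (Suc k) = a ^ Suc k / of_real (real (Suc k) * c ^ Suc k)"
      by (simp only: power_divide of_real_mult of_real_power of_real_of_nat_eq divide_divide_eq_left mult.commute)
    then show ?thesis by (simp only: Re_divide_of_real)
  qed
  moreover have "Re (- Ln (1 - ?z)) = ln c - ln (cmod (of_real c - a))"
  proof -
    have "1 - ?z = (of_real c - a) / of_real c" using assms by (simp add: field_simps)
    then have "cmod (1 - ?z) = cmod (of_real c - a) / c" using assms by (simp add: norm_divide)
    moreover have "of_real c - a \<noteq> 0" using assms by auto
    ultimately show ?thesis using ne assms by (simp add: Re_Ln ln_div)
  qed
  ultimately show ?thesis by simp
qed

text \<open>Adding the series of the single factors over the eigenvalue list produces traces of
  powers. The strict inequality \<open>B < c\<close> places every eigenvalue inside the disc of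
  convergence.\<close>

lemma ln_cmod_det_sums:
  fixes W :: "complex mat"
  assumes W: "W \<in> carrier_mat n n"
    and rows: "\<And>i. i < n \<Longrightarrow> (\<Sum>j<n. cmod (W $$ (i, j))) \<le> B"
    and c: "c > B" "c > 0"
  shows "(\<lambda>k. Re (\<Sum>i<n. (W ^\<^sub>m Suc k) $$ (i, i)) / (real (Suc k) * c ^ Suc k))
           sums (real n * ln c - ln (cmod (det (of_real c \<cdot>\<^sub>m 1\<^sub>m n - W))))"
    and "det (of_real c \<cdot>\<^sub>m 1\<^sub>m n - W) \<noteq> 0"
proof -
  obtain es where es: "length es = n"
    "\<And>c. det (c \<cdot>\<^sub>m 1\<^sub>m n - W) = (\<Prod>a\<leftarrow>es. c - a)"
    "\<And>k. (\<Sum>i<n. (W ^\<^sub>m k) $$ (i, i)) = (\<Sum>a\<leftarrow>es. a ^ k)"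
    "\<And>a. a \<in> set es \<Longrightarrow> eigenvalue W a"
    by (rule spectral_list[OF W]) blast
  have small: "cmod a < c" if "a \<in> set es" for a
    using eigenvalue_row_sum_bound[OF W es(4)[OF that] rows] c by linarith
  \<comment> \<open>Nonvanishing is carried through the induction because the logarithm of the
    product splits only over nonzero factors.\<close>
  have "(\<lambda>k. Re (\<Sum>a\<leftarrow>es. a ^ Suc k) / (real (Suc k) * c ^ Suc k))
          sums (real (length es) * ln c - ln (cmod (\<Prod>a\<leftarrow>es. of_real c - a)))
        \<and> (\<Prod>a\<leftarrow>es. of_real c - a) \<noteq> 0"
    using small
  proof (induction es)
    case Nil
    then show ?case by simp
  next
    case (Cons a es)
    have ne: "of_real c - a \<noteq> 0" using Cons.prems[of a] c by auto
    have IH: "(\<lambda>k. Re (\<Sum>a\<leftarrow>es. a ^ Suc k) / (real (Suc k) * c ^ Suc k))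
          sums (real (length es) * ln c - ln (cmod (\<Prod>a\<leftarrow>es. of_real c - a)))"
        "(\<Prod>a\<leftarrow>es. of_real c - a) \<noteq> 0"
      using Cons.IH Cons.prems by auto
    have "(\<lambda>k. Re (a ^ Suc k) / (real (Suc k) * c ^ Suc k)
              + Re (\<Sum>a\<leftarrow>es. a ^ Suc k) / (real (Suc k) * c ^ Suc k))
        sums (ln c - ln (cmod (of_real c - a))
              + (real (length es) * ln c - ln (cmod (\<Prod>a\<leftarrow>es. of_real c - a))))"
      by (rule sums_add[OF ln_cmod_diff_sums[OF c(2)] IH(1)]) (use Cons.prems in auto)
    moreover have "ln (cmod (\<Prod>a\<leftarrow>a # es. of_real c - a))
        = ln (cmod (of_real c - a)) + ln (cmod (\<Prod>a\<leftarrow>es. of_real c - a))"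
      using ne IH(2) by (simp add: norm_mult ln_mult)
    moreover have "Re (a ^ Suc k) / (real (Suc k) * c ^ Suc k)
              + Re (\<Sum>a\<leftarrow>es. a ^ Suc k) / (real (Suc k) * c ^ Suc k)
        = Re (\<Sum>a\<leftarrow>a # es. a ^ Suc k) / (real (Suc k) * c ^ Suc k)" for k
      by (simp only: list.map sum_list.Cons plus_complex.sel add_divide_distrib)
    moreover have "(\<Prod>a\<leftarrow>a # es. of_real c - a) \<noteq> 0" using ne IH(2) by simp
    ultimately show ?case by (simp only: list.size) (simp add: algebra_simps)
  qed
  then show "(\<lambda>k. Re (\<Sum>i<n. (W ^\<^sub>m Suc k) $$ (i, i)) / (real (Suc k) * c ^ Suc k))
           sums (real n * ln c - ln (cmod (det (of_real c \<cdot>\<^sub>m 1\<^sub>m n - W))))"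
    and "det (of_real c \<cdot>\<^sub>m 1\<^sub>m n - W) \<noteq> 0"
    unfolding es(2) es(3) es(1) by auto
qed

text \<open>All eigenvalues have real part at most \<open>B\<close>, so moving a real point from
  \<open>s\<close> to the right increases its distance to each of them.\<close>

lemma cmod_det_mono:
  fixes W :: "complex mat"
  assumes W: "W \<in> carrier_mat n n"
    and rows: "\<And>i. i < n \<Longrightarrow> (\<Sum>j<n. cmod (W $$ (i, j))) \<le> B"
    and st: "B \<le> s" "s \<le> t"
  shows "cmod (det (of_real s \<cdot>\<^sub>m 1\<^sub>m n - W)) \<le> cmod (det (of_real t \<cdot>\<^sub>m 1\<^sub>m n - W))"
proof -
  obtain es where es: "length es = n"
    "\<And>c. det (c \<cdot>\<^sub>m 1\<^sub>m n - W) = (\<Prod>a\<leftarrow>es. c - a)"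
    "\<And>k. (\<Sum>i<n. (W ^\<^sub>m k) $$ (i, i)) = (\<Sum>a\<leftarrow>es. a ^ k)"
    "\<And>a. a \<in> set es \<Longrightarrow> eigenvalue W a"
    by (rule spectral_list[OF W]) blast
  have "cmod (of_real s - a) \<le> cmod (of_real t - a)" if "a \<in> set es" for a
  proof -
    have "cmod a \<le> B" by (rule eigenvalue_row_sum_bound[OF W es(4)[OF that] rows])
    then have "Re a \<le> s" using complex_Re_le_cmod[of a] st by linarith
    then have "(s - Re a)\<^sup>2 \<le> (t - Re a)\<^sup>2" using st by (intro power_mono) auto
    then show ?thesis by (simp add: cmod_def)
  qed
  then have "cmod (\<Prod>a\<leftarrow>es. of_real s - a) \<le> cmod (\<Prod>a\<leftarrow>es. of_real t - a)"
    by (induction es) (auto simp: norm_mult intro!: mult_mono)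
  then show ?thesis by (simp add: es(2))
qed

section \<open>Walks and the Green function of a finite chain\<close>

text \<open>Entries of powers of the weight matrix, indexed by the vertices themselves so that
  restriction to a component and passage to a quotient require no enumeration.\<close>

primrec walks :: "'a set \<Rightarrow> ('a \<Rightarrow> 'a \<Rightarrow> real) \<Rightarrow> nat \<Rightarrow> 'a \<Rightarrow> 'a \<Rightarrow> real" where
  "walks V w 0 x y = (if x = y then 1 else 0)"
| "walks V w (Suc k) x y = (\<Sum>z\<in>V. w x z * walks V w k z y)"

text \<open>Neumann series of the resolvent \<open>(c - w)^-1\<close>; with \<open>w = B - L\<close>
  and \<open>c = B + t\<close> it is \<open>(L + t)^-1\<close>.\<close>

definition green :: "'a set \<Rightarrow> ('a \<Rightarrow> 'a \<Rightarrow> real) \<Rightarrow> real \<Rightarrow> 'a \<Rightarrow> 'a \<Rightarrow> real" where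
  "green V w c x y = suminf (\<lambda>k. walks V w k x y / c ^ Suc k)"

text \<open>The share of \<open>x\<close> in the logarithm of the determinant of
  \<open>c - w\<close>, closed walks being sorted by their base point. This local form is unchanged
  by restriction to a component and constant along orbits in a quotient.\<close>

definition log_density :: "'a set \<Rightarrow> ('a \<Rightarrow> 'a \<Rightarrow> real) \<Rightarrow> real \<Rightarrow> 'a \<Rightarrow> real" where
  "log_density V w c x = ln c - (suminf (\<lambda>k. walks V w (Suc k) x x / (real (Suc k) * c ^ Suc k)))"

lemma walks_Suc_right:
  "finite V \<Longrightarrow> x \<in> V \<Longrightarrow> y \<in> V \<Longrightarrow> walks V w (Suc k) x y = (\<Sum>z\<in>V. walks V w k x z * w z y)"
proof (induction k arbitrary: x)
  case 0
  then show ?case by (simp add: if_distrib[of "\<lambda>u. _ * u"] if_distrib[of "\<lambda>u. u * _"] cong: if_cong)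
next
  case (Suc k)
  have "walks V w (Suc (Suc k)) x y = (\<Sum>u\<in>V. w x u * walks V w (Suc k) u y)" by simp
  also have "\<dots> = (\<Sum>u\<in>V. w x u * (\<Sum>z\<in>V. walks V w k u z * w z y))"
    using Suc by (intro sum.cong refl arg_cong2[where f = "(*)"]) auto
  also have "\<dots> = (\<Sum>z\<in>V. \<Sum>u\<in>V. w x u * (walks V w k u z * w z y))"
    unfolding sum_distrib_left by (rule sum.swap)
  also have "\<dots> = (\<Sum>z\<in>V. walks V w (Suc k) x z * w z y)"
    by (simp add: sum_distrib_right mult.assoc)
  finally show ?case .
qed

lemma walks_mat_pow:
  assumes h: "bij_betw h {0..<m} V" and V: "finite V" and ij: "i < m" "j < m"
  shows "(mat m m (\<lambda>(i, j). w (h i) (h j)) ^\<^sub>m k) $$ (i, j) = walks V w k (h i) (h j)"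
  using ij
proof (induction k arbitrary: i j)
  case 0
  then show ?case using h by (auto simp: bij_betw_def inj_on_def)
next
  case (Suc k)
  let ?A = "mat m m (\<lambda>(i, j). w (h i) (h j))"
  have hV: "h i \<in> V" if "i < m" for i using h that by (auto simp: bij_betw_def)
  have "(?A ^\<^sub>m Suc k) $$ (i, j) = (\<Sum>l = 0..<m. (?A ^\<^sub>m k) $$ (i, l) * ?A $$ (l, j))"
    using Suc.prems by (simp add: scalar_prod_def)
  also have "\<dots> = (\<Sum>l = 0..<m. walks V w k (h i) (h l) * w (h l) (h j))"
    using Suc by (intro sum.cong refl) auto
  also have "\<dots> = (\<Sum>z\<in>V. walks V w k (h i) z * w z (h j))"
    by (rule sum.reindex_bij_betw[OF h])
  finally show ?case using walks_Suc_right[OF V hV hV] Suc.prems by simp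
qed

section \<open>Resolvent estimates for a symmetric chain with constant row sums\<close>

locale finite_chain =
  fixes V :: "'a set" and w :: "'a \<Rightarrow> 'a \<Rightarrow> real" and B :: real
  assumes fin: "finite V"
    and nonneg: "x \<in> V \<Longrightarrow> y \<in> V \<Longrightarrow> w x y \<ge> 0"
    and sym: "x \<in> V \<Longrightarrow> y \<in> V \<Longrightarrow> w x y = w y x"
    and row_sum: "x \<in> V \<Longrightarrow> (\<Sum>y\<in>V. w x y) = B"
    and B_pos: "B > 0"
begin

lemma walks_nonneg: "x \<in> V \<Longrightarrow> walks V w k x y \<ge> 0"
  by (induction k arbitrary: x) (auto intro!: sum_nonneg mult_nonneg_nonneg nonneg)

lemma walks_col_sum: "x \<in> V \<Longrightarrow> (\<Sum>y\<in>V. walks V w k y x) = B ^ k"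
proof (induction k)
  case 0
  then show ?case using fin by (simp add: sum.delta)
next
  case (Suc k)
  have "(\<Sum>y\<in>V. walks V w (Suc k) y x) = (\<Sum>z\<in>V. (\<Sum>y\<in>V. w y z) * walks V w k z x)"
    by (simp add: sum_distrib_right) (rule sum.swap)
  also have "\<dots> = (\<Sum>z\<in>V. B * walks V w k z x)"
  proof (intro sum.cong refl)
    fix z assume z: "z \<in> V"
    have "(\<Sum>y\<in>V. w y z) = (\<Sum>y\<in>V. w z y)" by (intro sum.cong refl sym z)
    then show "(\<Sum>y\<in>V. w y z) * walks V w k z x = B * walks V w k z x" using row_sum[OF z] by simp
  qed
  also have "\<dots> = B ^ Suc k" using Suc by (simp add: sum_distrib_left[symmetric])
  finally show ?case .
qed

lemma walks_le: "x \<in> V \<Longrightarrow> y \<in> V \<Longrightarrow> walks V w k y x \<le> B ^ k"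
  unfolding walks_col_sum[of x k, symmetric]
  by (rule member_le_sum) (auto simp: fin walks_nonneg)

lemma green_summable:
  assumes "c > B" "x \<in> V" "y \<in> V"
  shows "summable (\<lambda>k. walks V w k x y / c ^ Suc k)"
proof (rule summable_comparison_test')
  show "summable (\<lambda>k. (B / c) ^ k * (1 / c))"
    using assms B_pos by (intro summable_mult2 summable_geometric) simp
  show "norm (walks V w k x y / c ^ Suc k) \<le> (B / c) ^ k * (1 / c)" for k
    using walks_le[OF assms(3,2), of k] walks_nonneg[OF assms(2), of k y] assms(1) B_pos
    by (simp add: power_divide divide_simps mult_right_mono)
qed

lemma log_density_summable:
  assumes c: "c > B" and x: "x \<in> V"
  shows "summable (\<lambda>k. walks V w (Suc k) x x / (real (Suc k) * c ^ Suc k))"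
proof (rule summable_comparison_test')
  show "summable (\<lambda>k. (B / c) * (B / c) ^ k)"
    using c B_pos by (intro summable_mult summable_geometric) simp
  fix k
  have cp: "c > 0" using c B_pos by simp
  have "norm (walks V w (Suc k) x x / (real (Suc k) * c ^ Suc k)) = walks V w (Suc k) x x / (real (Suc k) * c ^ Suc k)"
    using walks_nonneg[OF x, of "Suc k" x] cp by (simp del: walks.simps)
  also have "\<dots> \<le> B ^ Suc k / (1 * c ^ Suc k)"
    by (intro frac_le mult_mono walks_le[OF x x]) (use cp B_pos in auto)
  finally show "norm (walks V w (Suc k) x x / (real (Suc k) * c ^ Suc k)) \<le> (B / c) * (B / c) ^ k"
    by (simp add: power_divide)
qed

lemma green_nonneg: "c > B \<Longrightarrow> x \<in> V \<Longrightarrow> y \<in> V \<Longrightarrow> green V w c x y \<ge> 0"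
  unfolding green_def using B_pos
  by (intro suminf_nonneg green_summable divide_nonneg_nonneg walks_nonneg) auto

text \<open>Splitting off the term \<open>k = 0\<close> and shifting the index of the rest yields
  the resolvent equation.\<close>

lemma green_first_step:
  assumes c: "c > B" and x: "x \<in> V" and y: "y \<in> V"
  shows "c * green V w c x y = (if x = y then 1 else 0) + (\<Sum>z\<in>V. w x z * green V w c z y)"
proof -
  have cp: "c > 0" using c B_pos by simp
  let ?f = "\<lambda>x k. walks V w k x y / c ^ Suc k"
  have "green V w c x y = ?f x 0 + (suminf (\<lambda>k. ?f x (Suc k)))"
    using suminf_split_head[OF green_summable[OF c x y]] by (simp only: green_def)
  also have "suminf (\<lambda>k. ?f x (Suc k)) = suminf (\<lambda>k. \<Sum>z\<in>V. (w x z / c) * ?f z k)"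
    by (simp add: sum_divide_distrib)
  also have "\<dots> = (\<Sum>z\<in>V. suminf (\<lambda>k. (w x z / c) * ?f z k))"
    by (intro suminf_sum summable_mult green_summable c y)
  also have "\<dots> = (\<Sum>z\<in>V. (w x z / c) * green V w c z y)"
    unfolding green_def by (intro sum.cong refl suminf_mult green_summable c y)
  finally have "c * green V w c x y = c * ?f x 0 + (\<Sum>z\<in>V. c * ((w x z / c) * green V w c z y))"
    by (simp add: distrib_left sum_distrib_left)
  then show ?thesis using cp by (simp add: sum_distrib_left)
qed

text \<open>Constants are an eigenvector of \<open>w\<close> for \<open>B\<close>, hence of the
  resolvent at \<open>B + t\<close> for \<open>1 / t\<close>; concretely, summing the first-step
  equation over \<open>y\<close> cancels \<open>B\<close>.\<close>

lemma green_col_sum: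
  assumes t: "t > 0" and x: "x \<in> V"
  shows "(\<Sum>y\<in>V. green V w (B + t) y x) = 1 / t"
proof -
  let ?g = "\<lambda>y. green V w (B + t) y x"
  have "(B + t) * (\<Sum>y\<in>V. ?g y) = (\<Sum>y\<in>V. (if y = x then 1 else 0) + (\<Sum>z\<in>V. w y z * ?g z))"
    unfolding sum_distrib_left by (intro sum.cong refl green_first_step) (use t x in auto)
  also have "\<dots> = 1 + (\<Sum>z\<in>V. \<Sum>y\<in>V. w y z * ?g z)"
    using fin x by (simp add: sum.distrib sum.delta) (rule sum.swap)
  also have "(\<Sum>z\<in>V. \<Sum>y\<in>V. w y z * ?g z) = (\<Sum>z\<in>V. B * ?g z)"
  proof (intro sum.cong refl)
    fix z assume z: "z \<in> V"
    have "(\<Sum>y\<in>V. w y z) = (\<Sum>y\<in>V. w z y)" by (intro sum.cong refl sym z)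
    then show "(\<Sum>y\<in>V. w y z * ?g z) = B * ?g z"
      using row_sum[OF z] by (simp add: sum_distrib_right[symmetric])
  qed
  finally have "t * (\<Sum>y\<in>V. ?g y) = 1" by (simp add: sum_distrib_left[symmetric] algebra_simps)
  then show ?thesis using t by (simp add: field_simps)
qed

text \<open>Pairing the resolvent equation with \<open>g\<close> itself gives <g, (L + t) g> = g x,
  and the double sum is twice <g, L g> because each unordered pair is counted in both
  orders.\<close>

lemma green_energy:
  assumes t: "t > 0" and x: "x \<in> V"
  defines "g \<equiv> \<lambda>y. green V w (B + t) y x"
  shows "(\<Sum>y\<in>V. \<Sum>z\<in>V. w y z * (g y - g z)\<^sup>2) = 2 * (g x - t * (\<Sum>y\<in>V. (g y)\<^sup>2))"
proof -
  define S where "S = (\<Sum>y\<in>V. (g y)\<^sup>2)"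
  have "(\<Sum>y\<in>V. g y * ((B + t) * g y)) = (\<Sum>y\<in>V. g y * ((if y = x then 1 else 0) + (\<Sum>z\<in>V. w y z * g z)))"
    unfolding g_def by (intro sum.cong refl arg_cong2[where f = "(*)"] green_first_step) (use t x in auto)
  also have "\<dots> = g x + (\<Sum>y\<in>V. \<Sum>z\<in>V. w y z * (g y * g z))"
    using fin x by (simp add: distrib_left sum.distrib sum_distrib_left mult.left_commute if_distrib[of "\<lambda>u. _ * u"] sum.delta cong: if_cong)
  finally have e1: "(B + t) * S = g x + (\<Sum>y\<in>V. \<Sum>z\<in>V. w y z * (g y * g z))"
    by (simp add: S_def sum_distrib_left power2_eq_square mult.left_commute mult.assoc)
  have e2: "(\<Sum>y\<in>V. \<Sum>z\<in>V. w y z * (g y)\<^sup>2) = B * S"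
    by (simp add: S_def sum_distrib_right[symmetric] row_sum sum_distrib_left)
  have "(\<Sum>y\<in>V. \<Sum>z\<in>V. w y z * (g z)\<^sup>2) = (\<Sum>z\<in>V. \<Sum>y\<in>V. w y z * (g z)\<^sup>2)" by (rule sum.swap)
  also have "\<dots> = (\<Sum>z\<in>V. \<Sum>y\<in>V. w z y * (g z)\<^sup>2)" by (intro sum.cong refl arg_cong2[where f = "(*)"] sym)
  finally have e3: "(\<Sum>y\<in>V. \<Sum>z\<in>V. w y z * (g z)\<^sup>2) = B * S" using e2 by simp
  have "(\<Sum>y\<in>V. \<Sum>z\<in>V. w y z * (g y - g z)\<^sup>2)
      = (\<Sum>y\<in>V. \<Sum>z\<in>V. w y z * (g y)\<^sup>2 + w y z * (g z)\<^sup>2 - 2 * (w y z * (g y * g z)))"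
    by (intro sum.cong refl) (simp add: power2_diff algebra_simps)
  also have "\<dots> = B * S + B * S - 2 * ((B + t) * S - g x)"
    unfolding e1 by (simp add: sum.distrib sum_subtractf e2 e3 sum_distrib_left[symmetric])
  finally show ?thesis unfolding S_def by (simp add: algebra_simps)
qed

text \<open>
  The deviation of the diagonal from its equilibrium value controls the Dirichlet energy of
  \<open>green c _ x\<close>, by Cauchy--Schwarz applied to the column sum.
\<close>

lemma green_energy_le:
  assumes t: "t > 0" and x: "x \<in> V"
  defines "g \<equiv> \<lambda>y. green V w (B + t) y x"
  shows "(\<Sum>y\<in>V. \<Sum>z\<in>V. w y z * (g y - g z)\<^sup>2) \<le> 2 * (g x - 1 / (t * card V))"
proof -
  have m: "card V > 0" using x fin by (auto simp: card_gt_0_iff)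
  have "(1 / t)\<^sup>2 \<le> (\<Sum>y\<in>V. (g y)\<^sup>2) * card V"
    using Cauchy_Schwarz_ineq_sum[of g "\<lambda>_. 1" V] green_col_sum[OF t x] by (simp add: g_def)
  then have "1 / (t * card V) \<le> t * (\<Sum>y\<in>V. (g y)\<^sup>2)"
    using t m by (simp add: field_simps power2_eq_square)
  then show ?thesis using green_energy[OF t x] unfolding g_def by simp
qed

text \<open>The threshold 1 makes each neighbouring pair contribute at least its squared difference
  to the energy. In the application off-diagonal weights are edge counts, so distinct adjacent
  vertices qualify.\<close>

definition nbr :: "('a \<times> 'a) set" where
  "nbr = {(y, z). y \<in> V \<and> z \<in> V \<and> w y z \<ge> 1}"

text \<open>Meaningful when \<open>y\<close> can be reached from \<open>x\<close>; for other
  \<open>y\<close> the value is unspecified.\<close>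

definition dst :: "'a \<Rightarrow> 'a \<Rightarrow> nat" where
  "dst x y = (LEAST j. (x, y) \<in> nbr ^^ j)"

lemma dst_pred:
  assumes xy: "(x, y) \<in> nbr\<^sup>*" and d: "dst x y = Suc j"
  obtains z where "z \<in> V" "(x, z) \<in> nbr\<^sup>*" "dst x z = j" "(z, y) \<in> nbr"
proof -
  obtain i where "(x, y) \<in> nbr ^^ i" using xy rtrancl_power by blast
  then have "(x, y) \<in> nbr ^^ dst x y" unfolding dst_def by (rule LeastI)
  then obtain z where z: "(x, z) \<in> nbr ^^ j" "(z, y) \<in> nbr" unfolding d by auto
  have "dst x z \<le> j" unfolding dst_def using z(1) by (rule Least_le)
  moreover have "Suc j \<le> Suc (dst x z)"
  proof -
    have "(x, z) \<in> nbr ^^ dst x z" unfolding dst_def using z(1) by (rule LeastI)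
    then have "(x, y) \<in> nbr ^^ Suc (dst x z)" using z(2) by auto
    then show ?thesis unfolding d[symmetric] unfolding dst_def by (rule Least_le)
  qed
  moreover have "z \<in> V" using z(2) by (auto simp: nbr_def)
  ultimately show ?thesis using that z relpow_imp_rtrancl by fastforce
qed

lemma dst_layers:
  assumes "(x, y) \<in> nbr\<^sup>*" "i \<le> dst x y" "y \<in> V"
  obtains z where "z \<in> V" "(x, z) \<in> nbr\<^sup>*" "dst x z = i"
proof -
  have "\<exists>z\<in>V. (x, z) \<in> nbr\<^sup>* \<and> dst x z = i"
    using assms
  proof (induction "dst x y - i" arbitrary: y)
    case 0
    then show ?case by auto
  next
    case (Suc m)
    then obtain j where j: "dst x y = Suc j" by (cases "dst x y") auto
    obtain z where z: "z \<in> V" "(x, z) \<in> nbr\<^sup>*" "dst x z = j"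
      using dst_pred[OF Suc.prems(1) j] by blast
    show ?case by (rule Suc.hyps(1)[of z]) (use z j Suc.hyps(2) Suc.prems in auto)
  qed
  then show ?thesis using that by blast
qed

text \<open>Step \<open>i\<close> of a shortest path crosses from distance layer \<open>i\<close> to
  layer \<open>i + 1\<close> and is charged to the energy \<open>e i\<close> between these layers.
  Different \<open>i\<close> use disjoint sets of ordered pairs, so the \<open>e i\<close> add up to
  at most the total energy; Cauchy--Schwarz contributes the factor \<open>k\<close>.\<close>

lemma path_energy_bound:
  fixes g :: "'a \<Rightarrow> real"
  assumes y: "(x, y) \<in> nbr\<^sup>*" "dst x y \<le> k" and x: "x \<in> V"
  shows "(g x - g y)\<^sup>2 \<le> real k * (\<Sum>u\<in>V. \<Sum>v\<in>V. w u v * (g u - g v)\<^sup>2)"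
proof -
  define e where "e i = (\<Sum>u\<in>V. \<Sum>v\<in>V. if dst x u = i \<and> dst x v = Suc i then w u v * (g u - g v)\<^sup>2 else 0)" for i
  have term0: "w u v * (g u - g v)\<^sup>2 \<ge> 0" if "u \<in> V" "v \<in> V" for u v
    using nonneg[OF that] by simp
  have e0: "e i \<ge> 0" for i unfolding e_def by (intro sum_nonneg) (auto simp: term0)
  have "\<bar>g x - g y\<bar> \<le> (\<Sum>i<dst x y. sqrt (e i))"
    using y(1)
  proof (induction "dst x y" arbitrary: y)
    case 0
    obtain i where "(x, y) \<in> nbr ^^ i" using 0 rtrancl_power by blast
    then have "(x, y) \<in> nbr ^^ dst x y" unfolding dst_def by (rule LeastI)
    then show ?case using 0 by simp
  next
    case (Suc j)
    obtain z where z: "z \<in> V" "(x, z) \<in> nbr\<^sup>*" "dst x z = j" "(z, y) \<in> nbr"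
      using dst_pred[OF Suc.prems Suc.hyps(2)[symmetric]] by blast
    have yV: "y \<in> V" and w1: "w z y \<ge> 1" using z(4) by (auto simp: nbr_def)
    have "(g z - g y)\<^sup>2 \<le> w z y * (g z - g y)\<^sup>2"
      using mult_right_mono[OF w1, of "(g z - g y)\<^sup>2"] by simp
    also have "\<dots> \<le> (\<Sum>v\<in>V. if dst x z = j \<and> dst x v = Suc j then w z v * (g z - g v)\<^sup>2 else 0)"
      using member_le_sum[of y V "\<lambda>v. if dst x z = j \<and> dst x v = Suc j then w z v * (g z - g v)\<^sup>2 else 0"]
        fin yV term0 z Suc.hyps(2) by auto
    also have "\<dots> \<le> e j" unfolding e_def
      by (rule member_le_sum[OF z(1)]) (auto intro!: sum_nonneg term0 simp: fin)
    finally have "\<bar>g z - g y\<bar> \<le> sqrt (e j)" using real_le_rsqrt[of "\<bar>g z - g y\<bar>"] by simp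
    moreover have "\<bar>g x - g z\<bar> \<le> (\<Sum>i<j. sqrt (e i))" using Suc.hyps(1)[of z] z by simp
    ultimately show ?case unfolding Suc.hyps(2)[symmetric] by simp
  qed
  also have "\<dots> \<le> (\<Sum>i<k. sqrt (e i))" using y(2) e0 by (intro sum_mono2) auto
  finally have "(g x - g y)\<^sup>2 \<le> (\<Sum>i<k. 1 * sqrt (e i))\<^sup>2"
    using power_mono[of "\<bar>g x - g y\<bar>" _ 2] by simp
  also have "\<dots> \<le> (\<Sum>i<k. 1\<^sup>2) * (\<Sum>i<k. (sqrt (e i))\<^sup>2)" by (rule Cauchy_Schwarz_ineq_sum)
  also have "\<dots> = real k * (\<Sum>i<k. e i)" using e0 by simp
  also have "(\<Sum>i<k. e i) = (\<Sum>u\<in>V. \<Sum>v\<in>V. \<Sum>i<k. if dst x u = i \<and> dst x v = Suc i then w u v * (g u - g v)\<^sup>2 else 0)"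
    unfolding e_def by (subst sum.swap) (intro sum.cong refl sum.swap)
  also have "\<dots> \<le> (\<Sum>u\<in>V. \<Sum>v\<in>V. w u v * (g u - g v)\<^sup>2)"
  proof (intro sum_mono)
    fix u v assume uv: "u \<in> V" "v \<in> V"
    have "(\<Sum>i<k. if dst x u = i \<and> dst x v = Suc i then w u v * (g u - g v)\<^sup>2 else 0)
        \<le> (\<Sum>i<k. if i = dst x u then w u v * (g u - g v)\<^sup>2 else 0)"
      by (intro sum_mono) (auto simp: term0 uv)
    also have "\<dots> \<le> w u v * (g u - g v)\<^sup>2" using term0[OF uv] by (simp add: sum.delta)
    finally show "(\<Sum>i<k. if dst x u = i \<and> dst x v = Suc i then w u v * (g u - g v)\<^sup>2 else 0) \<le> w u v * (g u - g v)\<^sup>2" .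
  qed
  finally show ?thesis by (simp add: mult_left_mono)
qed

text \<open>A vertex with small \<open>g\<close> is found in one of two ways. If the graph reaches
  distance \<open>k\<close>, of order \<open>1 / sqrt t\<close>, the column sum \<open>1 / t\<close>
  spread over \<open>k\<close> layers forces a value at most \<open>1 / sqrt t\<close>; otherwise
  all vertices are within distance \<open>k\<close>, and one of them lies at or below the mean
  \<open>1 / (t m)\<close>. The energy bound, itself linear in the excess \<open>D\<close>, then
  controls the drop from \<open>x\<close> to that vertex.\<close>

lemma green_diag_bounds:
  fixes t :: real
  assumes t: "0 < t" "t \<le> 1" and x: "x \<in> V" and conn: "\<And>y. y \<in> V \<Longrightarrow> (x, y) \<in> nbr\<^sup>*"
  shows "1 / (t * card V) \<le> green V w (B + t) x x"
    and "green V w (B + t) x x \<le> 1 / (t * card V) + 8 / sqrt t"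
proof -
  define g where "g = (\<lambda>y. green V w (B + t) y x)"
  define m where "m = real (card V)"
  \<comment> \<open>At this length the averaging bound \<open>1 / (t k)\<close> and the energy cost,
    proportional to \<open>k\<close>, balance. Since \<open>s \<ge> 1\<close>, rounding up to
    \<open>k\<close> at most doubles it.\<close>
  define s where "s = 1 / sqrt t"
  define k where "k = nat \<lceil>s\<rceil>"
  define D where "D = g x - 1 / (t * m)"
  define E where "E = (\<Sum>u\<in>V. \<Sum>v\<in>V. w u v * (g u - g v)\<^sup>2)"
  have mpos: "m > 0" unfolding m_def using x fin by (auto simp: card_gt_0_iff)
  have s1: "s \<ge> 1" unfolding s_def using t by simp
  have kb: "s \<le> real k" "real k \<le> 2 * s" unfolding k_def using s1 by linarith+
  have tss: "t * s * s = 1" unfolding s_def using t by (simp add: field_simps)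
  have g0: "g y \<ge> 0" if "y \<in> V" for y unfolding g_def using green_nonneg that x t by simp
  have gs: "(\<Sum>y\<in>V. g y) = 1 / t" unfolding g_def by (rule green_col_sum) (use t x in auto)
  have E0: "E \<ge> 0" unfolding E_def by (intro sum_nonneg) (simp add: nonneg)
  have ED: "E \<le> 2 * D" using green_energy_le[OF t(1) x] unfolding E_def D_def g_def m_def by simp
  then have D0: "D \<ge> 0" using E0 by simp
  then show "1 / (t * card V) \<le> green V w (B + t) x x" unfolding D_def g_def m_def by simp
  have path: "(g x - g y)\<^sup>2 \<le> 4 * s * D * 1" if "y \<in> V" "dst x y \<le> k" for y
  proof -
    have "(g x - g y)\<^sup>2 \<le> real k * E" unfolding E_def by (rule path_energy_bound[OF conn[OF that(1)] that(2) x])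
    also have "\<dots> \<le> (2 * s) * (2 * D)" using kb ED E0 s1 by (intro mult_mono) auto
    finally show ?thesis by simp
  qed
  have "D \<le> 8 * s"
  proof (cases "\<exists>y\<in>V. dst x y \<ge> k")
    case True
    then obtain y where y: "y \<in> V" "dst x y \<ge> k" by blast
    have "\<exists>z. z \<in> V \<and> dst x z = i" if "i < k" for i
      using dst_layers[OF conn[OF y(1)], of i] y that by auto
    then have "\<exists>p. \<forall>i\<in>{..<k}. p i \<in> V \<and> dst x (p i) = i" by (intro bchoice) auto
    then obtain p where p: "\<And>i. i < k \<Longrightarrow> p i \<in> V \<and> dst x (p i) = i" by auto
    have inj: "inj_on p {..<k}" by (rule inj_on_inverseI[where g = "dst x"]) (use p in auto)
    have kp: "k > 0" using kb s1 by auto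
    \<comment> \<open>As \<open>s * s = 1 / t\<close>, values above \<open>s\<close> at
      \<open>k\<close> distinct vertices would exceed the column sum.\<close>
    have "\<exists>i<k. g (p i) \<le> s"
    proof (rule ccontr)
      assume "\<not> ?thesis"
      then have "(\<Sum>i<k. s) < (\<Sum>i<k. g (p i))" using kp by (intro sum_strict_mono) auto
      also have "\<dots> = (\<Sum>z\<in>p ` {..<k}. g z)" by (simp add: sum.reindex[OF inj])
      also have "\<dots> \<le> (\<Sum>z\<in>V. g z)" using p fin g0 by (intro sum_mono2) auto
      finally have "real k * s < 1 / t" using gs by simp
      moreover have "s * s \<le> real k * s" using kb s1 by (intro mult_right_mono) auto
      moreover have "s * s = 1 / t" using tss t by (simp add: field_simps)
      ultimately show False by simp
    qed
    then obtain i where i: "i < k" "g (p i) \<le> s" by blast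
    have gxD: "D \<le> g x" unfolding D_def using t mpos by simp
    have le: "(g x - g (p i))\<^sup>2 \<le> 4 * s * g x"
    proof -
      have "(g x - g (p i))\<^sup>2 \<le> 4 * s * D * 1" by (rule path) (use p[OF i(1)] i(1) in auto)
      also have "\<dots> \<le> 4 * s * g x" using mult_left_mono[OF gxD, of "4 * s"] s1 by simp
      finally show ?thesis .
    qed
    show ?thesis
    proof (rule ccontr)
      \<comment> \<open>Once \<open>g x > 8 s\<close>, the square of \<open>g x - s\<close> exceeds
        \<open>6 s g x\<close>, against the bound \<open>4 s g x\<close>.\<close>
      assume "\<not> D \<le> 8 * s"
      then have big: "g x > 8 * s" using gxD by simp
      then have "(g x - s)\<^sup>2 \<le> (g x - g (p i))\<^sup>2" using i(2) s1 by (intro power_mono) auto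
      then have "(g x - s)\<^sup>2 \<le> 4 * (s * g x)" using le by simp
      moreover have "(g x - s)\<^sup>2 = g x * g x - 2 * (s * g x) + s * s"
        by (simp add: power2_eq_square algebra_simps)
      moreover have "g x * g x > 8 * s * g x" using big s1 by (intro mult_strict_right_mono) auto
      moreover have "s * g x > 0" using big s1 by (intro mult_pos_pos) auto
      moreover have "s * s > 0" using s1 by simp
      ultimately show False by linarith
    qed
  next
    case False
    have "\<exists>y\<in>V. g y \<le> 1 / (t * m)"
    proof (rule ccontr)
      assume "\<not> ?thesis"
      then have "(\<Sum>y\<in>V. 1 / (t * m)) < (\<Sum>y\<in>V. g y)" using fin x by (intro sum_strict_mono) auto
      then show False using gs mpos t by (simp add: m_def)
    qed
    then obtain y where y: "y \<in> V" "g y \<le> 1 / (t * m)" by blast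
    have "D\<^sup>2 \<le> (g x - g y)\<^sup>2" using y(2) D0 unfolding D_def by (intro power_mono) auto
    also have "\<dots> \<le> 4 * s * D" using path[OF y(1)] False y(1) by (auto simp: not_le)
    finally have "D * D \<le> 4 * s * D" by (simp add: power2_eq_square)
    then have "D \<le> 4 * s" using D0 s1 by (cases "D = 0") auto
    then show ?thesis using s1 by simp
  qed
  then show "green V w (B + t) x x \<le> 1 / (t * card V) + 8 / sqrt t"
    unfolding D_def g_def m_def s_def by simp
qed

text \<open>In the variable \<open>u = 1 / (B + t)\<close> the density is, up to
  \<open>ln (B + t)\<close>, a power series whose coefficients carry a factor \<open>1 / n\<close>.
  Termwise differentiation cancels that factor, the chain rule contributes \<open>- u^2\<close>, and
  the Green series appears.\<close>

lemma log_density_deriv: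
  assumes t: "t > 0" and x: "x \<in> V"
  shows "((\<lambda>t. log_density V w (B + t) x) has_real_derivative green V w (B + t) x x) (at t)"
proof -
  define c where "c n = (if n = 0 then 0 else walks V w n x x / real n)" for n
  define u where "u = 1 / (B + t)"
  \<comment> \<open>A radius strictly between \<open>u\<close> and \<open>1 / B\<close> at which the
    series still converges, as termwise differentiation at \<open>u\<close> requires.\<close>
  define K where "K = 1 / (B + t / 2)"
  have Bt: "B + t > 0" using B_pos t by simp
  have wb: "0 \<le> walks V w n x x" "walks V w n x x \<le> B ^ n" for n
    using walks_nonneg[OF x] walks_le[OF x x] by auto
  have summ: "summable (\<lambda>n. c n * K ^ n)"
  proof (rule summable_comparison_test')
    show "summable (\<lambda>n. (B * K) ^ n)" using B_pos t by (intro summable_geometric) (simp add: K_def)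
    show "norm (c n * K ^ n) \<le> (B * K) ^ n" for n
    proof (cases "n = 0")
      case False
      have "norm (c n) \<le> B ^ n"
      proof -
        have "walks V w n x x / real n \<le> walks V w n x x / 1"
          using wb(1)[of n] False by (intro divide_left_mono) auto
        then show ?thesis using wb[of n] False by (simp add: c_def)
      qed
      moreover have "K > 0" using B_pos t by (simp add: K_def)
      ultimately show ?thesis by (simp add: power_mult_distrib abs_mult mult_right_mono)
    qed (simp add: c_def)
  qed
  have uK: "norm u < norm K" unfolding u_def K_def using B_pos t by (simp add: field_simps)
  have f: "DERIV (\<lambda>u. suminf (\<lambda>n. c n * u ^ n)) u :> suminf (\<lambda>n. diffs c n * u ^ n)"
    by (rule termdiffs_strong[OF summ uK])
  have du: "((\<lambda>t. 1 / (B + t)) has_real_derivative - (u\<^sup>2)) (at t)"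
    unfolding u_def using Bt by (auto intro!: derivative_eq_intros simp: power2_eq_square)
  have comp: "((\<lambda>t. suminf (\<lambda>n. c n * (1 / (B + t)) ^ n)) has_real_derivative
      (suminf (\<lambda>n. diffs c n * u ^ n)) * - (u\<^sup>2)) (at t)"
    using DERIV_chain2[of "\<lambda>u. suminf (\<lambda>n. c n * u ^ n)" _ "\<lambda>t. 1 / (B + t)", OF _ du] f u_def by simp
  have lnd: "((\<lambda>t. ln (B + t)) has_real_derivative u) (at t)"
    unfolding u_def using Bt by (auto intro!: derivative_eq_intros simp: field_simps)
  have d: "((\<lambda>t. ln (B + t) - (suminf (\<lambda>n. c n * (1 / (B + t)) ^ n))) has_real_derivative
      u + u\<^sup>2 * (suminf (\<lambda>n. diffs c n * u ^ n))) (at t)"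
    using DERIV_diff[OF lnd comp] by (simp add: mult.commute)
  have head: "suminf (\<lambda>n. c n * (1 / (B + s)) ^ n) = suminf (\<lambda>k. walks V w (Suc k) x x / (real (Suc k) * (B + s) ^ Suc k))"
    if s: "s > t / 2" for s
  proof -
    have "summable (\<lambda>n. c n * (1 / (B + s)) ^ n)"
      by (rule powser_inside[OF summ]) (use s B_pos t in \<open>simp add: K_def field_simps\<close>)
    then have "suminf (\<lambda>n. c n * (1 / (B + s)) ^ n) = suminf (\<lambda>n. c (Suc n) * (1 / (B + s)) ^ Suc n)"
      by (subst suminf_split_head) (auto simp: c_def)
    then show ?thesis by (simp add: c_def power_divide)
  qed
  have "eventually (\<lambda>s. s \<in> {t/2<..}) (nhds t)" by (rule eventually_nhds_in_open) (use t in auto)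
  then have ev: "eventually (\<lambda>s. ln (B + s) - (suminf (\<lambda>n. c n * (1 / (B + s)) ^ n)) = log_density V w (B + s) x) (nhds t)"
    by eventually_elim (simp add: log_density_def head)
  have val: "green V w (B + t) x x = u + u\<^sup>2 * (suminf (\<lambda>n. diffs c n * u ^ n))"
  proof -
    have s: "summable (\<lambda>k. walks V w k x x / (B + t) ^ Suc k)" using green_summable[of "B + t" x x] t x by simp
    have "green V w (B + t) x x = u + (suminf (\<lambda>k. walks V w (Suc k) x x / (B + t) ^ Suc (Suc k)))"
      using suminf_split_head[OF s] by (simp add: green_def u_def)
    also have "(\<lambda>k. walks V w (Suc k) x x / (B + t) ^ Suc (Suc k)) = (\<lambda>k. u\<^sup>2 * (diffs c k * u ^ k))"
      by (simp add: fun_eq_iff diffs_def c_def u_def power_divide power2_eq_square)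
    also have "suminf (\<lambda>k. u\<^sup>2 * (diffs c k * u ^ k)) = u\<^sup>2 * (suminf (\<lambda>k. diffs c k * u ^ k))"
      by (rule suminf_mult[OF termdiff_converges[of u "norm K"]]) (use uK summ in \<open>auto intro: powser_inside[OF summ]\<close>)
    finally show ?thesis .
  qed
  show ?thesis unfolding val using DERIV_cong_ev[OF refl ev refl] d by blast
qed

text \<open>Integrating the bounds on the Green function from 0 to \<open>t\<close>.\<close>

lemma log_density_sum_bounds:
  fixes t :: real
  assumes conn: "\<And>x y. x \<in> V \<Longrightarrow> y \<in> V \<Longrightarrow> (x, y) \<in> nbr\<^sup>*" and ne: "V \<noteq> {}"
    and lim: "((\<lambda>t. (\<Sum>x\<in>V. log_density V w (B + t) x) - ln t) \<longlongrightarrow> L) (at_right 0)"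
    and t: "0 < t" "t \<le> 1"
  shows "L + ln t \<le> (\<Sum>x\<in>V. log_density V w (B + t) x)"
    and "(\<Sum>x\<in>V. log_density V w (B + t) x) \<le> L + ln t + 16 * card V * sqrt t"
proof -
  \<comment> \<open>Subtracting \<open>ln t\<close> removes the contribution of the eigenvalue
    \<open>t\<close> of the constants; its derivative \<open>1 / t\<close> is the sum of the
    equilibrium values \<open>1 / (t m)\<close>.\<close>
  define F where "F t = (\<Sum>x\<in>V. log_density V w (B + t) x) - ln t" for t
  define F' where "F' t = (\<Sum>x\<in>V. green V w (B + t) x x) - 1 / t" for t
  have m: "real (card V) > 0" using ne fin by (auto simp: card_gt_0_iff)
  have dF: "(F has_real_derivative F' s) (at s)" if "s > 0" for s
    unfolding F_def F'_def using that
    by (intro DERIV_diff DERIV_sum log_density_deriv) (auto intro!: derivative_eq_intros)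
  have b: "0 \<le> F' s" "F' s \<le> 8 * card V / sqrt s" if s: "0 < s" "s \<le> 1" for s
  proof -
    have sp: "(\<Sum>x\<in>V. 1 / (s * card V)) = 1 / s" using m by simp
    have "(\<Sum>x\<in>V. 1 / (s * card V)) \<le> (\<Sum>x\<in>V. green V w (B + s) x x)"
      by (intro sum_mono green_diag_bounds(1)[OF s]) (auto intro: conn)
    then show "0 \<le> F' s" unfolding F'_def using sp by simp
    have "(\<Sum>x\<in>V. green V w (B + s) x x) \<le> (\<Sum>x\<in>V. 1 / (s * card V) + 8 / sqrt s)"
      by (intro sum_mono green_diag_bounds(2)[OF s]) (auto intro: conn)
    also have "\<dots> = 1 / s + 8 * card V / sqrt s" using m by (simp add: field_simps)
    finally show "F' s \<le> 8 * card V / sqrt s" unfolding F'_def by simp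
  qed
  have limF: "(F \<longlongrightarrow> L) (at_right 0)" using lim unfolding F_def .
  have mono: "F s \<le> F t" if "0 < s" "s \<le> t" for s
  proof (rule DERIV_nonneg_imp_nondecreasing[OF that(2)])
    fix r assume "s \<le> r" "r \<le> t"
    then show "\<exists>y. (F has_real_derivative y) (at r) \<and> 0 \<le> y"
      using dF[of r] b(1)[of r] that t by auto
  qed
  have ev: "eventually (\<lambda>s. s \<in> {0<..<t}) (at_right 0)" by (rule eventually_at_right_real) (use t in auto)
  have "L \<le> F t"
    by (rule tendsto_upperbound[OF limF]) (use ev in \<open>auto elim!: eventually_mono intro: mono\<close>)
  then show "L + ln t \<le> (\<Sum>x\<in>V. log_density V w (B + t) x)" unfolding F_def by simp
  \<comment> \<open>The constant 16 makes the derivative of \<open>16 m sqrt s\<close> equal to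
    \<open>8 m / sqrt s\<close>, the upper bound found for \<open>F'\<close>.\<close>
  define H where "H s = 16 * card V * sqrt s - F s" for s
  have mono2: "H s \<le> H t" if "0 < s" "s \<le> t" for s
  proof (rule DERIV_nonneg_imp_nondecreasing[OF that(2)])
    fix r assume r: "s \<le> r" "r \<le> t"
    then have r0: "r > 0" "r \<le> 1" using that t by auto
    have "(H has_real_derivative 16 * card V * (inverse (sqrt r) / 2) - F' r) (at r)"
      unfolding H_def by (intro DERIV_diff DERIV_cmult DERIV_real_sqrt dF r0)
    moreover have "0 \<le> 16 * card V * (inverse (sqrt r) / 2) - F' r"
      using b(2)[OF r0] by (simp add: field_simps)
    ultimately show "\<exists>y. (H has_real_derivative y) (at r) \<and> 0 \<le> y" by blast
  qed
  have limH: "(H \<longlongrightarrow> 16 * card V * sqrt 0 - L) (at_right 0)"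
    unfolding H_def by (intro tendsto_intros limF)
  have "16 * card V * sqrt 0 - L \<le> H t"
    by (rule tendsto_upperbound[OF limH]) (use ev in \<open>auto elim!: eventually_mono intro: mono2\<close>)
  then show "(\<Sum>x\<in>V. log_density V w (B + t) x) \<le> L + ln t + 16 * card V * sqrt t"
    unfolding H_def F_def by simp
qed

end

section \<open>Matrix tree theorem\<close>

definition adj :: "('v, 'e) multigraph \<Rightarrow> 'v \<Rightarrow> 'v \<Rightarrow> nat" where
  "adj H x y = (if x = y then 0 else card {e \<in> edges H. ends H e = {x, y}})"

definition graph_laplacian :: "('v, 'e) multigraph \<Rightarrow> real \<Rightarrow> 'v \<Rightarrow> 'v \<Rightarrow> real" where
  "graph_laplacian H t x y =
     (if x = y then real (nonloop_degree H x) + t else 0) - real (adj H x y)"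

text \<open>Multilinearity in the rows: each Leibniz product of row sums is expanded over all ways
  to choose one summand per vertex.\<close>

lemma det_expand_rows:
  fixes R :: "'c \<Rightarrow> 'v \<Rightarrow> 'v \<Rightarrow> 'r::comm_ring_1"
  assumes h: "bij_betw h {0..<m} V" and fin: "finite V" "\<And>x. x \<in> V \<Longrightarrow> finite (C x)"
  shows "det (mat m m (\<lambda>(i, j). \<Sum>c\<in>C (h i). R c (h i) (h j)))
       = (\<Sum>f\<in>PiE V C. det (mat m m (\<lambda>(i, j). R (f (h i)) (h i) (h j))))"
proof -
  have e: "(\<Prod>i = 0..<m. \<Sum>c\<in>C (h i). R c (h i) (h (p i))) =
      (\<Sum>f\<in>PiE V C. \<Prod>i = 0..<m. R (f (h i)) (h i) (h (p i)))" if p: "p permutes {0..<m}" for p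
  proof -
    \<comment> \<open>Leibniz products permute indices while the choices live on vertices;
      \<open>q\<close> is the permutation carried over along \<open>h\<close>.\<close>
    define q where "q x = h (p (inv_into {0..<m} h x))" for x
    have q: "q (h i) = h (p i)" if "i \<in> {0..<m}" for i
      unfolding q_def using that h by (simp add: bij_betw_inv_into_left)
    have "(\<Prod>i = 0..<m. \<Sum>c\<in>C (h i). R c (h i) (h (p i))) = (\<Prod>i = 0..<m. \<Sum>c\<in>C (h i). R c (h i) (q (h i)))"
      using q by (intro prod.cong refl) simp
    also have "\<dots> = (\<Prod>x\<in>V. \<Sum>c\<in>C x. R c x (q x))"
      by (rule prod.reindex_bij_betw[OF h])
    also have "\<dots> = (\<Sum>f\<in>PiE V C. \<Prod>x\<in>V. R (f x) x (q x))"
      by (rule prod_sum_PiE) (use fin in auto)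
    also have "\<dots> = (\<Sum>f\<in>PiE V C. \<Prod>i = 0..<m. R (f (h i)) (h i) (q (h i)))"
      by (intro sum.cong refl prod.reindex_bij_betw[OF h, symmetric])
    also have "\<dots> = (\<Sum>f\<in>PiE V C. \<Prod>i = 0..<m. R (f (h i)) (h i) (h (p i)))"
      using q by (intro sum.cong prod.cong refl) simp
    finally show ?thesis .
  qed
  have "det (mat m m (\<lambda>(i, j). \<Sum>c\<in>C (h i). R c (h i) (h j)))
      = (\<Sum>p | p permutes {0..<m}. signof p * (\<Prod>i = 0..<m. \<Sum>c\<in>C (h i). R c (h i) (h (p i))))"
    by (subst det_def'[where n = m])
      (auto intro!: sum.cong prod.cong arg_cong2[where f = "(*)"] simp: permutes_in_image permutes_nat_less)
  also have "\<dots> = (\<Sum>p | p permutes {0..<m}. \<Sum>f\<in>PiE V C. signof p * (\<Prod>i = 0..<m. R (f (h i)) (h i) (h (p i))))"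
    by (intro sum.cong refl) (simp add: e sum_distrib_left)
  also have "\<dots> = (\<Sum>f\<in>PiE V C. \<Sum>p | p permutes {0..<m}. signof p * (\<Prod>i = 0..<m. R (f (h i)) (h i) (h (p i))))"
    by (rule sum.swap)
  also have "\<dots> = (\<Sum>f\<in>PiE V C. det (mat m m (\<lambda>(i, j). R (f (h i)) (h i) (h j))))"
    by (intro sum.cong refl, subst det_def'[where n = m])
      (auto intro!: sum.cong prod.cong arg_cong2[where f = "(*)"] simp: permutes_in_image permutes_nat_less)
  finally show ?thesis .
qed

locale finite_multigraph =
  fixes H :: "('v, 'e) multigraph"
  assumes wf: "wf_multigraph H" and fin_verts: "finite (verts H)" and fin_edges: "finite (edges H)"
begin

definition inc :: "'v \<Rightarrow> 'e set" where
  "inc x = {e \<in> edges H. x \<in> ends H e \<and> ends H e \<noteq> {x}}"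

text \<open>Meaningful for \<open>e\<close> in \<open>inc x\<close>, where removing \<open>x\<close>
  from the endpoints leaves a singleton.\<close>

definition other :: "'e \<Rightarrow> 'v \<Rightarrow> 'v" where
  "other e x = the_elem (ends H e - {x})"

lemma inc_other:
  assumes "e \<in> inc x"
  shows "ends H e = {x, other e x}" "other e x \<noteq> x" "other e x \<in> verts H" "x \<in> verts H"
proof -
  have e: "e \<in> edges H" "x \<in> ends H e" "ends H e \<noteq> {x}" using assms by (auto simp: inc_def)
  then obtain u v where uv: "u \<in> verts H" "v \<in> verts H" "ends H e = {u, v}"
    using wf unfolding wf_multigraph_def by blast
  define y where "y = (if u = x then v else u)"
  have y: "ends H e = {x, y}" "y \<noteq> x" "y \<in> verts H" "x \<in> verts H" using uv e by (auto simp: y_def)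
  then have "ends H e - {x} = {y}" by auto
  then have "other e x = y" by (simp add: other_def)
  then show "ends H e = {x, other e x}" "other e x \<noteq> x" "other e x \<in> verts H" "x \<in> verts H" using y by auto
qed

lemma other_eqI: "ends H e = {x, y} \<Longrightarrow> x \<noteq> y \<Longrightarrow> other e x = y"
proof -
  assume "ends H e = {x, y}" "x \<noteq> y"
  then have "ends H e - {x} = {y}" by auto
  then show ?thesis by (simp add: other_def)
qed

lemma incI: "e \<in> edges H \<Longrightarrow> ends H e = {x, y} \<Longrightarrow> x \<noteq> y \<Longrightarrow> e \<in> inc x"
  by (auto simp: inc_def)

lemma fin_inc: "finite (inc x)" using fin_edges by (auto simp: inc_def)

lemma adj_inc: "x \<noteq> y \<Longrightarrow> adj H x y = card {e \<in> inc x. other e x = y}"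
  unfolding adj_def using inc_other other_eqI incI
  by (auto intro!: arg_cong[where f = card] simp: inc_def)

lemma adj_sym: "adj H x y = adj H y x" by (auto simp: adj_def insert_commute)

lemma sum_adj: "(\<Sum>y\<in>verts H. adj H x y) = nonloop_degree H x"
proof -
  have "nonloop_degree H x = card (inc x)" by (simp add: nonloop_degree_def inc_def)
  also have "\<dots> = (\<Sum>e\<in>inc x. 1)" by simp
  also have "\<dots> = (\<Sum>y\<in>verts H. \<Sum>e | e \<in> inc x \<and> other e x = y. 1)"
    by (rule sum.group[symmetric]) (use fin_inc fin_verts inc_other in auto)
  also have "\<dots> = (\<Sum>y\<in>verts H. adj H x y)"
  proof (intro sum.cong refl)
    fix y
    show "(\<Sum>e | e \<in> inc x \<and> other e x = y. 1) = adj H x y"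
    proof (cases "x = y")
      case True
      then have "{e. e \<in> inc x \<and> other e x = y} = {}" using inc_other by auto
      then show ?thesis using True by (simp only: adj_def) simp
    qed (simp add: adj_inc)
  qed
  finally show ?thesis by simp
qed

definition step_rel :: "'e set \<Rightarrow> ('v \<times> 'v) set" where
  "step_rel F = {(a, b). \<exists>e\<in>F. ends H e = {a, b}}"

lemma step_rel_sym: "(a, b) \<in> (step_rel F)\<^sup>* \<Longrightarrow> (b, a) \<in> (step_rel F)\<^sup>*"
proof -
  have "sym (step_rel F)" by (auto simp: sym_def step_rel_def insert_commute)
  then show "(a, b) \<in> (step_rel F)\<^sup>* \<Longrightarrow> (b, a) \<in> (step_rel F)\<^sup>*"
    using sym_rtrancl by (metis symD)
qed

lemma connected_iff:
  "connected_multigraph (H\<lparr>edges := F\<rparr>) \<longleftrightarrow>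
     verts H \<noteq> {} \<and> (\<forall>u\<in>verts H. \<forall>v\<in>verts H. (u, v) \<in> (step_rel F)\<^sup>*)"
  by (auto simp: connected_multigraph_def connected_rel_def step_rel_def)

text \<open>
  An arrow field sends every vertex either to \<open>None\<close>, making it a root, or to an incident edge,
  along which one walks to the other endpoint. It is acyclic when every walk ends in a root.
\<close>

definition arrows :: "('v \<Rightarrow> 'e option) set" where
  "arrows = PiE (verts H) (\<lambda>x. insert None (Some ` inc x))"

definition nxt :: "('v \<Rightarrow> 'e option) \<Rightarrow> 'v \<Rightarrow> 'v" where
  "nxt f x = (case f x of None \<Rightarrow> x | Some e \<Rightarrow> other e x)"

definition terminates :: "('v \<Rightarrow> 'e option) \<Rightarrow> 'v \<Rightarrow> bool" where
  "terminates f x \<longleftrightarrow> (\<exists>k. f ((nxt f ^^ k) x) = None)"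

definition depth :: "('v \<Rightarrow> 'e option) \<Rightarrow> 'v \<Rightarrow> nat" where
  "depth f x = (LEAST k. f ((nxt f ^^ k) x) = None)"

definition acyclic_arrows :: "('v \<Rightarrow> 'e option) set" where
  "acyclic_arrows = {f \<in> arrows. \<forall>x\<in>verts H. terminates f x}"

definition roots :: "('v \<Rightarrow> 'e option) \<Rightarrow> 'v set" where
  "roots f = {x \<in> verts H. f x = None}"

definition arrow_edges :: "('v \<Rightarrow> 'e option) \<Rightarrow> 'e set" where
  "arrow_edges f = {e. \<exists>x\<in>verts H. f x = Some e}"

text \<open>Row \<open>x\<close> of \<open>L + t\<close> is the sum of these rows over all possible
  arrows at \<open>x\<close>: every incident edge brings its own difference row, and the choice of
  \<open>x\<close> as a root brings \<open>t\<close>.\<close>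

definition arrow_row :: "real \<Rightarrow> 'e option \<Rightarrow> 'v \<Rightarrow> 'v \<Rightarrow> real" where
  "arrow_row t c x y = (case c of None \<Rightarrow> (if x = y then t else 0)
     | Some e \<Rightarrow> (if x = y then 1 else 0) - (if other e x = y then 1 else 0))"

lemma arrows_Some:
  assumes "f \<in> arrows" "x \<in> verts H" "f x = Some e"
  shows "e \<in> inc x" "nxt f x = other e x" "nxt f x \<in> verts H"
proof -
  show e: "e \<in> inc x" using assms by (force simp: arrows_def PiE_def Pi_def)
  show "nxt f x = other e x" using assms by (simp add: nxt_def)
  then show "nxt f x \<in> verts H" using inc_other[OF e] by simp
qed

lemma nxt_in: "f \<in> arrows \<Longrightarrow> x \<in> verts H \<Longrightarrow> nxt f x \<in> verts H"
  using arrows_Some(3)[of f x] by (cases "f x") (auto simp: nxt_def)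

lemma nxt_pow_in: "f \<in> arrows \<Longrightarrow> x \<in> verts H \<Longrightarrow> (nxt f ^^ k) x \<in> verts H"
  by (induction k) (auto intro: nxt_in)

lemma terminates_nxt:
  assumes "f x \<noteq> None"
  shows "terminates f x \<longleftrightarrow> terminates f (nxt f x)"
    and "terminates f x \<Longrightarrow> depth f x = Suc (depth f (nxt f x))"
proof -
  show iff: "terminates f x \<longleftrightarrow> terminates f (nxt f x)"
  proof
    assume "terminates f x"
    then obtain k where k: "f ((nxt f ^^ k) x) = None" by (auto simp: terminates_def)
    then obtain j where "k = Suc j" using assms by (cases k) auto
    then show "terminates f (nxt f x)" using k by (auto simp: terminates_def funpow_swap1)
  next
    assume "terminates f (nxt f x)"
    then obtain k where "f ((nxt f ^^ k) (nxt f x)) = None" by (auto simp: terminates_def)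
    then have "f ((nxt f ^^ Suc k) x) = None" by (simp add: funpow_swap1)
    then show "terminates f x" unfolding terminates_def by blast
  qed
  assume "terminates f x"
  then obtain k where k: "f ((nxt f ^^ k) x) = None" by (auto simp: terminates_def)
  have "(LEAST k. f ((nxt f ^^ k) x) = None) = Suc (LEAST k. f ((nxt f ^^ Suc k) x) = None)"
    by (rule Least_Suc[of _ k]) (use k assms in auto)
  then show "depth f x = Suc (depth f (nxt f x))" by (simp add: depth_def funpow_swap1)
qed

lemma terminates_rootI: "f x = None \<Longrightarrow> terminates f x"
  unfolding terminates_def by (rule exI[of _ 0]) simp

lemma not_terminates_closed:
  assumes "x \<in> S" "\<And>y. y \<in> S \<Longrightarrow> f y \<noteq> None \<and> nxt f y \<in> S"
  shows "\<not> terminates f x"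
proof -
  have "(nxt f ^^ k) x \<in> S" for k using assms by (induction k) auto
  then show ?thesis using assms(2) unfolding terminates_def by blast
qed

text \<open>A permutation with nonzero Leibniz product sends each vertex to itself or to the target
  of its arrow, which has smaller depth. Permutations preserve the sum of all depths, so only the
  identity survives, and its product collects one \<open>t\<close> per root.\<close>

lemma det_arrow_acyclic:
  assumes f: "f \<in> acyclic_arrows" and h: "bij_betw h {0..<m} (verts H)"
  shows "det (mat m m (\<lambda>(i, j). arrow_row t (f (h i)) (h i) (h j))) = t ^ card (roots f)"
proof -
  let ?R = "\<lambda>i j. arrow_row t (f (h i)) (h i) (h j)"
  have fa: "f \<in> arrows" and trm: "\<And>x. x \<in> verts H \<Longrightarrow> terminates f x"
    using f by (auto simp: acyclic_arrows_def)
  have hin: "h i \<in> verts H" if "i < m" for i using that h by (auto simp: bij_betw_def)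
  have hinj: "h i = h j \<longleftrightarrow> i = j" if "i < m" "j < m" for i j
    using that h by (auto simp: bij_betw_def inj_on_def)
  have zero: "(\<Prod>i = 0..<m. ?R i (p i)) = 0" if p: "p permutes {0..<m}" "p \<noteq> id" for p
  proof (rule ccontr)
    assume nz: "(\<Prod>i = 0..<m. ?R i (p i)) \<noteq> 0"
    have pm: "p i < m" if "i < m" for i using p(1) that permutes_in_image[of p "{0..<m}" i] by auto
    have cases: "p i = i \<or> depth f (h (p i)) < depth f (h i)" if i: "i < m" for i
    proof (rule ccontr)
      assume c: "\<not> ?thesis"
      then have ne: "h i \<noteq> h (p i)" using hinj[OF i pm[OF i]] by auto
      have "?R i (p i) = 0"
      proof (cases "f (h i)")
        case None
        then show ?thesis using ne by (simp add: arrow_row_def)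
      next
        case (Some e)
        have "depth f (h i) = Suc (depth f (nxt f (h i)))"
          by (rule terminates_nxt(2)) (use Some trm hin i in auto)
        then have "nxt f (h i) \<noteq> h (p i)" using c by auto
        then show ?thesis using Some ne by (simp add: arrow_row_def nxt_def)
      qed
      then show False using nz i by auto
    qed
    obtain i0 where i0: "p i0 \<noteq> i0" using p(2) by (auto simp: fun_eq_iff)
    then have i0m: "i0 < m" using p(1) permutes_not_in by fastforce
    have "(\<Sum>i = 0..<m. depth f (h (p i))) < (\<Sum>i = 0..<m. depth f (h i))"
    proof (rule sum_strict_mono_ex1)
      show "\<forall>x\<in>{0..<m}. depth f (h (p x)) \<le> depth f (h x)" using cases by fastforce
      show "\<exists>a\<in>{0..<m}. depth f (h (p a)) < depth f (h a)" using cases[OF i0m] i0 i0m by auto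
    qed simp
    moreover have "(\<Sum>i = 0..<m. depth f (h (p i))) = (\<Sum>i = 0..<m. depth f (h i))"
      using sum.permute[OF p(1), of "\<lambda>i. depth f (h i)"] by (simp add: o_def)
    ultimately show False by simp
  qed
  have pf: "finite {p. p permutes {0..<m}}" by (rule finite_permutations) simp
  have "det (mat m m (\<lambda>(i, j). ?R i j)) = (\<Sum>p | p permutes {0..<m}. signof p * (\<Prod>i = 0..<m. ?R i (p i)))"
    by (subst det_def'[where n = m])
      (auto intro!: sum.cong prod.cong arg_cong2[where f = "(*)"] simp: permutes_in_image permutes_nat_less)
  also have "\<dots> = (\<Sum>p\<in>{id}. signof p * (\<Prod>i = 0..<m. ?R i (p i)))"
    by (rule sum.mono_neutral_right[OF pf]) (auto simp: zero permutes_id)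
  also have "\<dots> = (\<Prod>i = 0..<m. ?R i i)" by simp
  also have "\<dots> = (\<Prod>x\<in>verts H. arrow_row t (f x) x x)"
    by (rule prod.reindex_bij_betw[OF h])
  also have "\<dots> = (\<Prod>x\<in>verts H. if f x = None then t else 1)"
  proof (intro prod.cong refl)
    fix x assume x: "x \<in> verts H"
    show "arrow_row t (f x) x x = (if f x = None then t else 1)"
      using arrows_Some(1)[OF fa x] inc_other(2) by (cases "f x") (auto simp: arrow_row_def)
  qed
  also have "\<dots> = t ^ card (roots f)"
    using fin_verts by (simp add: prod.If_cases roots_def Int_def)
  finally show ?thesis .
qed

text \<open>The indicator of the vertices from which no root is reached is a nonzero kernel vector:
  a vertex and its successor agree on termination, and roots have value 0.\<close>

lemma det_arrow_cyclic:
  assumes f: "f \<in> arrows" "f \<notin> acyclic_arrows" and h: "bij_betw h {0..<m} (verts H)"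
  shows "det (mat m m (\<lambda>(i, j). arrow_row t (f (h i)) (h i) (h j))) = 0"
proof -
  let ?A = "mat m m (\<lambda>(i, j). arrow_row t (f (h i)) (h i) (h j))"
  define u where "u x = (if terminates f x then 0 else 1 :: real)" for x
  define v where "v = vec m (\<lambda>i. u (h i))"
  obtain x where x: "x \<in> verts H" "\<not> terminates f x" using f by (auto simp: acyclic_arrows_def)
  then have "x \<in> h ` {0..<m}" using h by (simp add: bij_betw_def)
  then obtain i where i: "i < m" "h i = x" by auto
  have "vec_index v i = 1" using i x by (simp add: v_def u_def)
  then have nz: "v \<noteq> 0\<^sub>v m" using i(1) by auto
  have ker: "(\<Sum>y\<in>verts H. arrow_row t (f x) x y * u y) = 0" if x: "x \<in> verts H" for x
  proof (cases "f x")
    case None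
    then have "u x = 0" by (simp add: u_def terminates_rootI)
    have "(\<Sum>y\<in>verts H. arrow_row t (f x) x y * u y) = (\<Sum>y\<in>verts H. if x = y then t * u x else 0)"
      using None by (intro sum.cong refl) (simp add: arrow_row_def)
    then show ?thesis using \<open>u x = 0\<close> x fin_verts by simp
  next
    case (Some e)
    have n: "nxt f x = other e x" "nxt f x \<in> verts H" using arrows_Some[OF f(1) x Some] by auto
    have "(\<Sum>y\<in>verts H. arrow_row t (f x) x y * u y)
        = (\<Sum>y\<in>verts H. (if x = y then u y else 0) - (if nxt f x = y then u y else 0))"
      using Some n by (intro sum.cong refl) (simp add: arrow_row_def)
    also have "\<dots> = u x - u (nxt f x)"
      using x n fin_verts by (simp add: sum_subtractf)
    also have "\<dots> = 0" using terminates_nxt(1)[of f x] Some by (simp add: u_def)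
    finally show ?thesis .
  qed
  have "?A *\<^sub>v v = 0\<^sub>v m"
  proof (rule eq_vecI)
    fix i assume i: "i < dim_vec (0\<^sub>v m :: real vec)"
    then have im: "i < m" by simp
    then have "h i \<in> verts H" using h by (auto simp: bij_betw_def)
    have "vec_index (?A *\<^sub>v v) i = (\<Sum>j = 0..<m. arrow_row t (f (h i)) (h i) (h j) * u (h j))"
      using im by (simp add: scalar_prod_def v_def)
    also have "\<dots> = (\<Sum>y\<in>verts H. arrow_row t (f (h i)) (h i) y * u y)"
      by (rule sum.reindex_bij_betw[OF h])
    finally show "vec_index (?A *\<^sub>v v) i = vec_index (0\<^sub>v m) i" using ker[OF \<open>h i \<in> verts H\<close>] im by simp
  qed simp
  moreover have "v \<in> carrier_vec m" by (simp add: v_def)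
  ultimately show ?thesis using nz det_0_iff_vec_prod_zero[of ?A m] by auto
qed

text \<open>Acyclic arrow fields are the spanning forests with one root per tree, directed towards
  the roots. Expanding all rows yields the polynomial that counts them by number of trees.\<close>

theorem matrix_forest:
  assumes h: "bij_betw h {0..<m} (verts H)"
  shows "det (mat m m (\<lambda>(i, j). graph_laplacian H t (h i) (h j))) = (\<Sum>f\<in>acyclic_arrows. t ^ card (roots f))"
proof -
  let ?C = "\<lambda>x. insert None (Some ` inc x)"
  have row: "(\<Sum>c\<in>?C x. arrow_row t c x y) = graph_laplacian H t x y" for x y
  proof -
    have "(\<Sum>c\<in>?C x. arrow_row t c x y) = (if x = y then t else 0) + (\<Sum>e\<in>inc x. arrow_row t (Some e) x y)"
      using fin_inc by (subst sum.insert) (auto simp: arrow_row_def sum.reindex)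
    also have "(\<Sum>e\<in>inc x. arrow_row t (Some e) x y)
        = (\<Sum>e\<in>inc x. if x = y then 1 else 0) - (\<Sum>e\<in>inc x. if other e x = y then 1 else 0)"
      by (simp add: arrow_row_def sum_subtractf)
    also have "(\<Sum>e\<in>inc x. if x = y then 1 else (0::real)) = (if x = y then nonloop_degree H x else 0)"
      by (simp add: nonloop_degree_def inc_def)
    also have "(\<Sum>e\<in>inc x. if other e x = y then 1 else (0::real)) = adj H x y"
    proof (cases "x = y")
      case True
      then show ?thesis using inc_other(2) by (auto simp: adj_def intro!: sum.neutral)
    next
      case False
      then show ?thesis using fin_inc by (simp add: adj_inc sum.If_cases Int_def)
    qed
    finally show ?thesis by (simp add: graph_laplacian_def)
  qed
  have finA: "finite arrows" unfolding arrows_def using fin_verts fin_inc by (intro finite_PiE) auto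
  have "det (mat m m (\<lambda>(i, j). graph_laplacian H t (h i) (h j)))
      = det (mat m m (\<lambda>(i, j). \<Sum>c\<in>?C (h i). arrow_row t c (h i) (h j)))"
    by (simp add: row)
  also have "\<dots> = (\<Sum>f\<in>arrows. det (mat m m (\<lambda>(i, j). arrow_row t (f (h i)) (h i) (h j))))"
    unfolding arrows_def by (rule det_expand_rows[OF h fin_verts]) (use fin_inc in auto)
  also have "\<dots> = (\<Sum>f\<in>acyclic_arrows. det (mat m m (\<lambda>(i, j). arrow_row t (f (h i)) (h i) (h j))))"
    by (rule sum.mono_neutral_right[OF finA]) (auto simp: det_arrow_cyclic[OF _ _ h], simp add: acyclic_arrows_def)
  also have "\<dots> = (\<Sum>f\<in>acyclic_arrows. t ^ card (roots f))"
    by (intro sum.cong refl det_arrow_acyclic[OF _ h])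
  finally show ?thesis .
qed

section \<open>Spanning trees as acyclic arrow fields with a single root\<close>

lemma arrow_edges_subset: "f \<in> arrows \<Longrightarrow> arrow_edges f \<subseteq> edges H"
  using arrows_Some(1) unfolding arrow_edges_def inc_def by fastforce

lemma step_nxt: "f \<in> arrows \<Longrightarrow> x \<in> verts H \<Longrightarrow> (x, nxt f x) \<in> (step_rel (arrow_edges f))\<^sup>*"
proof (cases "f x")
  case (Some e)
  assume f: "f \<in> arrows" and x: "x \<in> verts H"
  have "e \<in> arrow_edges f" using x Some by (auto simp: arrow_edges_def)
  moreover have "ends H e = {x, nxt f x}" using arrows_Some[OF f x Some] inc_other(1) by simp
  ultimately show ?thesis by (auto simp: step_rel_def)
qed (simp add: nxt_def)

lemma reaches_root:
  assumes f: "f \<in> acyclic_arrows" and x: "x \<in> verts H"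
  obtains r where "r \<in> roots f" "(x, r) \<in> (step_rel (arrow_edges f))\<^sup>*"
proof -
  have fa: "f \<in> arrows" using f by (simp add: acyclic_arrows_def)
  obtain k where k: "f ((nxt f ^^ k) x) = None"
    using f x by (auto simp: acyclic_arrows_def terminates_def)
  have "(x, (nxt f ^^ k) x) \<in> (step_rel (arrow_edges f))\<^sup>*" for k
  proof (induction k)
    case (Suc k)
    then show ?case using step_nxt[OF fa nxt_pow_in[OF fa x, of k]] by simp
  qed simp
  then show ?thesis using that k nxt_pow_in[OF fa x, of k] by (auto simp: roots_def)
qed

lemma arrow_edges_connected:
  assumes f: "f \<in> acyclic_arrows" and r: "roots f = {r}" and u: "u \<in> verts H" and v: "v \<in> verts H"
  shows "(u, v) \<in> (step_rel (arrow_edges f))\<^sup>*"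
  using reaches_root[OF f u] reaches_root[OF f v] r step_rel_sym
  by (metis rtrancl_trans singletonD)

text \<open>Each edge of such a cycle is the arrow of one of its endpoints, and these lie on the
  cycle. A cycle has as many vertices as edges, so all its vertices carry arrows along it, and a
  walk starting there never meets a root.\<close>

lemma arrow_edges_no_cycle:
  assumes f: "f \<in> acyclic_arrows"
  shows "\<not> is_cycle (H\<lparr>edges := arrow_edges f\<rparr>) vs es"
proof
  assume c: "is_cycle (H\<lparr>edges := arrow_edges f\<rparr>) vs es"
  have fa: "f \<in> arrows" using f by (simp add: acyclic_arrows_def)
  have len: "length vs = length es" "es \<noteq> []" and dist: "distinct vs" "distinct es"
    and vsub: "set vs \<subseteq> verts H" and esub: "set es \<subseteq> arrow_edges f"
    and en: "\<And>i. i < length es \<Longrightarrow> ends H (es ! i) = {vs ! i, vs ! (Suc i mod length es)}"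
    using c by (auto simp: is_cycle_def)
  have ends_vs: "ends H e \<subseteq> set vs" if "e \<in> set es" for e
  proof -
    have "\<exists>i<length es. es ! i = e" using that by (simp only: in_set_conv_nth)
    then obtain i where i: "i < length es" "es ! i = e" by (elim exE conjE)
    have "Suc i mod length es < length vs" using len by simp
    moreover have "i < length vs" using i len by simp
    ultimately show ?thesis unfolding i(2)[symmetric] en[OF i(1)] by simp
  qed
  define S where "S = {v \<in> set vs. f v \<in> Some ` set es}"
  have "Some ` set es \<subseteq> f ` S"
  proof
    fix z assume "z \<in> Some ` set es"
    then obtain e where e: "e \<in> set es" "z = Some e" by auto
    then obtain x where x: "x \<in> verts H" "f x = Some e" using esub by (auto simp: arrow_edges_def)
    have "x \<in> ends H e" using inc_other(1)[OF arrows_Some(1)[OF fa x]] by auto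
    then have "x \<in> S" using ends_vs[OF e(1)] x e by (auto simp: S_def)
    then show "z \<in> f ` S" using x e by force
  qed
  then have "card (Some ` set es) \<le> card (f ` S)" by (intro card_mono) (auto simp: S_def)
  also have "\<dots> \<le> card S" by (rule card_image_le) (simp add: S_def)
  finally have "card (set vs) \<le> card S"
    using dist len by (simp add: card_image distinct_card)
  then have "S = set vs" by (intro card_seteq) (auto simp: S_def)
  moreover have "f y \<noteq> None \<and> nxt f y \<in> set vs" if "y \<in> S" for y
  proof -
    have "f y \<in> Some ` set es" "y \<in> set vs" using that by (simp_all add: S_def)
    then obtain e where e: "e \<in> set es" "f y = Some e" "y \<in> set vs" by (elim imageE)
    have yv: "y \<in> verts H" using e(3) vsub by blast
    have "nxt f y \<in> ends H e"
      unfolding arrows_Some(2)[OF fa yv e(2)]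
      by (subst inc_other(1)[OF arrows_Some(1)[OF fa yv e(2)]]) simp
    then have "nxt f y \<in> set vs" using ends_vs[OF e(1)] by blast
    then show ?thesis using e(2) by simp
  qed
  moreover have "vs ! 0 \<in> set vs" using len by simp
  ultimately have "\<not> terminates f (vs ! 0)" by (intro not_terminates_closed[of _ S]) auto
  then show False using f vsub \<open>vs ! 0 \<in> set vs\<close> by (auto simp: acyclic_arrows_def)
qed

lemma arrow_edges_tree:
  assumes f: "f \<in> acyclic_arrows" and r: "roots f = {r}"
  shows "arrow_edges f \<in> spanning_trees H"
proof -
  have "verts H \<noteq> {}" using r by (auto simp: roots_def)
  then show ?thesis
    using arrow_edges_subset[of f] arrow_edges_connected[OF f r] arrow_edges_no_cycle[OF f] f
    by (auto simp: spanning_trees_def is_tree_def connected_iff acyclic_arrows_def)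
qed

text \<open>Where the fields disagree, the arrow of \<open>g\<close> at \<open>x\<close> must be, in
  \<open>f\<close>, the arrow of the opposite endpoint; there \<open>g\<close> cannot use the same
  edge without going back and forth forever. Disagreement thus propagates along \<open>nxt g\<close>
  without meeting a root, against termination.\<close>

lemma arrows_eqI:
  assumes f: "f \<in> acyclic_arrows" "roots f = {r}" and g: "g \<in> acyclic_arrows" "roots g = {r}"
    and eq: "arrow_edges f = arrow_edges g"
  shows "f = g"
proof -
  have fa: "f \<in> arrows" and ga: "g \<in> arrows" using f g by (auto simp: acyclic_arrows_def)
  define S where "S = {x \<in> verts H. f x \<noteq> g x}"
  have cl: "g x \<noteq> None \<and> nxt g x \<in> S" if xS: "x \<in> S" for x
  proof -
    have x: "x \<in> verts H" "f x \<noteq> g x" using xS by (auto simp: S_def)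
    have gn: "g x \<noteq> None"
    proof
      assume "g x = None"
      then have "x \<in> roots g" using x by (simp add: roots_def)
      then have "x \<in> roots f" using f g by simp
      then show False using x \<open>g x = None\<close> by (simp add: roots_def)
    qed
    then obtain e where e: "g x = Some e" by auto
    then have "e \<in> arrow_edges f" using x eq by (auto simp: arrow_edges_def)
    then obtain y where y: "y \<in> verts H" "f y = Some e" by (auto simp: arrow_edges_def)
    have yx: "y \<noteq> x" using x y e by auto
    have ee: "ends H e = {x, other e x}" "ends H e = {y, other e y}"
      by (rule inc_other(1)[OF arrows_Some(1)[OF ga x(1) e]], rule inc_other(1)[OF arrows_Some(1)[OF fa y]])
    have "{x, other e x} = {y, other e y}" using ee(1)[symmetric] ee(2) by (rule trans)
    then have xy: "x = other e y \<and> other e x = y" using yx unfolding doubleton_eq_iff by argo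
    have n: "other e x = y" "other e y = x" by (rule conjunct2[OF xy], rule conjunct1[OF xy, symmetric])
    have "g y \<noteq> Some e"
    proof
      assume gy: "g y = Some e"
      have "\<not> terminates g x"
        by (rule not_terminates_closed[of x "{x, y}"]) (use e gy n in \<open>auto simp: nxt_def\<close>)
      then show False using g x by (auto simp: acyclic_arrows_def)
    qed
    then have "y \<in> S" using y by (auto simp: S_def)
    then show ?thesis using e n by (simp add: nxt_def)
  qed
  have "f x = g x" for x
  proof (cases "x \<in> verts H")
    case True
    show ?thesis
    proof (rule ccontr)
      assume "f x \<noteq> g x"
      then have "x \<in> S" using True by (simp add: S_def)
      then have "\<not> terminates g x" by (rule not_terminates_closed) (rule cl)
      then show False using g True by (auto simp: acyclic_arrows_def)
    qed
  next
    case False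
    then show ?thesis using fa ga by (auto simp: arrows_def PiE_def extensional_def)
  qed
  then show ?thesis by auto
qed

text \<open>Each vertex takes the first edge of a shortest path to \<open>r\<close>, so the distance
  to \<open>r\<close> strictly decreases along arrows.\<close>

lemma arrows_towards_root:
  assumes F: "F \<subseteq> edges H" and conn: "\<And>x. x \<in> verts H \<Longrightarrow> (x, r) \<in> (step_rel F)\<^sup>*" and r: "r \<in> verts H"
  obtains f where "f \<in> acyclic_arrows" "roots f = {r}" "arrow_edges f \<subseteq> F"
proof -
  define d where "d x = (LEAST k. (x, r) \<in> step_rel F ^^ k)" for x
  have dI: "(x, r) \<in> step_rel F ^^ d x" if "x \<in> verts H" for x
  proof -
    obtain k where "(x, r) \<in> step_rel F ^^ k" using conn[OF \<open>x \<in> verts H\<close>] rtrancl_power by blast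
    then show ?thesis unfolding d_def by (rule LeastI)
  qed
  have "\<exists>e\<in>F. e \<in> inc x \<and> d (other e x) < d x" if x: "x \<in> verts H" "x \<noteq> r" for x
  proof -
    obtain k where k: "d x = Suc k" using dI[OF x(1)] x(2) by (cases "d x") auto
    obtain y where y: "(x, y) \<in> step_rel F" "(y, r) \<in> step_rel F ^^ k"
      using dI[OF x(1)] unfolding k by (rule relpow_Suc_E2)
    have "d y \<le> k" unfolding d_def using y(2) by (rule Least_le)
    then have dy: "d y < d x" using k by simp
    obtain e where e: "e \<in> F" "ends H e = {x, y}" using y(1) by (auto simp: step_rel_def)
    have "x \<noteq> y" using dy by auto
    then show ?thesis using e F dy incI[of e x y] other_eqI[of e x y] by auto
  qed
  then have "\<exists>g. \<forall>x\<in>verts H - {r}. g x \<in> F \<and> g x \<in> inc x \<and> d (other (g x) x) < d x"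
    by (intro bchoice) auto
  then obtain g where g: "\<And>x. x \<in> verts H \<Longrightarrow> x \<noteq> r \<Longrightarrow> g x \<in> F \<and> g x \<in> inc x \<and> d (other (g x) x) < d x"
    by auto
  define f where "f x = (if x \<in> verts H then if x = r then None else Some (g x) else undefined)" for x
  have fa: "f \<in> arrows"
    unfolding arrows_def
  proof (rule PiE_I)
    fix x assume "x \<in> verts H"
    then show "f x \<in> insert None (Some ` inc x)" using g[of x] by (cases "x = r") (simp_all add: f_def)
  qed (simp add: f_def)
  have "terminates f x" if "x \<in> verts H" for x
    using that
  proof (induction "d x" arbitrary: x rule: less_induct)
    case less
    show ?case
    proof (cases "x = r")
      case True
      then show ?thesis using r by (intro terminates_rootI) (simp add: f_def)
    next
      case False
      have fx: "f x = Some (g x)" using False less.prems by (simp add: f_def)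
      have "terminates f (nxt f x)"
        by (rule less.hyps) (use fx g[OF less.prems False] nxt_in[OF fa less.prems] in \<open>auto simp: nxt_def\<close>)
      then show ?thesis using terminates_nxt(1)[of f x] fx by simp
    qed
  qed
  then have "f \<in> acyclic_arrows" using fa by (simp add: acyclic_arrows_def)
  moreover have "roots f = {r}" using r by (auto simp: roots_def f_def)
  moreover have "arrow_edges f \<subseteq> F" using g by (auto simp: arrow_edges_def f_def split: if_splits)
  ultimately show ?thesis by (rule that)
qed

text \<open>A shortest path in \<open>F\<close> is closed up by \<open>e\<close>; distances from
  \<open>u\<close> differ along it, hence so do its vertices. For \<open>u = v\<close> the path is
  empty and the cycle is the loop \<open>e\<close>.\<close>

lemma cycle_through_edge:
  assumes uv: "(u, v) \<in> (step_rel F)\<^sup>*" and u: "u \<in> verts H" and F: "F \<subseteq> edges H" "F \<subseteq> F'"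
    and e: "e \<in> F'" "e \<notin> F" "ends H e = {u, v}"
  obtains vs es where "is_cycle (H\<lparr>edges := F'\<rparr>) vs es"
proof -
  define d where "d x = (LEAST k. (u, x) \<in> step_rel F ^^ k)" for x
  obtain k0 where "(u, v) \<in> step_rel F ^^ k0" using uv rtrancl_power by blast
  then have "(u, v) \<in> step_rel F ^^ d v" unfolding d_def by (rule LeastI)
  then obtain p where p: "p 0 = u" "p (d v) = v" "\<And>i. i < d v \<Longrightarrow> (p i, p (Suc i)) \<in> step_rel F"
    by (auto simp: relpow_fun_conv)
  define n where "n = d v"
  note p = p[folded n_def]
  have fwd: "(u, p i) \<in> step_rel F ^^ i" if "i \<le> n" for i
    using that
  proof (induction i)
    case (Suc i)
    then show ?case using p(3)[of i] by auto
  qed (simp add: p)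
  have bwd: "(p i, v) \<in> step_rel F ^^ (n - i)" if "i \<le> n" for i
    unfolding relpow_fun_conv by (rule exI[of _ "\<lambda>j. p (i + j)"]) (use p that in auto)
  have dp: "d (p i) = i" if i: "i \<le> n" for i
  proof -
    have le: "d (p i) \<le> i" unfolding d_def using fwd[OF i] by (rule Least_le)
    have "(u, p i) \<in> step_rel F ^^ d (p i)" unfolding d_def using fwd[OF i] by (rule LeastI)
    then have "(u, v) \<in> step_rel F ^^ (d (p i) + (n - i))"
      using bwd[OF i] by (auto simp: relpow_add)
    then have "n \<le> d (p i) + (n - i)" unfolding n_def d_def[of v] by (rule Least_le)
    then show ?thesis using le i by simp
  qed
  have inj: "p i = p j \<longleftrightarrow> i = j" if "i \<le> n" "j \<le> n" for i j using dp that by metis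
  have "\<exists>q. \<forall>i\<in>{..<n}. q i \<in> F \<and> ends H (q i) = {p i, p (Suc i)}"
    using p(3) by (intro bchoice) (auto simp: step_rel_def)
  then obtain q where q: "\<And>i. i < n \<Longrightarrow> q i \<in> F \<and> ends H (q i) = {p i, p (Suc i)}" by auto
  have qinj: "inj_on q {0..<n}"
  proof (rule inj_onI)
    fix i j assume ij: "i \<in> {0..<n}" "j \<in> {0..<n}" "q i = q j"
    then have "{p i, p (Suc i)} = {p j, p (Suc j)}" using q[of i] q[of j] by simp
    then show "i = j" using ij inj by (auto simp: doubleton_eq_iff)
  qed
  have pv: "p i \<in> verts H" if "i \<le> n" for i
  proof (cases i)
    case 0
    then show ?thesis using p u by simp
  next
    case (Suc j)
    then have "q j \<in> edges H" "p i \<in> ends H (q j)" using q[of j] that F by auto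
    then show ?thesis using wf unfolding wf_multigraph_def by fastforce
  qed
  define vs where "vs = map p [0..<Suc n]"
  define es where "es = map q [0..<n] @ [e]"
  have "is_cycle (H\<lparr>edges := F'\<rparr>) vs es"
    unfolding is_cycle_def
  proof (intro conjI allI impI)
    show "distinct vs" unfolding vs_def distinct_map using inj by (auto simp: inj_on_def)
    show "distinct es" unfolding es_def using qinj q e(2) by (auto simp: distinct_map)
    show "set vs \<subseteq> verts (H\<lparr>edges := F'\<rparr>)" using pv by (auto simp: vs_def)
    show "set es \<subseteq> edges (H\<lparr>edges := F'\<rparr>)" using q e F by (auto simp: es_def)
    fix i assume i: "i < length es"
    show "ends (H\<lparr>edges := F'\<rparr>) (es ! i) = {vs ! i, vs ! (Suc i mod length es)}"
    proof (cases "i < n")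
      case True
      then show ?thesis using q[OF True] by (simp add: es_def vs_def nth_append del: upt_Suc)
    next
      case False
      then have "i = n" using i by (simp add: es_def)
      then show ?thesis using e p by (auto simp: es_def vs_def nth_append simp del: upt_Suc)
    qed
  qed (auto simp: vs_def es_def)
  then show ?thesis by (rule that)
qed

text \<open>Arrows towards \<open>r\<close> chosen inside \<open>F\<close> already connect all
  vertices, so a leftover edge of \<open>F\<close> would close a cycle.\<close>

lemma spanning_tree_arrows:
  assumes F: "F \<in> spanning_trees H" and r: "r \<in> verts H"
  obtains f where "f \<in> acyclic_arrows" "roots f = {r}" "arrow_edges f = F"
proof -
  have FE: "F \<subseteq> edges H" and conn: "\<And>u v. u \<in> verts H \<Longrightarrow> v \<in> verts H \<Longrightarrow> (u, v) \<in> (step_rel F)\<^sup>*"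
    and nocyc: "\<And>vs es. \<not> is_cycle (H\<lparr>edges := F\<rparr>) vs es"
    using F by (auto simp: spanning_trees_def is_tree_def connected_iff)
  obtain f where f: "f \<in> acyclic_arrows" "roots f = {r}" "arrow_edges f \<subseteq> F"
    by (rule arrows_towards_root[OF FE conn[OF _ r] r])
  have "e \<in> arrow_edges f" if e: "e \<in> F" for e
  proof (rule ccontr)
    assume ne: "e \<notin> arrow_edges f"
    have eE: "e \<in> edges H" using e FE by (rule rev_subsetD)
    then obtain u v where uv: "u \<in> verts H" "v \<in> verts H" "ends H e = {u, v}"
      using wf unfolding wf_multigraph_def by blast
    obtain vs es where "is_cycle (H\<lparr>edges := F\<rparr>) vs es"
      by (rule cycle_through_edge[OF arrow_edges_connected[OF f(1,2) uv(1,2)] uv(1) subset_trans[OF f(3) FE] f(3) e ne uv(3)])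
    then show False using nocyc by simp
  qed
  then have "arrow_edges f = F" using f(3) by auto
  then show ?thesis by (rule that[OF f(1,2)])
qed

text \<open>A tree can be directed towards a prescribed root in exactly one way.\<close>

lemma card_single_root_arrows:
  "card {f \<in> acyclic_arrows. card (roots f) = 1} = card (verts H) * card (spanning_trees H)"
proof -
  let ?A = "{f \<in> acyclic_arrows. card (roots f) = 1}"
  have r: "\<exists>r. roots f = {r}" if "f \<in> ?A" for f using that by (auto simp: card_1_singleton_iff)
  have "bij_betw (\<lambda>f. (the_elem (roots f), arrow_edges f)) ?A (verts H \<times> spanning_trees H)"
    unfolding bij_betw_def
  proof
    show "inj_on (\<lambda>f. (the_elem (roots f), arrow_edges f)) ?A"
    proof (rule inj_onI)
      fix f g assume fg: "f \<in> ?A" "g \<in> ?A" "(the_elem (roots f), arrow_edges f) = (the_elem (roots g), arrow_edges g)"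
      obtain a where a: "roots f = {a}" using r[OF fg(1)] by (elim exE)
      obtain b where b: "roots g = {b}" using r[OF fg(2)] by (elim exE)
      have "a = b" "arrow_edges f = arrow_edges g" using fg(3) by (simp_all add: a b)
      then show "f = g" using fg(1,2) a b by (intro arrows_eqI[of f a g]) simp_all
    qed
    show "(\<lambda>f. (the_elem (roots f), arrow_edges f)) ` ?A = verts H \<times> spanning_trees H"
    proof (intro equalityI subsetI)
      fix z assume "z \<in> (\<lambda>f. (the_elem (roots f), arrow_edges f)) ` ?A"
      then obtain f where f: "f \<in> ?A" "z = (the_elem (roots f), arrow_edges f)" by auto
      obtain a where a: "roots f = {a}" using r[OF f(1)] by (elim exE)
      have "a \<in> roots f" by (simp add: a)
      then have "a \<in> verts H" by (simp add: roots_def)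
      moreover have "arrow_edges f \<in> spanning_trees H" using f(1) a by (intro arrow_edges_tree[of f a]) simp_all
      ultimately show "z \<in> verts H \<times> spanning_trees H" by (simp add: f(2) a)
    next
      fix z assume z: "z \<in> verts H \<times> spanning_trees H"
      obtain f where f: "f \<in> acyclic_arrows" "roots f = {fst z}" "arrow_edges f = snd z"
        by (rule spanning_tree_arrows[of "snd z" "fst z"]) (use z in auto)
      then show "z \<in> (\<lambda>f. (the_elem (roots f), arrow_edges f)) ` ?A"
        by (intro image_eqI[of _ _ f]) simp_all
    qed
  qed
  then show ?thesis by (simp add: bij_betw_same_card card_cartesian_product)
qed

lemma finite_acyclic_arrows: "finite acyclic_arrows"
proof (rule finite_subset)
  show "acyclic_arrows \<subseteq> arrows" by (simp add: acyclic_arrows_def)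
  show "finite arrows" unfolding arrows_def using fin_verts fin_inc by (intro finite_PiE) auto
qed

lemma card_roots_pos:
  assumes "f \<in> acyclic_arrows" "verts H \<noteq> {}"
  shows "card (roots f) \<noteq> 0"
proof -
  obtain x where "x \<in> verts H" using assms by blast
  then have "roots f \<noteq> {}" using reaches_root[OF assms(1)] by blast
  then show ?thesis using fin_verts by (simp add: roots_def)
qed

lemma spanning_tree_exists:
  assumes "connected_multigraph H"
  shows "card (spanning_trees H) > 0"
proof -
  have conn: "\<And>u v. u \<in> verts H \<Longrightarrow> v \<in> verts H \<Longrightarrow> (u, v) \<in> (step_rel (edges H))\<^sup>*" and ne: "verts H \<noteq> {}"
    using assms connected_iff[of "edges H"] by auto
  obtain r where r: "r \<in> verts H" using ne by blast
  obtain f where "f \<in> acyclic_arrows" "roots f = {r}"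
    by (rule arrows_towards_root[OF subset_refl conn[OF _ r] r])
  then have "arrow_edges f \<in> spanning_trees H" by (rule arrow_edges_tree)
  moreover have "finite (spanning_trees H)"
    by (rule finite_subset[of _ "Pow (edges H)"]) (auto simp: spanning_trees_def fin_edges)
  ultimately show ?thesis by (auto simp: card_gt_0_iff)
qed

text \<open>The forest polynomial has no constant term; after division by \<open>t\<close> its value
  at 0 is the number of fields with a single root.\<close>

theorem matrix_tree_limit:
  assumes h: "bij_betw h {0..<m} (verts H)" and ne: "verts H \<noteq> {}"
  shows "((\<lambda>t. det (mat m m (\<lambda>(i, j). graph_laplacian H t (h i) (h j))) / t)
           \<longlongrightarrow> real (card (verts H)) * real (card (spanning_trees H))) (at_right 0)"
proof -
  have "((\<lambda>t::real. \<Sum>f\<in>acyclic_arrows. t ^ (card (roots f) - 1)) \<longlongrightarrow>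
      (\<Sum>f\<in>acyclic_arrows. 0 ^ (card (roots f) - 1))) (at_right 0)"
    by (intro tendsto_intros)
  \<comment> \<open>Here \<open>0 ^ 0 = 1\<close> selects the fields with one root. A field without
    roots, for which the truncated exponent would also be 0, is excluded because there is a
    vertex.\<close>
  also have "(\<Sum>f\<in>acyclic_arrows. (0::real) ^ (card (roots f) - 1))
      = (\<Sum>f\<in>acyclic_arrows. if card (roots f) = 1 then 1 else 0)"
  proof (intro sum.cong refl)
    fix f assume "f \<in> acyclic_arrows"
    then have "card (roots f) \<noteq> 0" using card_roots_pos ne by blast
    then show "(0::real) ^ (card (roots f) - 1) = (if card (roots f) = 1 then 1 else 0)"
      by (cases "card (roots f)") auto
  qed
  also have "\<dots> = real (card {f \<in> acyclic_arrows. card (roots f) = 1})"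
    using finite_acyclic_arrows by (simp add: sum.If_cases Int_def)
  also have "\<dots> = real (card (verts H)) * real (card (spanning_trees H))"
    using arg_cong[OF card_single_root_arrows, of real] by simp
  finally show ?thesis
  proof (rule Lim_transform_eventually)
    show "eventually (\<lambda>t. (\<Sum>f\<in>acyclic_arrows. t ^ (card (roots f) - 1)) =
        det (mat m m (\<lambda>(i, j). graph_laplacian H t (h i) (h j))) / t) (at_right 0)"
      using eventually_at_right_less[of "0::real"]
    proof eventually_elim
      case (elim t)
      have "t ^ (card (roots f) - 1) = t ^ card (roots f) / t" if "f \<in> acyclic_arrows" for f
        using card_roots_pos[OF that ne] elim by (cases "card (roots f)") auto
      then show ?case by (simp add: matrix_forest[OF h] sum_divide_distrib)
    qed
  qed
qed

end

text \<open>The entry of \<open>B - L\<close>: the amount by which the degree of \<open>x\<close>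
  falls short of \<open>B\<close> becomes the weight of staying at \<open>x\<close>.\<close>

definition lazy_weight :: "('v, 'e) multigraph \<Rightarrow> real \<Rightarrow> 'v \<Rightarrow> 'v \<Rightarrow> real" where
  "lazy_weight H B x y = (if x = y then B - real (nonloop_degree H x) else 0) + real (adj H x y)"

context finite_chain
begin

text \<open>Traces of powers of the weight matrix are sums over closed walks, so the series for the
  logarithm of the determinant splits over base points.\<close>

lemma sum_log_density:
  assumes h: "bij_betw h {0..<m} V" and c: "c > B"
  shows "(\<Sum>x\<in>V. log_density V w c x)
       = ln \<bar>det (mat m m (\<lambda>(i, j). (if h i = h j then c else 0) - w (h i) (h j)))\<bar>"
    and "det (mat m m (\<lambda>(i, j). (if h i = h j then c else 0) - w (h i) (h j))) \<noteq> 0"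
proof -
  let ?W = "mat m m (\<lambda>(i, j). w (h i) (h j))"
  let ?D = "mat m m (\<lambda>(i, j). (if h i = h j then c else 0) - w (h i) (h j))"
  let ?C = "map_mat complex_of_real ?W"
  have cp: "c > 0" using c B_pos by simp
  have hV: "h i \<in> V" if "i < m" for i using h that by (auto simp: bij_betw_def)
  have hinj: "h i = h j \<longleftrightarrow> i = j" if "i < m" "j < m" for i j
    using that h by (auto simp: bij_betw_def inj_on_def)
  have mV: "card V = m" using bij_betw_same_card[OF h] by simp
  have C: "?C \<in> carrier_mat m m" by simp
  have rows: "(\<Sum>j<m. cmod (?C $$ (i, j))) \<le> B" if i: "i < m" for i
  proof -
    have "(\<Sum>j<m. cmod (?C $$ (i, j))) = (\<Sum>j = 0..<m. w (h i) (h j))"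
      unfolding atLeast0LessThan using i hV nonneg by (intro sum.cong refl) auto
    also have "\<dots> = (\<Sum>y\<in>V. w (h i) y)" by (rule sum.reindex_bij_betw[OF h])
    finally show ?thesis using row_sum[OF hV[OF i]] by simp
  qed
  have hom: "comm_ring_hom complex_of_real" by unfold_locales auto
  have "of_real c \<cdot>\<^sub>m 1\<^sub>m m - ?C = map_mat complex_of_real ?D"
    using hinj by (intro eq_matI) auto
  then have d: "det (of_real c \<cdot>\<^sub>m 1\<^sub>m m - ?C) = of_real (det ?D)"
    by (simp add: comm_ring_hom.hom_det[OF hom])
  show "det ?D \<noteq> 0" using ln_cmod_det_sums(2)[OF C rows c cp] unfolding d by auto
  have tr: "Re (\<Sum>i<m. (?C ^\<^sub>m k) $$ (i, i)) = (\<Sum>x\<in>V. walks V w k x x)" for k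
  proof -
    have "?C ^\<^sub>m k = map_mat complex_of_real (?W ^\<^sub>m k)"
      using of_real_hom.mat_hom_pow[of ?W m k, where 'a = complex] by simp
    then have "Re (\<Sum>i<m. (?C ^\<^sub>m k) $$ (i, i)) = (\<Sum>i = 0..<m. walks V w k (h i) (h i))"
      unfolding atLeast0LessThan using walks_mat_pow[OF h fin, of _ _ w k]
      by (simp add: Re_sum)
    also have "\<dots> = (\<Sum>x\<in>V. walks V w k x x)" by (rule sum.reindex_bij_betw[OF h])
    finally show ?thesis .
  qed
  have s1: "(\<lambda>k. (\<Sum>x\<in>V. walks V w (Suc k) x x) / (real (Suc k) * c ^ Suc k))
      sums (real m * ln c - ln \<bar>det ?D\<bar>)"
    using ln_cmod_det_sums(1)[OF C rows c cp] unfolding tr d norm_of_real .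
  have "(\<lambda>k. \<Sum>x\<in>V. walks V w (Suc k) x x / (real (Suc k) * c ^ Suc k))
      sums (\<Sum>x\<in>V. suminf (\<lambda>k. walks V w (Suc k) x x / (real (Suc k) * c ^ Suc k)))"
    by (intro sums_sum summable_sums log_density_summable c)
  then have "(\<Sum>x\<in>V. suminf (\<lambda>k. walks V w (Suc k) x x / (real (Suc k) * c ^ Suc k)))
      = real m * ln c - ln \<bar>det ?D\<bar>"
    using s1 unfolding sum_divide_distrib by (rule sums_unique2)
  then show "(\<Sum>x\<in>V. log_density V w c x) = ln \<bar>det ?D\<bar>"
    unfolding log_density_def sum_subtractf by (simp add: mV)
qed

end

context finite_multigraph
begin

lemma finite_chain_lazy:
  assumes "\<And>x. x \<in> verts H \<Longrightarrow> real (nonloop_degree H x) \<le> B" "B > 0"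
  shows "finite_chain (verts H) (lazy_weight H B) B"
proof
  show "finite (verts H)" by (rule fin_verts)
  fix x y assume x: "x \<in> verts H"
  show "lazy_weight H B x y \<ge> 0" using assms(1)[OF x] by (auto simp: lazy_weight_def)
  show "lazy_weight H B x y = lazy_weight H B y x" by (simp add: lazy_weight_def adj_sym)
  show "(\<Sum>y\<in>verts H. lazy_weight H B x y) = B"
    unfolding lazy_weight_def sum.distrib of_nat_sum[symmetric] sum_adj
    using x fin_verts by simp
qed (rule assms)

text \<open>The chain with \<open>lazy_weight\<close> at parameter \<open>B + t\<close> has the
  determinant of \<open>graph_laplacian\<close> at \<open>t\<close>, so the matrix tree theorem
  supplies the limit at 0 from which \<open>log_density_sum_bounds\<close> starts.\<close>

theorem log_spanning_trees_bounds:
  fixes t :: real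
  assumes conn: "connected_multigraph H"
    and B: "\<And>x. x \<in> verts H \<Longrightarrow> real (nonloop_degree H x) \<le> B" "B > 0" and t: "0 < t" "t \<le> 1"
  defines "L \<equiv> ln (real (card (verts H))) + ln (real (card (spanning_trees H)))"
  shows "L + ln t \<le> (\<Sum>x\<in>verts H. log_density (verts H) (lazy_weight H B) (B + t) x)"
    and "(\<Sum>x\<in>verts H. log_density (verts H) (lazy_weight H B) (B + t) x)
           \<le> L + ln t + 16 * card (verts H) * sqrt t"
proof -
  interpret chain: finite_chain "verts H" "lazy_weight H B" B by (rule finite_chain_lazy[OF B])
  have ne: "verts H \<noteq> {}" and
    cn: "\<And>u v. u \<in> verts H \<Longrightarrow> v \<in> verts H \<Longrightarrow> (u, v) \<in> (step_rel (edges H))\<^sup>*"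
    using conn connected_iff[of "edges H"] by auto
  have nbr: "(u, v) \<in> chain.nbr\<^sup>*" if "u \<in> verts H" "v \<in> verts H" for u v
  proof -
    \<comment> \<open>A loop may fail the weight threshold; being a step from a vertex to itself, it
      is absorbed by \<open>Id\<close>.\<close>
    have "step_rel (edges H) \<subseteq> chain.nbr \<union> Id"
    proof
      fix z assume z: "z \<in> step_rel (edges H)"
      then obtain a b e where e: "z = (a, b)" "e \<in> edges H" "ends H e = {a, b}"
        by (auto simp: step_rel_def)
      show "z \<in> chain.nbr \<union> Id"
      proof (cases "a = b")
        case False
        have "a \<in> verts H" "b \<in> verts H" using wf e unfolding wf_multigraph_def by fastforce+
        moreover have "adj H a b \<ge> 1"
          using e fin_edges False by (auto simp: adj_def Suc_le_eq card_gt_0_iff)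
        ultimately show ?thesis using e False by (simp add: chain.nbr_def lazy_weight_def)
      qed (use e in auto)
    qed
    then have "(step_rel (edges H))\<^sup>* \<subseteq> (chain.nbr \<union> Id)\<^sup>*" by (rule rtrancl_mono)
    then show ?thesis using cn[OF that] by auto
  qed
  obtain h where h: "bij_betw h {0..<card (verts H)} (verts H)"
    using ex_bij_betw_nat_finite[OF fin_verts] by blast
  let ?d = "\<lambda>t. det (mat (card (verts H)) (card (verts H)) (\<lambda>(i, j). graph_laplacian H t (h i) (h j)))"
  have lap: "mat (card (verts H)) (card (verts H)) (\<lambda>(i, j). (if h i = h j then B + t else 0) - lazy_weight H B (h i) (h j))
      = mat (card (verts H)) (card (verts H)) (\<lambda>(i, j). graph_laplacian H t (h i) (h j))" for t
    by (intro cong_mat) (auto simp: graph_laplacian_def lazy_weight_def)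
  have logd: "(\<Sum>x\<in>verts H. log_density (verts H) (lazy_weight H B) (B + t) x) - ln t = ln \<bar>?d t / t\<bar>"
    if "t > 0" for t
    using chain.sum_log_density[OF h, of "B + t"] that unfolding lap by (simp add: abs_divide ln_div)
  have pos: "real (card (verts H)) > 0" "real (card (spanning_trees H)) > 0"
    using ne fin_verts spanning_tree_exists[OF conn] by (auto simp: card_gt_0_iff)
  have "((\<lambda>t. ln \<bar>?d t / t\<bar>) \<longlongrightarrow> ln \<bar>real (card (verts H)) * real (card (spanning_trees H))\<bar>) (at_right 0)"
    by (intro tendsto_ln tendsto_rabs matrix_tree_limit[OF h ne]) (use pos in auto)
  moreover have "ln \<bar>real (card (verts H)) * real (card (spanning_trees H))\<bar> = L"
    unfolding L_def using pos by (simp add: ln_mult)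
  ultimately have "((\<lambda>t. ln \<bar>?d t / t\<bar>) \<longlongrightarrow> L) (at_right 0)" by simp
  then have lim: "((\<lambda>t. (\<Sum>x\<in>verts H. log_density (verts H) (lazy_weight H B) (B + t) x) - ln t) \<longlongrightarrow> L) (at_right 0)"
    by (rule Lim_transform_eventually) (auto intro!: eventually_mono[OF eventually_at_right_less[of "0::real"]] simp: logd)
  show "L + ln t \<le> (\<Sum>x\<in>verts H. log_density (verts H) (lazy_weight H B) (B + t) x)"
    and "(\<Sum>x\<in>verts H. log_density (verts H) (lazy_weight H B) (B + t) x) \<le> L + ln t + 16 * card (verts H) * sqrt t"
    by (rule chain.log_density_sum_bounds[OF nbr ne lim t]; assumption)+
qed

end

section \<open>Connected components\<close>

definition component :: "('v, 'e) multigraph \<Rightarrow> 'v set \<Rightarrow> ('v, 'e) multigraph" where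
  "component H C = H\<lparr>verts := C, edges := {e \<in> edges H. ends H e \<subseteq> C}\<rparr>"

lemma component_simps [simp]:
  "verts (component H C) = C" "edges (component H C) = {e \<in> edges H. ends H e \<subseteq> C}"
  "ends (component H C) = ends H"
  by (simp_all add: component_def)

lemma component_inject: "component H C = component H D \<longleftrightarrow> C = D"
  by (metis component_simps(1))

text \<open>No weight leads out of \<open>C\<close>, so walks that start in \<open>C\<close> stay
  there.\<close>

lemma walks_restrict:
  assumes "finite V" "C \<subseteq> V" "\<And>x y. x \<in> C \<Longrightarrow> y \<in> C \<Longrightarrow> w' x y = w x y"
    and "\<And>x z. x \<in> C \<Longrightarrow> z \<in> V - C \<Longrightarrow> w x z = 0" and "x \<in> C"
  shows "walks C w' k x y = walks V w k x y"
  using assms(5)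
proof (induction k arbitrary: x)
  case (Suc k)
  have "walks V w (Suc k) x y = (\<Sum>z\<in>C. w x z * walks V w k z y)"
    unfolding walks.simps using assms(1,2,4) Suc.prems by (intro sum.mono_neutral_right) auto
  also have "\<dots> = (\<Sum>z\<in>C. w' x z * walks C w' k z y)"
    using Suc assms(3) by (intro sum.cong refl) auto
  finally show ?case by simp
qed simp

context finite_multigraph
begin

lemma equiv_connected: "equiv (verts H) (connected_rel H)"
proof (rule equivI)
  have *: "{(a, b). \<exists>e\<in>edges H. ends H e = {a, b}} = step_rel (edges H)" by (simp add: step_rel_def)
  show "refl_on (verts H) (connected_rel H)" by (auto simp: refl_on_def connected_rel_def)
  show "sym (connected_rel H)" unfolding connected_rel_def * by (auto simp: sym_def intro: step_rel_sym)
  show "trans (connected_rel H)" unfolding connected_rel_def * by (auto simp: trans_def)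
  show "connected_rel H \<subseteq> verts H \<times> verts H" by (auto simp: connected_rel_def)
qed

lemma connected_edge:
  assumes "e \<in> edges H" "ends H e = {a, b}"
  shows "(a, b) \<in> connected_rel H"
proof -
  obtain u v where "u \<in> verts H" "v \<in> verts H" "ends H e = {u, v}"
    using wf assms(1) unfolding wf_multigraph_def by blast
  then have "a \<in> verts H" "b \<in> verts H" using assms(2) by auto
  then show ?thesis using assms by (auto simp: connected_rel_def)
qed

lemma class_edge:
  assumes C: "C \<in> verts H // connected_rel H" and e: "e \<in> edges H" and x: "x \<in> ends H e" "x \<in> C"
  shows "ends H e \<subseteq> C"
proof -
  obtain u v where uv: "ends H e = {u, v}"
    using wf e unfolding wf_multigraph_def by blast
  have "(u, v) \<in> connected_rel H" "(v, u) \<in> connected_rel H"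
    using connected_edge[OF e uv] connected_edge[OF e, of v u] uv by (auto simp: insert_commute)
  then show ?thesis
    using x uv in_quotient_imp_closed[OF equiv_connected C, of u v] in_quotient_imp_closed[OF equiv_connected C, of v u]
    by auto
qed

lemma class_subset: "C \<in> verts H // connected_rel H \<Longrightarrow> C \<subseteq> verts H"
  by (rule in_quotient_imp_subset[OF equiv_connected])

lemma finite_multigraph_component:
  assumes C: "C \<in> verts H // connected_rel H"
  shows "finite_multigraph (component H C)"
proof
  show "wf_multigraph (component H C)"
    unfolding wf_multigraph_def
  proof
    fix e assume e: "e \<in> edges (component H C)"
    then obtain u v where "ends H e = {u, v}" using wf unfolding wf_multigraph_def by fastforce
    then show "\<exists>u\<in>verts (component H C). \<exists>v\<in>verts (component H C). ends (component H C) e = {u, v}"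
      using e by auto
  qed
  show "finite (verts (component H C))" using class_subset[OF C] fin_verts by (auto intro: finite_subset)
  show "finite (edges (component H C))" using fin_edges by simp
qed

lemma connected_component:
  assumes C: "C \<in> verts H // connected_rel H"
  shows "connected_multigraph (component H C)"
proof -
  let ?S = "step_rel (edges (component H C))"
  have closed: "(u, v) \<in> ?S\<^sup>*" if u: "u \<in> C" and uv: "(u, v) \<in> (step_rel (edges H))\<^sup>*" for u v
    using uv
  proof (induction rule: rtrancl_induct)
    case (step y z)
    have stay: "(u, y) \<in> ?S\<^sup>* \<Longrightarrow> y \<in> C"
    proof -
      assume "(u, y) \<in> ?S\<^sup>*"
      then show "y \<in> C" using u by (induction rule: rtrancl_induct) (auto simp: step_rel_def)
    qed
    then have y: "y \<in> C" using step.IH by simp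
    obtain e where e: "e \<in> edges H" "ends H e = {y, z}" using step.hyps(2) by (auto simp: step_rel_def)
    then have "ends H e \<subseteq> C" using class_edge[OF C e(1) _ y] by simp
    then have "(y, z) \<in> ?S" using e by (auto simp: step_rel_def)
    then show ?case using step.IH by simp
  qed simp
  have "C \<noteq> {}" using in_quotient_imp_non_empty[OF equiv_connected C] .
  moreover have "(u, v) \<in> connected_rel (component H C)" if uv: "u \<in> C" "v \<in> C" for u v
  proof -
    have "(u, v) \<in> connected_rel H" using in_quotient_imp_in_rel[OF equiv_connected C] uv by simp
    then have "(u, v) \<in> (step_rel (edges H))\<^sup>*" by (simp add: connected_rel_def step_rel_def)
    then have "(u, v) \<in> ?S\<^sup>*" by (rule closed[OF uv(1)])
    then show ?thesis using uv by (simp add: connected_rel_def step_rel_def)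
  qed
  ultimately show ?thesis by (simp add: connected_multigraph_def)
qed

lemma lazy_weight_component:
  assumes C: "C \<in> verts H // connected_rel H" and x: "x \<in> C"
  shows "y \<in> C \<Longrightarrow> lazy_weight (component H C) B x y = lazy_weight H B x y"
    and "z \<in> verts H - C \<Longrightarrow> lazy_weight H B x z = 0"
    and "nonloop_degree (component H C) x = nonloop_degree H x"
proof -
  have inC: "ends H e \<subseteq> C" if "e \<in> edges H" "x \<in> ends H e" for e
    using class_edge[OF C that x] .
  show deg: "nonloop_degree (component H C) x = nonloop_degree H x"
    unfolding nonloop_degree_def by (rule arg_cong[where f = card]) (use inC in auto)
  show "lazy_weight (component H C) B x y = lazy_weight H B x y" if y: "y \<in> C"
  proof -
    have "{e \<in> edges (component H C). ends (component H C) e = {x, y}} = {e \<in> edges H. ends H e = {x, y}}"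
      using x y by auto
    then show ?thesis using deg by (auto simp: lazy_weight_def adj_def)
  qed
  show "lazy_weight H B x z = 0" if z: "z \<in> verts H - C"
  proof -
    have "{e \<in> edges H. ends H e = {x, z}} = {}" using inC z by auto
    then have "adj H x z = 0" by (simp only: adj_def) simp
    then show ?thesis using x z by (auto simp: lazy_weight_def)
  qed
qed

lemma log_density_component:
  assumes C: "C \<in> verts H // connected_rel H" and x: "x \<in> C"
  shows "log_density C (lazy_weight (component H C) B) c x = log_density (verts H) (lazy_weight H B) c x"
  unfolding log_density_def
  by (subst walks_restrict[OF fin_verts class_subset[OF C] lazy_weight_component(1,2)[OF C] x])
    (auto simp del: walks.simps)

lemma ln_complexity: "ln (real (complexity H))
    = (\<Sum>C\<in>verts H // connected_rel H. ln (real (card (spanning_trees (component H C)))))"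
proof -
  have comps: "components_of H = component H ` (verts H // connected_rel H)"
    by (simp add: components_of_def component_def[abs_def])
  have inj: "inj_on (component H) (verts H // connected_rel H)" by (simp add: inj_on_def component_inject)
  have "real (complexity H) = (\<Prod>C\<in>verts H // connected_rel H. real (card (spanning_trees (component H C))))"
    unfolding complexity_def comps by (simp add: prod.reindex[OF inj])
  also have "ln \<dots> = (\<Sum>C\<in>verts H // connected_rel H. ln (real (card (spanning_trees (component H C)))))"
  proof (rule ln_prod)
    fix C assume C: "C \<in> verts H // connected_rel H"
    interpret K: finite_multigraph "component H C" by (rule finite_multigraph_component[OF C])
    show "real (card (spanning_trees (component H C))) \<noteq> 0"
      using K.spanning_tree_exists[OF connected_component[OF C]] by simp
  qed (rule finite_quotient[OF fin_verts], auto simp: connected_rel_def)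
  finally show ?thesis .
qed

text \<open>The errors \<open>ln (card C)\<close> and \<open>|ln t|\<close> occur once per
  component. As a component has at least \<open>M\<close> vertices, they spread out to an error per
  vertex that is small for large \<open>M\<close>.\<close>

theorem ln_complexity_approx:
  fixes t :: real and M :: nat
  assumes B: "\<And>x. x \<in> verts H \<Longrightarrow> real (nonloop_degree H x) \<le> B" "B > 0" and t: "0 < t" "t \<le> 1"
    and M: "M > 0" "\<And>C. C \<in> verts H // connected_rel H \<Longrightarrow> M \<le> card C"
  shows "\<bar>ln (real (complexity H)) - (\<Sum>x\<in>verts H. log_density (verts H) (lazy_weight H B) (B + t) x)\<bar>
      \<le> real (card (verts H)) * (2 / sqrt M + \<bar>ln t\<bar> / M + 16 * sqrt t)"
proof -
  define \<K> where "\<K> = verts H // connected_rel H"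
  define D where "D x = log_density (verts H) (lazy_weight H B) (B + t) x" for x
  have finC: "finite C" if "C \<in> \<K>" for C
    using that class_subset fin_verts unfolding \<K>_def by (auto intro: finite_subset)
  have fink: "finite \<K>" unfolding \<K>_def
    by (rule finite_quotient[OF fin_verts]) (auto simp: connected_rel_def)
  have un: "\<Union>\<K> = verts H" unfolding \<K>_def by (rule Union_quotient[OF equiv_connected])
  have disj: "C \<inter> C' = {}" if "C \<in> \<K>" "C' \<in> \<K>" "C \<noteq> C'" for C C'
    using quotient_disj[OF equiv_connected] that unfolding \<K>_def by blast
  have split: "sum f (verts H) = (\<Sum>C\<in>\<K>. sum f C)" for f :: "'v \<Rightarrow> real"
    unfolding un[symmetric] using disj finC by (subst sum.Union_disjoint) auto
  have cardV: "real (card (verts H)) = (\<Sum>C\<in>\<K>. real (card C))"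
    using split[of "\<lambda>_. 1"] by simp
  have each: "\<bar>ln (real (card (spanning_trees (component H C)))) - sum D C\<bar>
      \<le> real (card C) * (2 / sqrt M + \<bar>ln t\<bar> / M + 16 * sqrt t)" if C: "C \<in> \<K>" for C
  proof -
    have C': "C \<in> verts H // connected_rel H" using C by (simp add: \<K>_def)
    interpret K: finite_multigraph "component H C" by (rule finite_multigraph_component[OF C'])
    have Bc: "\<And>x. x \<in> verts (component H C) \<Longrightarrow> real (nonloop_degree (component H C) x) \<le> B"
      using lazy_weight_component(3)[OF C'] B(1) class_subset[OF C'] by auto
    have sumD: "(\<Sum>x\<in>verts (component H C). log_density (verts (component H C)) (lazy_weight (component H C) B) (B + t) x) = sum D C"
      unfolding component_simps D_def by (intro sum.cong refl log_density_component[OF C'])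
    have lo: "ln (real (card C)) + ln (real (card (spanning_trees (component H C)))) + ln t \<le> sum D C"
      and hi: "sum D C \<le> ln (real (card C)) + ln (real (card (spanning_trees (component H C)))) + ln t + 16 * card C * sqrt t"
      using K.log_spanning_trees_bounds[OF connected_component[OF C'] Bc B(2) t]
      unfolding sumD unfolding component_simps by auto
    have MC: "real M \<le> real (card C)" using M(2)[OF C'] by simp
    then have c1: "real (card C) \<ge> 1" using M(1) by linarith
    have lt: "ln t \<le> 0" using t by simp
    have "\<bar>ln t\<bar> * real M \<le> \<bar>ln t\<bar> * real (card C)" using MC by (intro mult_left_mono) auto
    then have a: "\<bar>ln t\<bar> \<le> real (card C) * (\<bar>ln t\<bar> / M)" using M(1) by (simp add: field_simps)
    \<comment> \<open>The estimate \<open>ln z \<le> 2 sqrt z\<close> gives growth slower than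
      linear; with \<open>M \<le> card C\<close> this leaves \<open>2 / sqrt M\<close> per
      vertex.\<close>
    have "ln (real (card C)) = 2 * ln (sqrt (real (card C)))" using c1 by (simp add: ln_sqrt)
    also have "\<dots> \<le> 2 * sqrt (real (card C))"
    proof -
      have "sqrt (real (card C)) > 0" using c1 by simp
      then have "ln (sqrt (real (card C))) < sqrt (real (card C))" by (rule ln_less_self)
      then show ?thesis by simp
    qed
    also have "\<dots> \<le> 2 * (real (card C) / sqrt M)"
    proof -
      have "sqrt (real (card C)) * sqrt M \<le> sqrt (real (card C)) * sqrt (real (card C))"
        using MC by (intro mult_left_mono) auto
      then show ?thesis using M(1) by (simp add: field_simps)
    qed
    finally have b: "ln (real (card C)) \<le> real (card C) * (2 / sqrt M)" by (simp add: mult.commute)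
    have c: "0 \<le> ln (real (card C))" using c1 by simp
    have nn: "0 \<le> real (card C) * (2 / sqrt M)" "0 \<le> 16 * card C * sqrt t" using t by auto
    have eq: "real (card C) * (2 / sqrt M + \<bar>ln t\<bar> / M + 16 * sqrt t)
        = real (card C) * (2 / sqrt M) + real (card C) * (\<bar>ln t\<bar> / M) + 16 * card C * sqrt t"
      by (simp add: distrib_left)
    show ?thesis unfolding eq using lo hi a b c lt nn by linarith
  qed
  have "ln (real (complexity H)) - (\<Sum>x\<in>verts H. D x)
      = (\<Sum>C\<in>\<K>. ln (real (card (spanning_trees (component H C)))) - sum D C)"
    unfolding split ln_complexity \<K>_def[symmetric] by (simp add: sum_subtractf)
  also have "\<bar>\<dots>\<bar> \<le> (\<Sum>C\<in>\<K>. real (card C) * (2 / sqrt M + \<bar>ln t\<bar> / M + 16 * sqrt t))"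
    by (rule order_trans[OF sum_abs sum_mono]) (rule each)
  also have "\<dots> = real (card (verts H)) * (2 / sqrt M + \<bar>ln t\<bar> / M + 16 * sqrt t)"
    unfolding cardV by (simp only: sum_distrib_right)
  finally show ?thesis unfolding D_def .
qed

end

section \<open>Laurent polynomials on the torus\<close>

text \<open>One additive extension covers evaluation on the torus, total coefficient sums and
  coefficient sums over cosets of \<Lambda>, depending on the values prescribed on
  exponents.\<close>

definition lin_ext :: "((int ^ 'd::finite) \<Rightarrow> 'b::comm_ring_1) \<Rightarrow> 'd laurent \<Rightarrow> 'b" where
  "lin_ext F f = (\<Sum>s\<in>Poly_Mapping.keys f. of_int (Poly_Mapping.lookup f s) * F s)"

lemma lin_ext_superset:
  assumes "finite S" "Poly_Mapping.keys f \<subseteq> S"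
  shows "lin_ext F f = (\<Sum>s\<in>S. of_int (Poly_Mapping.lookup f s) * F s)"
  unfolding lin_ext_def using assms
  by (intro sum.mono_neutral_left) (auto simp: in_keys_iff)

lemma lin_ext_zero [simp]: "lin_ext F 0 = 0"
  by (simp add: lin_ext_def)

lemma lin_ext_add: "lin_ext F (f + g) = lin_ext F f + lin_ext F g"
proof -
  let ?S = "Poly_Mapping.keys f \<union> Poly_Mapping.keys g"
  have "lin_ext F (f + g) = (\<Sum>s\<in>?S. of_int (Poly_Mapping.lookup (f + g) s) * F s)"
    by (rule lin_ext_superset) (auto simp: keys_add)
  moreover have "lin_ext F f = (\<Sum>s\<in>?S. of_int (Poly_Mapping.lookup f s) * F s)"
    by (rule lin_ext_superset) auto
  moreover have "lin_ext F g = (\<Sum>s\<in>?S. of_int (Poly_Mapping.lookup g s) * F s)"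
    by (rule lin_ext_superset) auto
  ultimately show ?thesis by (simp add: lookup_add algebra_simps sum.distrib)
qed

lemma lin_ext_sum: "lin_ext F (\<Sum>i\<in>I. g i) = (\<Sum>i\<in>I. lin_ext F (g i))"
  by (induction I rule: infinite_finite_induct) (auto simp: lin_ext_add)

lemma lin_ext_single [simp]: "lin_ext F (Poly_Mapping.single s a) = of_int a * F s"
  by (cases "a = 0") (auto simp: lin_ext_def)

lemma single_zero_of_int: "Poly_Mapping.single (0 :: int ^ 'd::finite) a = of_int a"
proof -
  have n: "Poly_Mapping.single (0 :: int ^ 'd) (int k) = of_nat k" for k
    by (induction k) (auto simp: single_add simp flip: single_one)
  show ?thesis by (cases a rule: int_cases2) (simp_all add: n single_uminus)
qed

lemma lin_ext_of_int [simp]: "lin_ext F (of_int a) = of_int a * F 0"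
  using lin_ext_single[of F 0 a] by (simp add: single_zero_of_int)

lemma laurent_monomials: "(f :: 'd::finite laurent) = (\<Sum>s\<in>Poly_Mapping.keys f. Poly_Mapping.single s (Poly_Mapping.lookup f s))"
  by (rule poly_mapping_eqI)
    (simp add: lookup_sum lookup_single when_def sum.delta in_keys_iff cong: if_cong)

lemma lin_ext_mult:
  "lin_ext F (f * g) = (\<Sum>s\<in>Poly_Mapping.keys f. \<Sum>t\<in>Poly_Mapping.keys g.
     of_int (Poly_Mapping.lookup f s) * of_int (Poly_Mapping.lookup g t) * F (s + t))"
proof -
  have "f * g = (\<Sum>s\<in>Poly_Mapping.keys f. Poly_Mapping.single s (Poly_Mapping.lookup f s))
      * (\<Sum>t\<in>Poly_Mapping.keys g. Poly_Mapping.single t (Poly_Mapping.lookup g t))"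
    by (simp flip: laurent_monomials)
  also have "\<dots> = (\<Sum>s\<in>Poly_Mapping.keys f. \<Sum>t\<in>Poly_Mapping.keys g.
      Poly_Mapping.single (s + t) (Poly_Mapping.lookup f s * Poly_Mapping.lookup g t))"
    by (simp add: sum_product mult_single)
  finally show ?thesis by (simp add: lin_ext_sum)
qed

definition monomial_value :: "('d::finite \<Rightarrow> complex) \<Rightarrow> int ^ 'd \<Rightarrow> complex" where
  "monomial_value z s = (\<Prod>i\<in>UNIV. z i powi vec_nth s i)"

lemma laurent_eval_lin_ext: "laurent_eval f z = lin_ext (monomial_value z) f"
  by (simp add: laurent_eval_def lin_ext_def monomial_value_def)

lemma monomial_value_0 [simp]: "monomial_value z 0 = 1"
  by (simp add: monomial_value_def)

lemma monomial_value_add: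
  "(\<And>i. z i \<noteq> 0) \<Longrightarrow> monomial_value z (s + t) = monomial_value z s * monomial_value z t"
  by (simp add: monomial_value_def power_int_add prod.distrib)

lemma laurent_eval_hom:
  assumes "\<And>i. z i \<noteq> 0"
  shows "comm_ring_hom (\<lambda>f. laurent_eval f z)"
proof
  fix f g :: "'a laurent"
  show "laurent_eval (f * g) z = laurent_eval f z * laurent_eval g z"
    unfolding laurent_eval_lin_ext lin_ext_mult monomial_value_add[OF assms]
    unfolding lin_ext_def sum_product
    by (intro sum.cong refl) (simp add: mult_ac)
  show "laurent_eval 1 z = 1"
    using lin_ext_of_int[of "monomial_value z" 1] by (simp add: laurent_eval_lin_ext)
qed (simp_all add: laurent_eval_lin_ext lin_ext_add)

section \<open>Integration over the torus\<close>

definition unit_cube :: "(real ^ 'd::finite) set" where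
  "unit_cube = {\<theta>. \<forall>i. 0 \<le> vec_nth \<theta> i \<and> vec_nth \<theta> i \<le> 1}"

definition cube_measure :: "(real ^ 'd::finite) measure" where
  "cube_measure = restrict_space lborel unit_cube"

definition torus_point :: "real ^ 'd::finite \<Rightarrow> 'd \<Rightarrow> complex" where
  "torus_point \<theta> = (\<lambda>i. exp (2 * of_real pi * \<i> * of_real (vec_nth \<theta> i)))"

lemma torus_point_nonzero: "torus_point \<theta> i \<noteq> 0"
  by (simp add: torus_point_def)

lemmas torus_hom = laurent_eval_hom[of "torus_point \<theta>" for \<theta>, OF torus_point_nonzero]

lemma norm_monomial_torus: "cmod (monomial_value (torus_point \<theta>) s) = 1"
  by (simp add: monomial_value_def torus_point_def prod_norm[symmetric] norm_power_int)

lemma integral_exp_interval: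
  "(LINT x|lborel. indicator {0..1} x *\<^sub>R exp (2 * of_real pi * \<i> * of_int k * of_real x)) = (if k = 0 then 1 else (0::complex))"
  "integrable lborel (\<lambda>x::real. indicator {0..1} x *\<^sub>R exp (2 * of_real pi * \<i> * of_int k * of_real x))"
proof -
  let ?a = "2 * of_real pi * \<i> * of_int k :: complex"
  define F where "F x = (if k = 0 then of_real x else exp (?a * of_real x) / ?a)" for x :: real
  have F: "(F has_vector_derivative exp (?a * of_real x)) (at x within {0..1})" for x
  proof (cases "k = 0")
    case True
    have "((\<lambda>x. of_real x :: complex) has_vector_derivative 1) (at x within {0..1})"
      by (auto intro!: derivative_eq_intros simp: has_vector_derivative_def scaleR_conv_of_real)
    then show ?thesis using True by (simp add: F_def[abs_def])
  next
    case False
    have "((\<lambda>z. exp (?a * z) / ?a) has_field_derivative exp (?a * of_real x)) (at (of_real x))"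
      using False by (auto intro!: derivative_eq_intros)
    then have "((\<lambda>x. exp (?a * of_real x) / ?a) has_vector_derivative exp (?a * of_real x)) (at x within {0..1})"
      by (rule has_vector_derivative_real_field)
    then show ?thesis using False by (simp add: F_def[abs_def])
  qed
  have cont: "continuous_on {0..1} (\<lambda>x::real. exp (?a * of_real x))" by (intro continuous_intros)
  have val: "F 1 - F 0 = (if k = 0 then 1 else 0)"
  proof (cases "k = 0")
    case False
    have "exp ?a = 1" unfolding exp_eq_1 by (auto intro!: exI[of _ k])
    then show ?thesis using False by (simp add: F_def)
  qed (simp add: F_def)
  show "(LINT x|lborel. indicator {0..1} x *\<^sub>R exp (?a * of_real x)) = (if k = 0 then 1 else 0)"
    using integral_FTC_Icc[of 0 1 F, OF _ F cont] val by simp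
  show "integrable lborel (\<lambda>x::real. indicator {0..1} x *\<^sub>R exp (?a * of_real x))"
    using has_bochner_integral_FTC_Icc[of 0 1 F, OF _ F cont] by (simp add: has_bochner_integral_iff)
qed

lemma unit_cube_cbox: "unit_cube = cbox 0 (1 :: real ^ 'd::finite)"
  by (auto simp: unit_cube_def mem_box Basis_vec_def inner_axis)

lemma integral_cube_measure:
  fixes f :: "real ^ 'd::finite \<Rightarrow> 'b::{banach, second_countable_topology}"
  shows "integral\<^sup>L cube_measure f = (LINT \<theta>:unit_cube|lborel. f \<theta>)"
  unfolding cube_measure_def set_lebesgue_integral_def
  by (rule integral_restrict_space) (simp add: unit_cube_cbox)

text \<open>The monomial is a product of exponentials in one variable each, so the integral factors;
  a coordinate with nonzero exponent integrates to 0 over its full periods.\<close>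

lemma integral_monomial_torus:
  "(LINT \<theta>|cube_measure. monomial_value (torus_point \<theta>) s) = (if s = (0 :: int ^ 'd::finite) then 1 else 0)"
proof -
  \<comment> \<open>Lebesgue measure is handled as a product over \<open>Basis\<close>; the real
    copy of \<open>s\<close> lets the exponents be read off as inner products with basis
    vectors.\<close>
  define \<sigma> :: "real ^ 'd" where "\<sigma> = (\<chi> i. of_int (vec_nth s i))"
  define e where "e b x = exp (2 * of_real pi * \<i> * of_real (inner \<sigma> b) * of_real x)" for b and x :: real
  define g where "g b x = indicator {0..1} x *\<^sub>R e b x" for b and x :: real
  have Basis: "(Basis :: (real ^ 'd) set) = (\<lambda>i. axis i 1) ` UNIV" by (auto simp: Basis_vec_def)
  have inj: "inj (\<lambda>i::'d. axis i (1::real))" by (auto simp: inj_on_def axis_eq_axis)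
  have e_axis: "e (axis i 1) x = exp (2 * of_real pi * \<i> * of_int (vec_nth s i) * of_real x)" for i x
    by (simp add: e_def inner_axis \<sigma>_def)
  have mono: "monomial_value (torus_point \<theta>) s = (\<Prod>b\<in>Basis. e b (inner \<theta> b))" for \<theta>
    unfolding Basis prod.reindex[OF inj] monomial_value_def torus_point_def o_def e_axis
    by (intro prod.cong refl) (simp add: exp_power_int inner_axis mult_ac)
  have ind: "(indicator unit_cube \<theta> :: real) = (\<Prod>b\<in>Basis. indicator {0..1} (inner \<theta> b))" for \<theta> :: "real ^ 'd"
    unfolding Basis prod.reindex[OF inj] o_def
    by (auto simp: indicator_def unit_cube_def inner_axis prod.neutral)
  have prodg: "indicator unit_cube \<theta> *\<^sub>R monomial_value (torus_point \<theta>) s = (\<Prod>b\<in>Basis. g b (inner \<theta> b))" for \<theta>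
    unfolding g_def scaleR_conv_of_real mono ind by (simp add: prod.distrib)
  have int_g: "integrable lborel (g b)" "integral\<^sup>L lborel (g b) = (if inner \<sigma> b = 0 then 1 else 0)" if b: "b \<in> Basis" for b
  proof -
    obtain i where i: "b = axis i 1" using b by (auto simp: Basis_vec_def)
    have s: "inner \<sigma> b = of_int (vec_nth s i)" by (simp add: i inner_axis \<sigma>_def)
    show "integrable lborel (g b)" "integral\<^sup>L lborel (g b) = (if inner \<sigma> b = 0 then 1 else 0)"
      unfolding g_def[abs_def] i e_axis using integral_exp_interval[of "vec_nth s i"] s
      by (simp_all add: i)
  qed
  interpret product_sigma_finite "\<lambda>_::real ^ 'd. lborel :: real measure" ..
  have meas: "(\<lambda>\<theta> :: real ^ 'd. \<Prod>b\<in>Basis. g b (inner \<theta> b)) \<in> borel_measurable borel"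
    unfolding g_def e_def by measurable
  have "(LINT \<theta>|cube_measure. monomial_value (torus_point \<theta>) s)
      = (LINT \<theta>|lborel. (\<Prod>b\<in>Basis. g b (inner \<theta> b)))"
    unfolding integral_cube_measure set_lebesgue_integral_def prodg ..
  also have "\<dots> = (LINT f|(PiM Basis (\<lambda>_. lborel)). (\<Prod>b\<in>Basis. g b (inner (\<Sum>b\<in>Basis. f b *\<^sub>R b :: real ^ 'd) b)))"
    by (subst lborel_eq, rule integral_distr) (use meas in auto)
  also have "\<dots> = (LINT f|(PiM (Basis :: (real ^ 'd) set) (\<lambda>_. lborel)). (\<Prod>b\<in>Basis. g b (f b)))"
    by (intro Bochner_Integration.integral_cong prod.cong refl) simp
  also have "\<dots> = (\<Prod>b\<in>Basis. integral\<^sup>L lborel (g b))"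
    by (rule product_integral_prod) (auto simp: int_g)
  also have "\<dots> = (\<Prod>b\<in>Basis. if inner \<sigma> b = 0 then 1 else 0)"
    by (intro prod.cong refl) (simp add: int_g)
  also have "\<dots> = (if s = 0 then 1 else 0)"
  proof (cases "s = 0")
    case False
    then obtain i where "vec_nth s i \<noteq> 0" by (auto simp: Finite_Cartesian_Product.vec_eq_iff)
    then have "inner \<sigma> (axis i 1) \<noteq> 0" by (simp add: inner_axis \<sigma>_def)
    then show ?thesis using False by (auto simp: Basis intro!: prod_zero)
  next
    case True
    then have "\<sigma> = 0" by (simp add: \<sigma>_def Finite_Cartesian_Product.vec_eq_iff)
    then show ?thesis using True by simp
  qed
  finally show ?thesis .
qed

lemma finite_cube_measure: "finite_measure (cube_measure :: (real ^ 'd::finite) measure)"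
  by (rule finite_measureI)
    (simp add: cube_measure_def emeasure_restrict_space space_restrict_space unit_cube_cbox emeasure_lborel_cbox_eq)

lemma measure_cube: "measure (cube_measure :: (real ^ 'd::finite) measure) (space cube_measure) = 1"
proof -
  have "(LINT \<theta>|(cube_measure :: (real ^ 'd) measure). monomial_value (torus_point \<theta>) 0) = 1"
    by (simp only: integral_monomial_torus) simp
  then show ?thesis by (simp add: scaleR_conv_of_real)
qed

lemma borel_measurable_cubeI:
  "continuous_on UNIV f \<Longrightarrow> f \<in> borel_measurable (cube_measure :: (real ^ 'd::finite) measure)"
  unfolding cube_measure_def
  by (intro measurable_restrict_space1) (simp add: borel_measurable_continuous_onI)

lemma continuous_laurent_torus: "continuous_on UNIV (\<lambda>\<theta>. laurent_eval f (torus_point \<theta>))"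
  unfolding laurent_eval_def torus_point_def exp_power_int
  by (intro continuous_intros)

lemma integrable_laurent_torus: "integrable cube_measure (\<lambda>\<theta>. laurent_eval f (torus_point \<theta>))"
proof -
  interpret finite_measure cube_measure by (rule finite_cube_measure)
  have "cmod (laurent_eval f (torus_point \<theta>)) \<le> (\<Sum>s\<in>Poly_Mapping.keys f. \<bar>real_of_int (Poly_Mapping.lookup f s)\<bar>)" for \<theta>
    unfolding laurent_eval_lin_ext lin_ext_def
    by (rule order_trans[OF norm_sum]) (simp add: norm_mult norm_monomial_torus)
  then show ?thesis
    by (intro integrable_const_bound[where B = "\<Sum>s\<in>Poly_Mapping.keys f. \<bar>real_of_int (Poly_Mapping.lookup f s)\<bar>"]
        borel_measurable_cubeI continuous_laurent_torus) auto
qed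

text \<open>Orthogonality of the monomials leaves only the exponent 0.\<close>

lemma integral_laurent_torus:
  "(LINT \<theta>|cube_measure. laurent_eval f (torus_point \<theta>)) = of_int (Poly_Mapping.lookup f 0)"
proof -
  interpret finite_measure "cube_measure :: (real ^ 'a) measure" by (rule finite_cube_measure)
  have int: "integrable cube_measure (\<lambda>\<theta>. monomial_value (torus_point \<theta>) s)" for s :: "int ^ 'a"
    using integrable_laurent_torus[of "Poly_Mapping.single s 1"] by (simp add: laurent_eval_lin_ext)
  have "(LINT \<theta>|cube_measure. laurent_eval f (torus_point \<theta>))
      = (\<Sum>s\<in>Poly_Mapping.keys f. of_int (Poly_Mapping.lookup f s) * (if s = 0 then 1 else 0))"
    unfolding laurent_eval_lin_ext lin_ext_def
    by (subst Bochner_Integration.integral_sum) (auto simp: int integral_monomial_torus)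
  also have "\<dots> = of_int (Poly_Mapping.lookup f 0)"
    by (auto simp: in_keys_iff if_distrib sum.delta cong: if_cong)
  finally show ?thesis .
qed

text \<open>Torus counterpart of \<open>finite_chain\<close>: nonnegative coefficients with row
  totals \<open>B\<close> bound the absolute row sums of \<open>W\<close> by \<open>B\<close> at
  every torus point.\<close>

locale laurent_chain =
  fixes W :: "'d::finite laurent mat" and n :: nat and B :: real
  assumes W: "W \<in> carrier_mat n n"
    and coeff_nonneg: "i < n \<Longrightarrow> j < n \<Longrightarrow> Poly_Mapping.lookup (W $$ (i, j)) s \<ge> 0"
    and row_sums: "i < n \<Longrightarrow> (\<Sum>j<n. lin_ext (\<lambda>_. 1) (W $$ (i, j))) = B"
    and B_pos: "B > 0"
begin

definition W_at :: "real ^ 'd \<Rightarrow> complex mat" where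
  "W_at \<theta> = map_mat (\<lambda>f. laurent_eval f (torus_point \<theta>)) W"

definition log_det :: "real \<Rightarrow> real ^ 'd \<Rightarrow> real" where
  "log_det c \<theta> = ln (cmod (det (of_real c \<cdot>\<^sub>m 1\<^sub>m n - W_at \<theta>)))"

text \<open>For the matrix of a lattice graph these are the weighted closed walks of length
  \<open>k\<close> in the infinite graph, with one base point per vertex orbit.\<close>

definition moment :: "nat \<Rightarrow> real" where
  "moment k = (\<Sum>i<n. real_of_int (Poly_Mapping.lookup ((W ^\<^sub>m k) $$ (i, i)) 0))"

lemma W_at_carrier: "W_at \<theta> \<in> carrier_mat n n"
  using W by (simp add: W_at_def)

lemma W_at_rows:
  assumes i: "i < n"
  shows "(\<Sum>j<n. cmod (W_at \<theta> $$ (i, j))) \<le> B"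
proof -
  have "cmod (W_at \<theta> $$ (i, j)) \<le> lin_ext (\<lambda>_. 1) (W $$ (i, j))" if j: "j < n" for j
  proof -
    have "W_at \<theta> $$ (i, j) = lin_ext (monomial_value (torus_point \<theta>)) (W $$ (i, j))"
      using i j W by (simp add: W_at_def laurent_eval_lin_ext)
    also have "cmod \<dots> \<le> (\<Sum>s\<in>Poly_Mapping.keys (W $$ (i, j)). cmod (of_int (Poly_Mapping.lookup (W $$ (i, j)) s) * monomial_value (torus_point \<theta>) s))"
      unfolding lin_ext_def by (rule norm_sum)
    also have "\<dots> = lin_ext (\<lambda>_. 1) (W $$ (i, j))"
      unfolding lin_ext_def using coeff_nonneg[OF i j]
      by (intro sum.cong refl) (simp add: norm_mult norm_monomial_torus)
    finally show ?thesis .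
  qed
  then show ?thesis unfolding row_sums[OF i, symmetric] by (intro sum_mono) auto
qed

lemma trace_W_at: "(\<Sum>i<n. (W_at \<theta> ^\<^sub>m k) $$ (i, i)) = (\<Sum>i<n. laurent_eval ((W ^\<^sub>m k) $$ (i, i)) (torus_point \<theta>))"
proof -
  interpret h: comm_ring_hom "\<lambda>f. laurent_eval f (torus_point \<theta>)" by (rule torus_hom)
  show ?thesis unfolding W_at_def using W by (simp flip: h.mat_hom_pow[OF W])
qed

lemma trace_W_at_bound: "cmod (\<Sum>i<n. (W_at \<theta> ^\<^sub>m k) $$ (i, i)) \<le> real n * B ^ k"
proof -
  obtain es where es: "length es = n"
    "\<And>c. det (c \<cdot>\<^sub>m 1\<^sub>m n - W_at \<theta>) = (\<Prod>a\<leftarrow>es. c - a)"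
    "\<And>k. (\<Sum>i<n. (W_at \<theta> ^\<^sub>m k) $$ (i, i)) = (\<Sum>a\<leftarrow>es. a ^ k)"
    "\<And>a. a \<in> set es \<Longrightarrow> eigenvalue (W_at \<theta>) a"
    by (rule spectral_list[OF W_at_carrier]) blast
  have "cmod a \<le> B" if a: "a \<in> set es" for a
    by (rule eigenvalue_row_sum_bound[OF W_at_carrier es(4)[OF a] W_at_rows])
  then have "cmod (\<Sum>a\<leftarrow>es. a ^ k) \<le> real (length es) * B ^ k"
  proof (induction es)
    case (Cons a es)
    have "cmod (a ^ k) \<le> B ^ k" using Cons.prems[of a] by (simp add: norm_power power_mono)
    moreover have "cmod (\<Sum>a\<leftarrow>es. a ^ k) \<le> real (length es) * B ^ k" using Cons by simp
    ultimately show ?case using norm_triangle_ineq[of "a ^ k" "\<Sum>a\<leftarrow>es. a ^ k"]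
      by (simp add: algebra_simps)
  qed simp
  then show ?thesis by (simp only: es(1,3))
qed

text \<open>The terms of the trace series are dominated on the whole torus by a geometric series, so
  it may be integrated termwise; the integral of a trace is its constant coefficient.\<close>

lemma integral_log_det:
  assumes c: "c > B"
  shows "integrable cube_measure (log_det c)"
    and "(\<lambda>k. moment (Suc k) / (real (Suc k) * c ^ Suc k)) sums (real n * ln c - (LINT \<theta>|cube_measure. log_det c \<theta>))"
proof -
  interpret finite_measure "cube_measure :: (real ^ 'd) measure" by (rule finite_cube_measure)
  have cp: "c > 0" using c B_pos by simp
  define T where "T k \<theta> = Re (\<Sum>i<n. (W_at \<theta> ^\<^sub>m Suc k) $$ (i, i)) / (real (Suc k) * c ^ Suc k)" for k \<theta>
  have sums: "(\<lambda>k. T k \<theta>) sums (real n * ln c - log_det c \<theta>)" for \<theta>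
    unfolding T_def log_det_def by (rule ln_cmod_det_sums(1)[OF W_at_carrier W_at_rows c cp])
  have meas: "T k \<in> borel_measurable cube_measure" for k
    unfolding T_def trace_W_at
    by (intro borel_measurable_cubeI continuous_intros continuous_laurent_torus) (use cp in auto)
  have bound: "\<bar>T k \<theta>\<bar> \<le> real n * (B / c) ^ Suc k" for k \<theta>
  proof -
    have "\<bar>Re (\<Sum>i<n. (W_at \<theta> ^\<^sub>m Suc k) $$ (i, i))\<bar> \<le> real n * B ^ Suc k"
      using trace_W_at_bound[of \<theta> "Suc k"] abs_Re_le_cmod order_trans by blast
    then have "\<bar>T k \<theta>\<bar> \<le> real n * B ^ Suc k / (1 * c ^ Suc k)"
      unfolding T_def abs_divide using cp B_pos
      by (intro frac_le) (auto simp: abs_mult intro!: mult_right_mono)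
    then show ?thesis by (simp add: power_divide)
  qed
  have intT: "integrable cube_measure (T k)" for k
    by (rule integrable_const_bound[where B = "real n * (B / c) ^ Suc k"]) (use bound meas in auto)
  have geo: "summable (\<lambda>k. real n * (B / c) ^ Suc k)"
    using summable_mult[OF summable_geometric[of "B / c"], of "real n * (B / c)"] c cp B_pos by (simp add: mult.assoc)
  have s1: "summable (\<lambda>k. norm (T k \<theta>))" for \<theta>
    by (rule summable_comparison_test'[OF geo]) (use bound in auto)
  have s2: "summable (\<lambda>k. LINT \<theta>|cube_measure. norm (T k \<theta>))"
  proof (rule summable_comparison_test'[OF geo])
    fix k
    have "(LINT \<theta>|cube_measure. norm (T k \<theta>)) \<le> (LINT \<theta>|(cube_measure :: (real ^ 'd) measure). real n * (B / c) ^ Suc k)"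
      by (intro integral_mono integrable_norm intT) (use bound in auto)
    also have "\<dots> = real n * (B / c) ^ Suc k" by (simp add: measure_cube)
    finally show "norm (LINT \<theta>|cube_measure. norm (T k \<theta>)) \<le> real n * (B / c) ^ Suc k" by simp
  qed
  have ld: "log_det c = (\<lambda>\<theta>. real n * ln c - suminf (\<lambda>k. T k \<theta>))"
    using sums by (auto simp: fun_eq_iff sums_iff)
  have int_suminf: "integrable cube_measure (\<lambda>\<theta>. suminf (\<lambda>k. T k \<theta>))"
    by (rule integrable_suminf[OF intT _ s2]) (use s1 in auto)
  then show "integrable cube_measure (log_det c)" unfolding ld by simp
  have "(\<lambda>k. integral\<^sup>L cube_measure (T k)) sums (LINT \<theta>|cube_measure. suminf (\<lambda>k. T k \<theta>))"
    by (rule sums_integral[OF intT _ s2]) (use s1 in auto)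
  moreover have "(LINT \<theta>|cube_measure. suminf (\<lambda>k. T k \<theta>)) = real n * ln c - (LINT \<theta>|cube_measure. log_det c \<theta>)"
    unfolding ld using int_suminf by (simp add: measure_cube)
  moreover have "integral\<^sup>L cube_measure (T k) = moment (Suc k) / (real (Suc k) * c ^ Suc k)" for k
  proof -
    have int: "integrable cube_measure (\<lambda>\<theta>. \<Sum>i<n. laurent_eval ((W ^\<^sub>m Suc k) $$ (i, i)) (torus_point \<theta>))"
      by (intro Bochner_Integration.integrable_sum integrable_laurent_torus)
    have "(LINT \<theta>|cube_measure. Re (\<Sum>i<n. laurent_eval ((W ^\<^sub>m Suc k) $$ (i, i)) (torus_point \<theta>)))
        = Re (\<Sum>i<n. of_int (Poly_Mapping.lookup ((W ^\<^sub>m Suc k) $$ (i, i)) 0))"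
      unfolding integral_Re[OF int]
      by (subst Bochner_Integration.integral_sum) (auto simp: integrable_laurent_torus integral_laurent_torus)
    also have "\<dots> = moment (Suc k)" by (simp add: moment_def)
    finally show ?thesis unfolding T_def trace_W_at by simp
  qed
  ultimately show "(\<lambda>k. moment (Suc k) / (real (Suc k) * c ^ Suc k)) sums (real n * ln c - (LINT \<theta>|cube_measure. log_det c \<theta>))"
    by simp
qed

lemma log_det_mono:
  assumes "B < s" "s \<le> t"
  shows "log_det s \<theta> \<le> log_det t \<theta>"
proof -
  have "det (of_real s \<cdot>\<^sub>m 1\<^sub>m n - W_at \<theta>) \<noteq> 0"
    using ln_cmod_det_sums(2)[OF W_at_carrier W_at_rows, of s] assms B_pos by simp
  then have "cmod (det (of_real s \<cdot>\<^sub>m 1\<^sub>m n - W_at \<theta>)) > 0" by simp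
  moreover have "cmod (det (of_real s \<cdot>\<^sub>m 1\<^sub>m n - W_at \<theta>)) \<le> cmod (det (of_real t \<cdot>\<^sub>m 1\<^sub>m n - W_at \<theta>))"
    by (rule cmod_det_mono[OF W_at_carrier W_at_rows]) (use assms in auto)
  ultimately show ?thesis unfolding log_det_def by (auto intro: ln_mono)
qed

lemma det_continuous: "((\<lambda>t. cmod (det (of_real t \<cdot>\<^sub>m 1\<^sub>m n - W_at \<theta>))) \<longlongrightarrow> cmod (det (of_real s \<cdot>\<^sub>m 1\<^sub>m n - W_at \<theta>))) (at s within S)"
proof -
  obtain es where es: "\<And>c. det (c \<cdot>\<^sub>m 1\<^sub>m n - W_at \<theta>) = (\<Prod>a\<leftarrow>es. c - a)"
    by (rule spectral_list[OF W_at_carrier]) blast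
  have "((\<lambda>t::real. \<Prod>a\<leftarrow>es. of_real t - a :: complex) \<longlongrightarrow> (\<Prod>a\<leftarrow>es. of_real s - a)) (at s within S)"
    by (induction es) (auto intro!: tendsto_intros)
  then show ?thesis unfolding es by (rule tendsto_norm)
qed

text \<open>
  The bound \<open>K\<close> makes the zero set of the determinant a null set and its logarithm integrable:
  otherwise monotone convergence would drive the integrals to \<open>-\<infinity>\<close>.
\<close>

lemma integral_log_det_limit:
  assumes K: "\<And>t. 0 < t \<Longrightarrow> t \<le> 1 \<Longrightarrow> (LINT \<theta>|cube_measure. log_det (B + t) \<theta>) \<ge> K"
    and meas: "log_det B \<in> borel_measurable cube_measure"
  shows "(\<lambda>m. LINT \<theta>|cube_measure. log_det (B + 1 / real (Suc m)) \<theta>) \<longlonglongrightarrow> (LINT \<theta>|cube_measure. log_det B \<theta>)"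
proof -
  define g where "g m = log_det (B + 1 / real (Suc m))" for m
  \<comment> \<open>Differences from the first member turn the decreasing sequence into an
    increasing nonnegative one.\<close>
  define h where "h m \<theta> = g 0 \<theta> - g m \<theta>" for m \<theta>
  have intg: "integrable cube_measure (g m)" for m
    unfolding g_def by (rule integral_log_det) simp
  then have inth: "integrable cube_measure (h m)" for m
    unfolding h_def by (intro Bochner_Integration.integrable_diff) auto
  have gmono: "g m' \<theta> \<le> g m \<theta>" if "m \<le> m'" for m m' \<theta>
    unfolding g_def by (rule log_det_mono) (use that in \<open>auto simp: field_simps\<close>)
  have hmono: "mono (\<lambda>m. h m \<theta>)" for \<theta>
    unfolding h_def mono_def using gmono by simp
  have h0: "h m \<theta> \<ge> 0" for m \<theta> unfolding h_def using gmono[of 0 m \<theta>] by simp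
  have approach: "filterlim (\<lambda>m. B + 1 / real (Suc m)) (at B within UNIV) sequentially"
  proof -
    have "(\<lambda>m. B + 1 / real (Suc m)) \<longlonglongrightarrow> B + 0"
      by (intro tendsto_add tendsto_const LIMSEQ_Suc[OF lim_1_over_n])
    then show ?thesis unfolding filterlim_at by simp
  qed
  have inth_le: "integral\<^sup>L cube_measure (h m) \<le> integral\<^sup>L cube_measure (g 0) - K" for m
  proof -
    have "integral\<^sup>L cube_measure (h m) = integral\<^sup>L cube_measure (g 0) - integral\<^sup>L cube_measure (g m)"
      unfolding h_def by (rule Bochner_Integration.integral_diff[OF intg intg])
    then show ?thesis using K[of "1 / real (Suc m)"] by (simp add: g_def)
  qed
  have "(\<integral>\<^sup>+ \<theta>. (SUP m. ennreal (h m \<theta>)) \<partial>cube_measure) = (SUP m. \<integral>\<^sup>+ \<theta>. ennreal (h m \<theta>) \<partial>cube_measure)"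
    by (rule nn_integral_monotone_convergence_SUP)
      (use inth hmono in \<open>auto simp: incseq_def le_fun_def mono_def intro!: ennreal_leI borel_measurable_integrable\<close>)
  also have "\<dots> \<le> ennreal (integral\<^sup>L cube_measure (g 0) - K)"
    by (rule SUP_least) (simp add: nn_integral_eq_integral[OF inth] h0 ennreal_leI inth_le)
  also have "\<dots> < \<infinity>" by simp
  finally have "AE \<theta> in cube_measure. (SUP m. ennreal (h m \<theta>)) \<noteq> \<infinity>"
    by (intro nn_integral_PInf_AE) (use inth in \<open>auto intro!: borel_measurable_SUP borel_measurable_integrable\<close>)
  \<comment> \<open>With \<open>ln 0 = 0\<close>, the value of \<open>log_det B\<close> at a zero of
    the determinant is not the limit of the regularized values, so the zeros must form a null set.
    At a zero the \<open>h m\<close> are unbounded, which the finiteness of their supremum excludes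
    almost everywhere.\<close>
  then have nz: "AE \<theta> in cube_measure. det (of_real B \<cdot>\<^sub>m 1\<^sub>m n - W_at \<theta>) \<noteq> 0"
  proof eventually_elim
    case (elim \<theta>)
    show ?case
    proof
      assume z: "det (of_real B \<cdot>\<^sub>m 1\<^sub>m n - W_at \<theta>) = 0"
      obtain M where M: "(SUP m. ennreal (h m \<theta>)) = ennreal M" "M \<ge> 0"
        using elim by (cases "SUP m. ennreal (h m \<theta>)") auto
      have hM: "h m \<theta> \<le> M" for m
      proof -
        have "ennreal (h m \<theta>) \<le> ennreal M" unfolding M(1)[symmetric] by (rule SUP_upper) simp
        then show ?thesis using M(2) by simp
      qed
      have "((\<lambda>t. cmod (det (of_real t \<cdot>\<^sub>m 1\<^sub>m n - W_at \<theta>))) \<longlongrightarrow> 0) (at B within UNIV)"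
        using det_continuous[of \<theta> B UNIV] z by simp
      moreover have "filterlim (\<lambda>m. B + 1 / real (Suc m)) (at B within UNIV) sequentially"
        by (rule approach)
      ultimately have "(\<lambda>m. cmod (det (of_real (B + 1 / real (Suc m)) \<cdot>\<^sub>m 1\<^sub>m n - W_at \<theta>))) \<longlonglongrightarrow> 0"
        by (rule filterlim_compose)
      \<comment> \<open>The threshold is chosen so that \<open>h m \<theta>\<close> exceeds
        \<open>M + 1\<close>, contradicting the bound \<open>M\<close>.\<close>
      then have "eventually (\<lambda>m. cmod (det (of_real (B + 1 / real (Suc m)) \<cdot>\<^sub>m 1\<^sub>m n - W_at \<theta>)) < exp (g 0 \<theta> - M - 1)) sequentially"
        by (rule order_tendstoD) simp
      then obtain m where m: "cmod (det (of_real (B + 1 / real (Suc m)) \<cdot>\<^sub>m 1\<^sub>m n - W_at \<theta>)) < exp (g 0 \<theta> - M - 1)"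
        using eventually_happens by force
      have "det (of_real (B + 1 / real (Suc m)) \<cdot>\<^sub>m 1\<^sub>m n - W_at \<theta>) \<noteq> 0"
        using ln_cmod_det_sums(2)[OF W_at_carrier W_at_rows, of "B + 1 / real (Suc m)"] B_pos by (simp add: add_pos_pos)
      then have "g m \<theta> < g 0 \<theta> - M - 1"
        unfolding g_def log_det_def using m[THEN ln_less_cancel_iff[THEN iffD2, rotated 2]]
        by (simp add: g_def log_det_def)
      then show False using hM[of m] by (simp add: h_def)
    qed
  qed
  have limh: "AE \<theta> in cube_measure. (\<lambda>m. h m \<theta>) \<longlonglongrightarrow> g 0 \<theta> - log_det B \<theta>"
    using nz
  proof eventually_elim
    case (elim \<theta>)
    have "filterlim (\<lambda>m. B + 1 / real (Suc m)) (at B within UNIV) sequentially"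
      by (rule approach)
    then have "(\<lambda>m. cmod (det (of_real (B + 1 / real (Suc m)) \<cdot>\<^sub>m 1\<^sub>m n - W_at \<theta>))) \<longlonglongrightarrow> cmod (det (of_real B \<cdot>\<^sub>m 1\<^sub>m n - W_at \<theta>))"
      by (rule filterlim_compose[OF det_continuous])
    then have "(\<lambda>m. g m \<theta>) \<longlonglongrightarrow> log_det B \<theta>"
      unfolding g_def log_det_def by (rule tendsto_ln) (use elim in auto)
    then show ?case unfolding h_def by (intro tendsto_intros)
  qed
  have "incseq (\<lambda>m. integral\<^sup>L cube_measure (h m))"
    unfolding incseq_def using hmono by (auto intro!: integral_mono inth simp: mono_def)
  then obtain L where L: "(\<lambda>m. integral\<^sup>L cube_measure (h m)) \<longlonglongrightarrow> L"
    using incseq_convergent[of _ "integral\<^sup>L cube_measure (g 0) - K"] inth_le by blast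
  have um: "(\<lambda>\<theta>. g 0 \<theta> - log_det B \<theta>) \<in> borel_measurable cube_measure"
    using intg[of 0] meas by auto
  have lim_int: "integrable cube_measure (\<lambda>\<theta>. g 0 \<theta> - log_det B \<theta>)" "(LINT \<theta>|cube_measure. g 0 \<theta> - log_det B \<theta>) = L"
    by (rule integrable_monotone_convergence[OF inth _ limh L um], use hmono in simp,
        rule integral_monotone_convergence[OF inth _ limh L um], use hmono in simp)
  have "integrable cube_measure (log_det B)"
    using Bochner_Integration.integrable_diff[OF intg[of 0] lim_int(1)] by simp
  then have "integral\<^sup>L cube_measure (g 0) - integral\<^sup>L cube_measure (log_det B) = L"
    using lim_int(2) intg[of 0] by simp
  moreover have "(\<lambda>m. integral\<^sup>L cube_measure (g 0) - integral\<^sup>L cube_measure (h m)) \<longlonglongrightarrow> integral\<^sup>L cube_measure (g 0) - L"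
    by (intro tendsto_intros L)
  moreover have "integral\<^sup>L cube_measure (g 0) - integral\<^sup>L cube_measure (h m) = integral\<^sup>L cube_measure (g m)" for m
    unfolding h_def using intg by simp
  moreover from calculation(1) have "integral\<^sup>L cube_measure (g 0) - L = integral\<^sup>L cube_measure (log_det B)" by linarith
  ultimately have "(\<lambda>m. integral\<^sup>L cube_measure (g m)) \<longlonglongrightarrow> integral\<^sup>L cube_measure (log_det B)" by (simp only:)
  then show ?thesis unfolding g_def .
qed

end

section \<open>Graphs with a free lattice action\<close>

lemma lattice_group_simps [simp]:
  "carrier lattice_group = UNIV" "x \<otimes>\<^bsub>lattice_group\<^esub> y = x + y" "\<one>\<^bsub>lattice_group\<^esub> = 0"
  by (simp_all add: lattice_group_def)

text \<open>Vertices and edges require the same facts, hence an abstract set with an additively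
  written action.\<close>

locale free_action =
  fixes X :: "'x set" and \<alpha> :: "int ^ 'd::finite \<Rightarrow> 'x \<Rightarrow> 'x"
  assumes zero: "x \<in> X \<Longrightarrow> \<alpha> 0 x = x"
    and add: "x \<in> X \<Longrightarrow> \<alpha> (s + t) x = \<alpha> s (\<alpha> t x)"
    and closed: "x \<in> X \<Longrightarrow> \<alpha> s x \<in> X"
    and free: "x \<in> X \<Longrightarrow> \<alpha> s x = x \<Longrightarrow> s = 0"
    and cofinite: "finite (orbits lattice_group X \<alpha>)"
begin

lemma move: "x \<in> X \<Longrightarrow> y = \<alpha> s x \<longleftrightarrow> y \<in> X \<and> x = \<alpha> (- s) y"
  using add[of x "- s" s] add[of y s "- s"] zero closed by auto

lemma inject: "x \<in> X \<Longrightarrow> \<alpha> s x = \<alpha> t x \<longleftrightarrow> s = t"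
proof
  assume x: "x \<in> X" and eq: "\<alpha> s x = \<alpha> t x"
  have "\<alpha> (- t + s) x = \<alpha> (- t + t) x" using add[OF x, of "- t" s] add[OF x, of "- t" t] eq by simp
  then have "\<alpha> (- t + s) x = x" using zero[OF x] by simp
  then show "s = t" using free[OF x] by fastforce
qed simp

lemma inject_elem: "x \<in> X \<Longrightarrow> y \<in> X \<Longrightarrow> \<alpha> s x = \<alpha> s y \<longleftrightarrow> x = y"
  using move[of x "\<alpha> s y" s] move[of y "\<alpha> s y" s] by auto

lemma finite_orbit_reps:
  obtains R where "finite R" "R \<subseteq> X" "\<And>x. x \<in> X \<Longrightarrow> \<exists>y\<in>R. \<exists>s. x = \<alpha> s y"
proof -
  have "orbits lattice_group X \<alpha> = orbit lattice_group \<alpha> ` X" by (auto simp: orbits_def)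
  then obtain R where R: "R \<subseteq> X" "finite R" "orbit lattice_group \<alpha> ` X = orbit lattice_group \<alpha> ` R"
    using cofinite finite_subset_image[of _ "orbit lattice_group \<alpha>" X] by (metis subset_refl)
  have "\<exists>y\<in>R. \<exists>s. x = \<alpha> s y" if x: "x \<in> X" for x
  proof -
    have "x \<in> orbit lattice_group \<alpha> x" unfolding orbit_def using zero[OF x] by (auto intro!: exI[of _ 0])
    moreover obtain y where "y \<in> R" "orbit lattice_group \<alpha> x = orbit lattice_group \<alpha> y" using R x by blast
    ultimately show ?thesis by (auto simp: orbit_def)
  qed
  then show ?thesis using R that by blast
qed

end

lemma free_actionI:
  assumes act: "group_action lattice_group X \<alpha>"
    and st: "\<And>x. x \<in> X \<Longrightarrow> stabilizer lattice_group \<alpha> x = {0}"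
    and fin: "finite (orbits lattice_group X \<alpha>)"
  shows "free_action X \<alpha>"
proof -
  interpret group_action lattice_group X \<alpha> by (rule act)
  show ?thesis
  proof
    fix x s t assume x: "x \<in> X"
    show "\<alpha> 0 x = x" using id_eq_one x by (simp add: fun_eq_iff restrict_def) (metis (full_types))
    show "\<alpha> (s + t) x = \<alpha> s (\<alpha> t x)" using composition_rule[OF x, of s t] by simp
    show "\<alpha> s x \<in> X" by (rule element_image[OF _ x refl]) simp
    show "s = 0" if "\<alpha> s x = x"
    proof -
      have "s \<in> stabilizer lattice_group \<alpha> x" using that by (simp add: stabilizer_def)
      then show ?thesis using st[OF x] by simp
    qed
  qed (rule fin)
qed

locale lattice_graph = V: free_action "verts G" \<phi> + E: free_action "edges G" \<psi>
  for G :: "('v, 'e) multigraph" and \<phi> :: "int ^ 'd::finite \<Rightarrow> 'v \<Rightarrow> 'v" and \<psi> +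
  fixes n :: nat and r :: "nat \<Rightarrow> 'v"
  assumes wf: "wf_multigraph G"
    and ends_act: "e \<in> edges G \<Longrightarrow> ends G (\<psi> s e) = \<phi> s ` ends G e"
    and reps: "orbit_representatives G \<phi> n r"
begin

lemma r_in: "i < n \<Longrightarrow> r i \<in> verts G"
  using reps by (auto simp: orbit_representatives_def)

lemma vertex_cases:
  assumes "v \<in> verts G"
  obtains i s where "i < n" "v = \<phi> s (r i)"
proof -
  have "orbit lattice_group \<phi> v \<in> (\<lambda>i. orbit lattice_group \<phi> (r i)) ` {..<n}"
    using reps assms by (auto simp: orbit_representatives_def bij_betw_def orbits_def)
  then obtain i where i: "i < n" "orbit lattice_group \<phi> v = orbit lattice_group \<phi> (r i)" by auto
  have "v \<in> orbit lattice_group \<phi> v" unfolding orbit_def using V.zero[OF assms] by (auto intro!: exI[of _ 0])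
  then show ?thesis using i that by (auto simp: orbit_def)
qed

lemma vertex_unique:
  assumes ij: "i < n" "j < n" and eq: "\<phi> s (r i) = \<phi> t (r j)"
  shows "i = j" "s = t"
proof -
  have "r i = \<phi> (- s) (\<phi> t (r j))" using V.move[OF r_in[OF ij(1)], of "\<phi> s (r i)" s] eq by simp
  then have e: "r i = \<phi> (- s + t) (r j)" unfolding V.add[OF r_in[OF ij(2)]] .
  have o: "orbit lattice_group \<phi> (r i) = orbit lattice_group \<phi> (r j)"
  proof -
    have "\<exists>h. \<phi> g (r i) = \<phi> h (r j)" for g
      unfolding e using V.add[OF r_in[OF ij(2)], of g "- s + t"] by metis
    moreover have "\<exists>h. \<phi> g (r j) = \<phi> h (r i)" for g
    proof -
      have "\<phi> (g - (- s + t)) (r i) = \<phi> (g - (- s + t) + (- s + t)) (r j)"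
        using V.add[OF r_in[OF ij(2)], of "g - (- s + t)" "- s + t"] e by simp
      then show ?thesis by (intro exI[of _ "g - (- s + t)"]) simp
    qed
    ultimately show ?thesis by (auto simp: orbit_def)
  qed
  then show "i = j" using reps ij by (auto simp: orbit_representatives_def bij_betw_def inj_on_def)
  then show "s = t" using eq V.inject[OF r_in[OF ij(2)]] by simp
qed

lemma edge_ends:
  assumes "e \<in> edges G"
  obtains u v where "u \<in> verts G" "v \<in> verts G" "ends G e = {u, v}"
  using wf assms unfolding wf_multigraph_def by blast

text \<open>There are finitely many edge orbits, and by freeness at most one translation carries a
  given endpoint of a representative to \<open>x\<close>.\<close>

lemma finite_incident:
  assumes x: "x \<in> verts G"
  shows "finite {e \<in> edges G. x \<in> ends G e}"
proof -
  obtain R where R: "finite R" "R \<subseteq> edges G" "\<And>e. e \<in> edges G \<Longrightarrow> \<exists>e0\<in>R. \<exists>s. e = \<psi> s e0"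
    by (rule E.finite_orbit_reps) blast
  have "{e \<in> edges G. x \<in> ends G e} \<subseteq> (\<Union>e0\<in>R. (\<lambda>s. \<psi> s e0) ` (\<Union>u\<in>ends G e0. {s. \<phi> s u = x}))"
  proof
    fix e assume e: "e \<in> {e \<in> edges G. x \<in> ends G e}"
    then obtain e0 s where es: "e0 \<in> R" "e = \<psi> s e0" using R(3)[of e] by auto
    then have "x \<in> \<phi> s ` ends G e0" using e ends_act[of e0 s] R(2) by auto
    then show "e \<in> (\<Union>e0\<in>R. (\<lambda>s. \<psi> s e0) ` (\<Union>u\<in>ends G e0. {s. \<phi> s u = x}))" using es by auto
  qed
  moreover have "finite (\<Union>e0\<in>R. (\<lambda>s. \<psi> s e0) ` (\<Union>u\<in>ends G e0. {s. \<phi> s u = x}))"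
  proof (intro finite_UN_I R(1) finite_imageI)
    fix e0 assume e0: "e0 \<in> R"
    then have e0E: "e0 \<in> edges G" using R(2) by auto
    obtain u v where uv: "u \<in> verts G" "v \<in> verts G" "ends G e0 = {u, v}" by (rule edge_ends[OF e0E])
    show "finite (ends G e0)" using uv by simp
    fix w assume "w \<in> ends G e0"
    then have w: "w \<in> verts G" using uv by auto
    show "finite {s. \<phi> s w = x}"
    proof (cases "\<exists>s. \<phi> s w = x")
      case True
      then obtain s where "\<phi> s w = x" by blast
      then have "{s. \<phi> s w = x} = {s}" using V.inject[OF w] by auto
      then show ?thesis by simp
    qed simp
  qed
  ultimately show ?thesis by (rule finite_subset)
qed

text \<open>A non-loop edge at \<open>r i\<close> is recorded with the translation of its far
  endpoint. An edge from \<open>r i\<close> into its own orbit lies in \<open>arcs i i\<close>, and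
  so does its translate ending at \<open>r i\<close>, with the opposite exponent.\<close>

definition arcs :: "nat \<Rightarrow> nat \<Rightarrow> ('e \<times> (int ^ 'd)) set" where
  "arcs i j = {(e, s). e \<in> edges G \<and> ends G e = {r i, \<phi> s (r j)} \<and> \<phi> s (r j) \<noteq> r i}"

lemma finite_arcs:
  assumes ij: "i < n" "j < n"
  shows "finite (arcs i j)"
proof (rule inj_on_finite[where f = fst])
  show "inj_on fst (arcs i j)"
  proof (rule inj_onI)
    fix p q assume pq: "p \<in> arcs i j" "q \<in> arcs i j" "fst p = fst q"
    obtain e s t where p: "p = (e, s)" and q: "q = (e, t)" using pq(3) by (cases p, cases q) auto
    have "{r i, \<phi> s (r j)} = {r i, \<phi> t (r j)}" "\<phi> s (r j) \<noteq> r i" "\<phi> t (r j) \<noteq> r i"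
      using pq unfolding p q arcs_def by auto
    then have "\<phi> s (r j) = \<phi> t (r j)" by (simp add: doubleton_eq_iff)
    then show "p = q" using V.inject[OF r_in[OF ij(2)]] by (simp add: p q)
  qed
  show "fst ` arcs i j \<subseteq> {e \<in> edges G. r i \<in> ends G e}" by (auto simp: arcs_def)
  show "finite {e \<in> edges G. r i \<in> ends G e}" by (rule finite_incident[OF r_in[OF ij(1)]])
qed

text \<open>The far endpoint of a non-loop edge has unique coordinates \<open>(j, s)\<close>, so
  each such edge is recorded exactly once.\<close>

lemma sum_card_arcs:
  assumes i: "i < n"
  shows "(\<Sum>j<n. card (arcs i j)) = nonloop_degree G (r i)"
proof -
  have "(\<Sum>j<n. card (arcs i j)) = card (Sigma {..<n} (arcs i))"
    by (subst card_SigmaI) (auto simp: finite_arcs i)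
  also have "\<dots> = card {e \<in> edges G. r i \<in> ends G e \<and> ends G e \<noteq> {r i}}"
  proof (rule bij_betw_same_card[of "\<lambda>(j, e, s). e"])
    show "bij_betw (\<lambda>(j, e, s). e) (Sigma {..<n} (arcs i)) {e \<in> edges G. r i \<in> ends G e \<and> ends G e \<noteq> {r i}}"
      unfolding bij_betw_def
    proof
      show "inj_on (\<lambda>(j, e, s). e) (Sigma {..<n} (arcs i))"
      proof (rule inj_onI)
        fix p q assume pq: "p \<in> Sigma {..<n} (arcs i)" "q \<in> Sigma {..<n} (arcs i)"
          "(case p of (j, e, s) \<Rightarrow> e) = (case q of (j, e, s) \<Rightarrow> e)"
        obtain e j s k t where p: "p = (j, e, s)" and q: "q = (k, e, t)" using pq(3) by (cases p, cases q) auto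
        have jk: "j < n" "k < n" and "{r i, \<phi> s (r j)} = {r i, \<phi> t (r k)}" "\<phi> s (r j) \<noteq> r i" "\<phi> t (r k) \<noteq> r i"
          using pq unfolding p q arcs_def by auto
        then have eq: "\<phi> s (r j) = \<phi> t (r k)" by (simp add: doubleton_eq_iff)
        show "p = q" using vertex_unique[OF jk eq] by (simp add: p q)
      qed
      show "(\<lambda>(j, e, s). e) ` Sigma {..<n} (arcs i) = {e \<in> edges G. r i \<in> ends G e \<and> ends G e \<noteq> {r i}}"
      proof (intro equalityI subsetI)
        fix e assume "e \<in> (\<lambda>(j, e, s). e) ` Sigma {..<n} (arcs i)"
        then show "e \<in> {e \<in> edges G. r i \<in> ends G e \<and> ends G e \<noteq> {r i}}" by (auto simp: arcs_def)
      next
        fix e assume e: "e \<in> {e \<in> edges G. r i \<in> ends G e \<and> ends G e \<noteq> {r i}}"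
        then obtain u v where uv: "u \<in> verts G" "v \<in> verts G" "ends G e = {u, v}" using edge_ends[of e] by blast
        then obtain w where w: "w \<in> verts G" "ends G e = {r i, w}" "w \<noteq> r i" using e by auto
        obtain j s where "j < n" "w = \<phi> s (r j)" by (rule vertex_cases[OF w(1)])
        then show "e \<in> (\<lambda>(j, e, s). e) ` Sigma {..<n} (arcs i)"
          using e w by (intro image_eqI[of _ _ "(j, e, s)"]) (auto simp: arcs_def)
      qed
    qed
  qed
  finally show ?thesis by (simp add: nonloop_degree_def)
qed

lemma adjacency_arcs: "adjacency_entry G \<phi> (r i) (r j) = (\<Sum>(e, s)\<in>arcs i j. Poly_Mapping.single s 1)"
  by (simp add: adjacency_entry_def arcs_def)

text \<open>A common bound for all degrees; the summand 1 keeps it positive for a graph without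
  edges.\<close>

definition total_degree :: nat where
  "total_degree = 1 + (\<Sum>i<n. nonloop_degree G (r i))"

definition walk_mat :: "'d laurent mat" where
  "walk_mat = mat n n (\<lambda>(i, j). (if i = j then of_nat total_degree else 0) - laplacian_matrix G \<phi> n r $$ (i, j))"

lemma walk_mat_entry:
  assumes "i < n" "j < n"
  shows "walk_mat $$ (i, j) = (if i = j then of_nat (total_degree - nonloop_degree G (r i)) else 0)
      + (\<Sum>(e, s)\<in>arcs i j. Poly_Mapping.single s 1)"
proof -
  have "nonloop_degree G (r i) \<le> (\<Sum>i<n. nonloop_degree G (r i))"
    using member_le_sum[of i "{..<n}" "\<lambda>i. nonloop_degree G (r i)"] assms by auto
  then have "nonloop_degree G (r i) \<le> total_degree" by (simp add: total_degree_def)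
  then have "(of_nat (total_degree - nonloop_degree G (r i)) :: 'd laurent) = of_nat total_degree - of_nat (nonloop_degree G (r i))"
    by (rule of_nat_diff)
  then show ?thesis using assms
    by (auto simp: walk_mat_def laplacian_matrix_def adjacency_arcs)
qed

lemma lin_ext_walk_mat:
  assumes "i < n" "j < n"
  shows "lin_ext F (walk_mat $$ (i, j)) = (if i = j then of_nat (total_degree - nonloop_degree G (r i)) * F 0 else 0)
      + (\<Sum>(e, s)\<in>arcs i j. F s)"
  using lin_ext_of_int[of F "int (total_degree - nonloop_degree G (r i))"]
  by (auto simp: walk_mat_entry[OF assms] lin_ext_add lin_ext_sum case_prod_unfold)

lemma laurent_chain_walk_mat: "laurent_chain walk_mat n (real total_degree)"
proof
  show "walk_mat \<in> carrier_mat n n" by (simp add: walk_mat_def)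
  fix i assume i: "i < n"
  show "(\<Sum>j<n. lin_ext (\<lambda>_. 1) (walk_mat $$ (i, j))) = real total_degree"
  proof -
    have d: "nonloop_degree G (r i) \<le> total_degree"
      using member_le_sum[of i "{..<n}" "\<lambda>i. nonloop_degree G (r i)"] i by (auto simp: total_degree_def)
    have "(\<Sum>j<n. lin_ext (\<lambda>_. 1) (walk_mat $$ (i, j)))
        = (\<Sum>j<n. (if i = j then real (total_degree - nonloop_degree G (r i)) else 0) + real (card (arcs i j)))"
      using i by (intro sum.cong refl) (simp add: lin_ext_walk_mat case_prod_unfold)
    also have "\<dots> = real (total_degree - nonloop_degree G (r i)) + real (nonloop_degree G (r i))"
      using i by (simp add: sum.distrib sum_card_arcs[OF i, symmetric])
    finally show ?thesis using d by simp
  qed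
  fix j s assume j: "j < n"
  have "Poly_Mapping.lookup (of_nat k :: 'd laurent) s \<ge> 0" for k
    by (induction k) (auto simp: lookup_add lookup_one when_def)
  moreover have "Poly_Mapping.lookup (\<Sum>(e, s)\<in>arcs i j. Poly_Mapping.single s (1::int)) s \<ge> 0"
    unfolding lookup_sum by (intro sum_nonneg) (auto simp: lookup_single when_def)
  ultimately show "Poly_Mapping.lookup (walk_mat $$ (i, j)) s \<ge> 0"
    by (auto simp: walk_mat_entry[OF i j] lookup_add)
qed (simp add: total_degree_def del: of_nat_Suc of_nat_add of_nat_sum)

text \<open>At the endpoint \<open>t = 0\<close> of the regularization
  \<open>total_degree - walk_mat\<close> is the Laplacian matrix, and evaluation, a ring
  homomorphism, commutes with the determinant.\<close>

lemma log_det_total_degree: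
  "laurent_chain.log_det walk_mat n (real total_degree) \<theta>
     = ln (cmod (laurent_eval (laplacian_polynomial G \<phi> n r) (torus_point \<theta>)))"
proof -
  interpret laurent_chain walk_mat n "real total_degree" by (rule laurent_chain_walk_mat)
  interpret h: comm_ring_hom "\<lambda>f. laurent_eval f (torus_point \<theta>)" by (rule torus_hom)
  have nat: "laurent_eval (of_nat k) (torus_point \<theta>) = of_nat k" for k
    using lin_ext_of_int[of "monomial_value (torus_point \<theta>)" "int k"] by (simp add: laurent_eval_lin_ext)
  have "of_real (real total_degree) \<cdot>\<^sub>m 1\<^sub>m n - W_at \<theta> = map_mat (\<lambda>f. laurent_eval f (torus_point \<theta>)) (laplacian_matrix G \<phi> n r)"
    unfolding W_at_def by (intro eq_matI) (auto simp: walk_mat_def laplacian_matrix_def h.hom_minus nat)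
  then show ?thesis unfolding log_det_def laplacian_polynomial_def by (simp add: h.hom_det)
qed

end

section \<open>Finite quotients\<close>

locale sublattice =
  fixes \<Lambda> :: "(int ^ 'd::finite) set"
  assumes finite_index: "finite_index_sublattice \<Lambda>"
begin

lemma L_zero: "0 \<in> \<Lambda>" and L_add: "a \<in> \<Lambda> \<Longrightarrow> b \<in> \<Lambda> \<Longrightarrow> a + b \<in> \<Lambda>"
proof -
  have sub: "subgroup \<Lambda> lattice_group" using finite_index by (simp add: finite_index_sublattice_def)
  show "0 \<in> \<Lambda>" using subgroup.one_closed[OF sub] by simp
  show "a + b \<in> \<Lambda>" if "a \<in> \<Lambda>" "b \<in> \<Lambda>" using subgroup.m_closed[OF sub that] by simp
qed

lemma lattice_inv: "inv\<^bsub>lattice_group\<^esub> (a :: int ^ 'd) = - a"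
proof -
  have "group (lattice_group :: (int ^ 'd) monoid)"
  proof (rule groupI)
    fix x :: "int ^ 'd"
    show "\<exists>y\<in>carrier lattice_group. y \<otimes>\<^bsub>lattice_group\<^esub> x = \<one>\<^bsub>lattice_group\<^esub>"
      by (rule bexI[of _ "- x"]) simp_all
  qed (simp_all add: add.assoc)
  then interpret group "lattice_group :: (int ^ 'd) monoid" .
  show ?thesis by (rule inv_equality) simp_all
qed

lemma L_uminus: "a \<in> \<Lambda> \<Longrightarrow> - a \<in> \<Lambda>"
  using finite_index subgroup.m_inv_closed[of \<Lambda> lattice_group a]
  by (simp add: finite_index_sublattice_def lattice_inv)

lemma L_uminus_iff: "- a \<in> \<Lambda> \<longleftrightarrow> a \<in> \<Lambda>"
  using L_uminus[of a] L_uminus[of "- a"] by auto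

lemma L_diff: "a \<in> \<Lambda> \<Longrightarrow> b \<in> \<Lambda> \<Longrightarrow> a - b \<in> \<Lambda>"
  using L_add[of a "- b"] L_uminus[of b] by simp

lemma L_diff_trans: "a - b \<in> \<Lambda> \<Longrightarrow> (a - c \<in> \<Lambda> \<longleftrightarrow> b - c \<in> \<Lambda>)"
  using L_add[of "a - b" "b - c"] L_diff[of "a - c" "a - b"] by (auto simp: algebra_simps)

definition transversal :: "(int ^ 'd) set" where
  "transversal = (\<lambda>X. SOME a. X = {h + a | h. h \<in> \<Lambda>}) ` (rcosets\<^bsub>lattice_group\<^esub> \<Lambda>)"

lemma coset_eq: "{h + a | h. h \<in> \<Lambda>} = {h + b | h. h \<in> \<Lambda>} \<longleftrightarrow> a - b \<in> \<Lambda>"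
proof
  assume eq: "{h + a | h. h \<in> \<Lambda>} = {h + b | h. h \<in> \<Lambda>}"
  have "a \<in> {h + a | h. h \<in> \<Lambda>}" using L_zero by force
  then show "a - b \<in> \<Lambda>" unfolding eq by auto
next
  assume ab: "a - b \<in> \<Lambda>"
  show "{h + a | h. h \<in> \<Lambda>} = {h + b | h. h \<in> \<Lambda>}"
  proof (intro equalityI subsetI)
    fix x assume "x \<in> {h + a | h. h \<in> \<Lambda>}"
    then obtain h where "h \<in> \<Lambda>" "x = h + a" by auto
    then show "x \<in> {h + b | h. h \<in> \<Lambda>}" using L_add[OF _ ab, of h] by (auto intro!: exI[of _ "h + (a - b)"])
  next
    fix x assume "x \<in> {h + b | h. h \<in> \<Lambda>}"
    then obtain h where "h \<in> \<Lambda>" "x = h + b" by auto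
    then show "x \<in> {h + a | h. h \<in> \<Lambda>}" using L_diff[OF _ ab, of h] by (auto intro!: exI[of _ "h - (a - b)"])
  qed
qed

lemma rcosets_eq: "rcosets\<^bsub>lattice_group\<^esub> \<Lambda> = range (\<lambda>a. {h + a | h. h \<in> \<Lambda>})"
  by (auto simp: RCOSETS_def r_coset_def)

lemma transversal_choice:
  assumes "X \<in> rcosets\<^bsub>lattice_group\<^esub> \<Lambda>"
  shows "X = {h + (SOME a. X = {h + a | h. h \<in> \<Lambda>}) | h. h \<in> \<Lambda>}"
  by (rule someI_ex) (use assms in \<open>auto simp: rcosets_eq\<close>)

lemma finite_transversal: "finite transversal"
  using finite_index by (simp add: transversal_def finite_index_sublattice_def)

lemma card_transversal: "card transversal = lattice_index \<Lambda>"
  unfolding transversal_def lattice_index_def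
proof (rule card_image, rule inj_onI)
  fix X Y assume X: "X \<in> rcosets\<^bsub>lattice_group\<^esub> \<Lambda>" and Y: "Y \<in> rcosets\<^bsub>lattice_group\<^esub> \<Lambda>"
    and eq: "(SOME a. X = {h + a | h. h \<in> \<Lambda>}) = (SOME a. Y = {h + a | h. h \<in> \<Lambda>})"
  have "X = {h + (SOME a. X = {h + a | h. h \<in> \<Lambda>}) | h. h \<in> \<Lambda>}" by (rule transversal_choice[OF X])
  also have "\<dots> = {h + (SOME a. Y = {h + a | h. h \<in> \<Lambda>}) | h. h \<in> \<Lambda>}" by (simp only: eq)
  also have "\<dots> = Y" by (rule transversal_choice[OF Y, symmetric])
  finally show "X = Y" .
qed

lemma transversal_ex: obtains c where "c \<in> transversal" "a - c \<in> \<Lambda>"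
proof -
  let ?X = "{h + a | h. h \<in> \<Lambda>}"
  have X: "?X \<in> rcosets\<^bsub>lattice_group\<^esub> \<Lambda>" by (auto simp: rcosets_eq)
  define c where "c = (SOME b. ?X = {h + b | h. h \<in> \<Lambda>})"
  have "c \<in> transversal" unfolding transversal_def c_def using X by (rule imageI)
  moreover have "?X = {h + c | h. h \<in> \<Lambda>}" unfolding c_def by (rule transversal_choice[OF X])
  then have "a - c \<in> \<Lambda>" by (simp only: coset_eq)
  ultimately show ?thesis by (rule that)
qed

lemma transversal_unique:
  assumes "b \<in> transversal" "c \<in> transversal" "b - c \<in> \<Lambda>"
  shows "b = c"
proof -
  obtain X Y where X: "X \<in> rcosets\<^bsub>lattice_group\<^esub> \<Lambda>" "b = (SOME a. X = {h + a | h. h \<in> \<Lambda>})"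
    and Y: "Y \<in> rcosets\<^bsub>lattice_group\<^esub> \<Lambda>" "c = (SOME a. Y = {h + a | h. h \<in> \<Lambda>})"
    using assms(1,2) by (auto simp: transversal_def)
  have "X = {h + b | h. h \<in> \<Lambda>}" unfolding X(2) by (rule transversal_choice[OF X(1)])
  also have "\<dots> = {h + c | h. h \<in> \<Lambda>}" using assms(3) by (simp only: coset_eq)
  also have "\<dots> = Y" unfolding Y(2) by (rule transversal_choice[OF Y(1), symmetric])
  finally show ?thesis by (simp add: X(2) Y(2))
qed

text \<open>The coefficient at the class of \<open>u\<close> of the image of a Laurent polynomial in
  the group ring of the lattice modulo \<Lambda>.\<close>

definition push :: "int ^ 'd \<Rightarrow> 'd laurent \<Rightarrow> real" where
  "push u = lin_ext (\<lambda>s. if s - u \<in> \<Lambda> then 1 else 0)"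

lemma sum_transversal_indicator:
  "(\<Sum>c\<in>transversal. if a - c \<in> \<Lambda> then f c else (0::real)) = f (THE c. c \<in> transversal \<and> a - c \<in> \<Lambda>)"
  "(THE c. c \<in> transversal \<and> a - c \<in> \<Lambda>) \<in> transversal"
  "a - (THE c. c \<in> transversal \<and> a - c \<in> \<Lambda>) \<in> \<Lambda>"
proof -
  obtain c where c: "c \<in> transversal" "a - c \<in> \<Lambda>" by (rule transversal_ex)
  have uniq: "b = c" if b: "b \<in> transversal" "a - b \<in> \<Lambda>" for b
  proof (rule transversal_unique[OF b(1) c(1)])
    show "b - c \<in> \<Lambda>" using L_diff[OF c(2) b(2)] by (simp add: algebra_simps)
  qed
  have the: "(THE c. c \<in> transversal \<and> a - c \<in> \<Lambda>) = c" 
    by (rule the_equality, rule conjI[OF c], elim conjE, rule uniq)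
  have "(\<Sum>d\<in>transversal. if a - d \<in> \<Lambda> then f d else 0) = (\<Sum>d\<in>{c}. if a - d \<in> \<Lambda> then f d else 0)"
  proof (rule sum.mono_neutral_right[OF finite_transversal])
    show "{c} \<subseteq> transversal" using c(1) by simp
    show "\<forall>d\<in>transversal - {c}. (if a - d \<in> \<Lambda> then f d else 0) = 0"
    proof
      fix d assume d: "d \<in> transversal - {c}"
      then have "a - d \<notin> \<Lambda>" using uniq[of d] by blast
      then show "(if a - d \<in> \<Lambda> then f d else 0) = 0" by simp
    qed
  qed
  then show "(\<Sum>c\<in>transversal. if a - c \<in> \<Lambda> then f c else 0) = f (THE c. c \<in> transversal \<and> a - c \<in> \<Lambda>)"
    and "(THE c. c \<in> transversal \<and> a - c \<in> \<Lambda>) \<in> transversal"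
    and "a - (THE c. c \<in> transversal \<and> a - c \<in> \<Lambda>) \<in> \<Lambda>"
    using c unfolding the by simp_all
qed

text \<open>The matrix with entries \<open>push (b - a) f\<close> describes multiplication by the
  image of \<open>f\<close> on the group ring of the finite quotient; products of polynomials
  therefore become matrix products.\<close>

lemma push_mult: "push (b - a) (f * g) = (\<Sum>c\<in>transversal. push (c - a) f * push (b - c) g)"
proof -
  have one: "(\<Sum>c\<in>transversal. (if s - (c - a) \<in> \<Lambda> then 1 else 0) * (if t - (b - c) \<in> \<Lambda> then 1 else (0::real)))
      = (if s + t - (b - a) \<in> \<Lambda> then 1 else 0)" for s t
  proof -
    define c0 where "c0 = (THE c. c \<in> transversal \<and> (s + a) - c \<in> \<Lambda>)"
    have "(\<Sum>c\<in>transversal. (if s - (c - a) \<in> \<Lambda> then 1 else 0) * (if t - (b - c) \<in> \<Lambda> then 1 else (0::real)))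
        = (\<Sum>c\<in>transversal. if (s + a) - c \<in> \<Lambda> then (if t - (b - c) \<in> \<Lambda> then 1 else 0) else 0)"
      by (intro sum.cong refl) (simp add: algebra_simps)
    also have "\<dots> = (if t - (b - c0) \<in> \<Lambda> then 1 else 0)"
      unfolding c0_def by (rule sum_transversal_indicator(1))
    also have "t - (b - c0) \<in> \<Lambda> \<longleftrightarrow> s + t - (b - a) \<in> \<Lambda>"
      using L_diff_trans[of "s + a" c0 "b - t"] sum_transversal_indicator(3)[of "s + a"]
      unfolding c0_def[symmetric] by (simp add: algebra_simps)
    finally show ?thesis .
  qed
  have "(\<Sum>c\<in>transversal. push (c - a) f * push (b - c) g)
      = (\<Sum>c\<in>transversal. \<Sum>s\<in>Poly_Mapping.keys f. \<Sum>t\<in>Poly_Mapping.keys g.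
          of_int (Poly_Mapping.lookup f s) * of_int (Poly_Mapping.lookup g t) *
          ((if s - (c - a) \<in> \<Lambda> then 1 else 0) * (if t - (b - c) \<in> \<Lambda> then 1 else 0)))"
    unfolding push_def lin_ext_def sum_product by (intro sum.cong refl) (simp only: mult_ac)
  also have "\<dots> = (\<Sum>s\<in>Poly_Mapping.keys f. \<Sum>c\<in>transversal. \<Sum>t\<in>Poly_Mapping.keys g.
          of_int (Poly_Mapping.lookup f s) * of_int (Poly_Mapping.lookup g t) *
          ((if s - (c - a) \<in> \<Lambda> then 1 else 0) * (if t - (b - c) \<in> \<Lambda> then 1 else 0)))"
    by (rule sum.swap)
  also have "\<dots> = (\<Sum>s\<in>Poly_Mapping.keys f. \<Sum>t\<in>Poly_Mapping.keys g.
          of_int (Poly_Mapping.lookup f s) * of_int (Poly_Mapping.lookup g t) * (if s + t - (b - a) \<in> \<Lambda> then 1 else 0))"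
  proof (rule sum.cong[OF refl])
    fix s
    show "(\<Sum>c\<in>transversal. \<Sum>t\<in>Poly_Mapping.keys g.
          of_int (Poly_Mapping.lookup f s) * of_int (Poly_Mapping.lookup g t) *
          ((if s - (c - a) \<in> \<Lambda> then 1 else 0) * (if t - (b - c) \<in> \<Lambda> then 1 else (0::real))))
      = (\<Sum>t\<in>Poly_Mapping.keys g.
          of_int (Poly_Mapping.lookup f s) * of_int (Poly_Mapping.lookup g t) * (if s + t - (b - a) \<in> \<Lambda> then 1 else 0))"
      by (subst sum.swap) (simp only: sum_distrib_left[symmetric] one)
  qed
  also have "\<dots> = push (b - a) (f * g)" unfolding push_def lin_ext_mult ..
  finally show ?thesis by (rule sym)
qed

lemma push_total: "(\<Sum>c\<in>transversal. push (c - a) f) = lin_ext (\<lambda>_. 1) f"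
proof -
  have "(\<Sum>c\<in>transversal. push (c - a) f) = (\<Sum>s\<in>Poly_Mapping.keys f. of_int (Poly_Mapping.lookup f s) *
      (\<Sum>c\<in>transversal. if (s + a) - c \<in> \<Lambda> then 1 else (0::real)))"
    unfolding push_def lin_ext_def by (subst sum.swap) (simp add: sum_distrib_left algebra_simps)
  then show ?thesis unfolding sum_transversal_indicator(1) lin_ext_def .
qed

end

section \<open>Vertices, edges and walks of the quotient graph\<close>

locale quotient_lattice_graph = lattice_graph G \<phi> \<psi> n r + sublattice \<Lambda>
  for G :: "('v, 'e) multigraph" and \<phi> :: "int ^ 'd::finite \<Rightarrow> 'v \<Rightarrow> 'v" and \<psi> n r and \<Lambda> :: "(int ^ 'd) set"
begin

abbreviation Q where "Q \<equiv> quotient_graph G \<phi> \<psi> \<Lambda>"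

abbreviation vclass :: "'v \<Rightarrow> 'v set" where "vclass \<equiv> orbit (lattice_group\<lparr>carrier := \<Lambda>\<rparr>) \<phi>"
abbreviation eclass :: "'e \<Rightarrow> 'e set" where "eclass \<equiv> orbit (lattice_group\<lparr>carrier := \<Lambda>\<rparr>) \<psi>"

lemma class_eq:
  assumes "free_action X \<alpha>" and x: "x \<in> X" and y: "y \<in> X"
  shows "orbit (lattice_group\<lparr>carrier := \<Lambda>\<rparr>) \<alpha> x = orbit (lattice_group\<lparr>carrier := \<Lambda>\<rparr>) \<alpha> y
      \<longleftrightarrow> (\<exists>l\<in>\<Lambda>. y = \<alpha> l x)"
proof -
  interpret free_action X \<alpha> by fact
  have refl: "z \<in> orbit (lattice_group\<lparr>carrier := \<Lambda>\<rparr>) \<alpha> z" if "z \<in> X" for z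
    unfolding orbit_def using L_zero zero[OF that] by force
  have tr: "orbit (lattice_group\<lparr>carrier := \<Lambda>\<rparr>) \<alpha> (\<alpha> l z) \<subseteq> orbit (lattice_group\<lparr>carrier := \<Lambda>\<rparr>) \<alpha> z"
    if z: "z \<in> X" and l: "l \<in> \<Lambda>" for z l
  proof
    fix w assume "w \<in> orbit (lattice_group\<lparr>carrier := \<Lambda>\<rparr>) \<alpha> (\<alpha> l z)"
    then obtain k where k: "k \<in> \<Lambda>" "w = \<alpha> k (\<alpha> l z)" by (auto simp: orbit_def)
    then have "w = \<alpha> (k + l) z" using add[OF z] by simp
    then show "w \<in> orbit (lattice_group\<lparr>carrier := \<Lambda>\<rparr>) \<alpha> z" using L_add[OF k(1) l] by (auto simp: orbit_def)
  qed
  show ?thesis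
  proof
    assume "orbit (lattice_group\<lparr>carrier := \<Lambda>\<rparr>) \<alpha> x = orbit (lattice_group\<lparr>carrier := \<Lambda>\<rparr>) \<alpha> y"
    then have "y \<in> orbit (lattice_group\<lparr>carrier := \<Lambda>\<rparr>) \<alpha> x" using refl[OF y] by simp
    then show "\<exists>l\<in>\<Lambda>. y = \<alpha> l x" by (auto simp: orbit_def)
  next
    assume "\<exists>l\<in>\<Lambda>. y = \<alpha> l x"
    then obtain l where l: "l \<in> \<Lambda>" "y = \<alpha> l x" by blast
    then have "x = \<alpha> (- l) y" using move[OF x] by simp
    then show "orbit (lattice_group\<lparr>carrier := \<Lambda>\<rparr>) \<alpha> x = orbit (lattice_group\<lparr>carrier := \<Lambda>\<rparr>) \<alpha> y"
      using tr[OF x l(1)] tr[OF y L_uminus[OF l(1)]] l(2) by auto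
  qed
qed

lemmas vclass_eq = class_eq[OF V.free_action_axioms]
lemmas eclass_eq = class_eq[OF E.free_action_axioms]

lemma verts_Q: "verts Q = vclass ` verts G" and edges_Q: "edges Q = eclass ` edges G"
  by (simp_all add: quotient_graph_def orbits_def Setcompr_eq_image)

lemma ends_Q:
  assumes e: "e \<in> edges G"
  shows "ends Q (eclass e) = vclass ` ends G e"
proof -
  obtain u v where uv: "u \<in> verts G" "v \<in> verts G" "ends G e = {u, v}" by (rule edge_ends[OF e])
  have same: "vclass ` ends G e' = vclass ` ends G e" if e': "e' \<in> eclass e" for e'
  proof -
    obtain l where l: "l \<in> \<Lambda>" "e' = \<psi> l e" using e' by (auto simp: orbit_def)
    have *: "vclass (\<phi> l w) = vclass w" if w: "w \<in> verts G" for w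
      by (rule vclass_eq[OF w V.closed[OF w], THEN iffD2, symmetric]) (rule bexI[OF refl l(1)])
    show ?thesis unfolding l(2) ends_act[OF e] uv(3) by (simp add: *[OF uv(1)] *[OF uv(2)])
  qed
  have ne: "eclass e \<noteq> {}" unfolding orbit_def using L_zero by auto
  have "ends Q (eclass e) = (\<Union>e'\<in>eclass e. vclass ` ends G e')" by (simp add: quotient_graph_def)
  also have "\<dots> = (\<Union>e'\<in>eclass e. vclass ` ends G e)" by (rule SUP_cong[OF refl same])
  also have "\<dots> = vclass ` ends G e" using ne by simp
  finally show ?thesis .
qed

definition vx :: "nat \<Rightarrow> int ^ 'd \<Rightarrow> 'v set" where
  "vx i a = vclass (\<phi> a (r i))"

lemma vx_eq: "i < n \<Longrightarrow> j < n \<Longrightarrow> vx i a = vx j b \<longleftrightarrow> i = j \<and> b - a \<in> \<Lambda>"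
proof -
  assume ij: "i < n" "j < n"
  have "vx i a = vx j b \<longleftrightarrow> (\<exists>l\<in>\<Lambda>. \<phi> b (r j) = \<phi> l (\<phi> a (r i)))"
    unfolding vx_def by (rule vclass_eq) (auto intro: V.closed r_in ij)
  also have "\<dots> \<longleftrightarrow> (\<exists>l\<in>\<Lambda>. \<phi> b (r j) = \<phi> (l + a) (r i))" using V.add[OF r_in[OF ij(1)]] by simp
  also have "\<dots> \<longleftrightarrow> i = j \<and> b - a \<in> \<Lambda>"
  proof
    assume "\<exists>l\<in>\<Lambda>. \<phi> b (r j) = \<phi> (l + a) (r i)"
    then obtain l where l: "l \<in> \<Lambda>" "\<phi> b (r j) = \<phi> (l + a) (r i)" by blast
    show "i = j \<and> b - a \<in> \<Lambda>" using vertex_unique[OF ij(2,1) l(2)] l(1) by simp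
  next
    assume "i = j \<and> b - a \<in> \<Lambda>"
    then show "\<exists>l\<in>\<Lambda>. \<phi> b (r j) = \<phi> (l + a) (r i)" by (auto intro!: bexI[of _ "b - a"])
  qed
  finally show ?thesis .
qed

lemma vx_in: "i < n \<Longrightarrow> vx i a \<in> verts Q"
  unfolding vx_def verts_Q by (auto intro: V.closed r_in)

lemma verts_Q_bij: "bij_betw (\<lambda>(i, a). vx i a) ({..<n} \<times> transversal) (verts Q)"
  unfolding bij_betw_def
proof
  show "inj_on (\<lambda>(i, a). vx i a) ({..<n} \<times> transversal)"
  proof (rule inj_onI)
    fix p q assume pq: "p \<in> {..<n} \<times> transversal" "q \<in> {..<n} \<times> transversal"
      "(case p of (i, a) \<Rightarrow> vx i a) = (case q of (i, a) \<Rightarrow> vx i a)"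
    obtain i a j b where p: "p = (i, a)" and q: "q = (j, b)" by (cases p, cases q) auto
    have "i = j \<and> b - a \<in> \<Lambda>" using pq vx_eq[of i j a b] by (simp add: p q)
    then show "p = q" using transversal_unique[of b a] pq by (simp add: p q)
  qed
  show "(\<lambda>(i, a). vx i a) ` ({..<n} \<times> transversal) = verts Q"
  proof (intro equalityI subsetI)
    fix x assume "x \<in> (\<lambda>(i, a). vx i a) ` ({..<n} \<times> transversal)"
    then show "x \<in> verts Q" using vx_in by auto
  next
    fix x assume "x \<in> verts Q"
    then obtain v where v: "v \<in> verts G" "x = vclass v" by (auto simp: verts_Q)
    obtain i s where iv: "i < n" "v = \<phi> s (r i)" by (rule vertex_cases[OF v(1)])
    obtain c where c: "c \<in> transversal" "s - c \<in> \<Lambda>" by (rule transversal_ex)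
    have "x = vx i s" by (simp add: v(2) iv(2) vx_def)
    also have "\<dots> = vx i c" using vx_eq[OF iv(1) iv(1), of s c] L_uminus[OF c(2)] by simp
    finally show "x \<in> (\<lambda>(i, a). vx i a) ` ({..<n} \<times> transversal)" using iv c by auto
  qed
qed

lemma sum_verts_Q: "sum f (verts Q) = (\<Sum>i<n. \<Sum>a\<in>transversal. f (vx i a))"
  using sum.reindex_bij_betw[OF verts_Q_bij, of f] by (simp add: sum.cartesian_product case_prod_unfold)

lemma card_verts_Q: "card (verts Q) = n * lattice_index \<Lambda>"
  using bij_betw_same_card[OF verts_Q_bij] by (simp add: card_cartesian_product card_transversal)

lemma finite_multigraph_Q: "finite_multigraph Q"
proof
  show "finite (verts Q)"
    using bij_betw_finite[OF verts_Q_bij] finite_transversal by simp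
  show "wf_multigraph Q"
    unfolding wf_multigraph_def
  proof
    fix X assume "X \<in> edges Q"
    then obtain e where e: "e \<in> edges G" "X = eclass e" by (auto simp: edges_Q)
    obtain u v where "u \<in> verts G" "v \<in> verts G" "ends G e = {u, v}" by (rule edge_ends[OF e(1)])
    then have "ends Q X = {vclass u, vclass v}" "vclass u \<in> verts Q" "vclass v \<in> verts Q"
      unfolding e(2) ends_Q[OF e(1)] by (simp_all add: verts_Q)
    then show "\<exists>u\<in>verts Q. \<exists>v\<in>verts Q. ends Q X = {u, v}" by blast
  qed
  obtain R where R: "finite R" "R \<subseteq> edges G" "\<And>e. e \<in> edges G \<Longrightarrow> \<exists>e0\<in>R. \<exists>s. e = \<psi> s e0"
    by (rule E.finite_orbit_reps) blast
  have "edges Q \<subseteq> (\<lambda>(e, c). eclass (\<psi> c e)) ` (R \<times> transversal)"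
  proof
    fix X assume "X \<in> edges Q"
    then obtain e where e: "e \<in> edges G" "X = eclass e" by (auto simp: edges_Q)
    obtain e0 s where es: "e0 \<in> R" "e = \<psi> s e0" using R(3)[OF e(1)] by blast
    have e0: "e0 \<in> edges G" using es R(2) by auto
    obtain c where c: "c \<in> transversal" "s - c \<in> \<Lambda>" by (rule transversal_ex)
    have "\<psi> s e0 = \<psi> (s - c) (\<psi> c e0)" using E.add[OF e0, of "s - c" c] by simp
    then have "eclass (\<psi> c e0) = eclass e"
      by (intro eclass_eq[OF E.closed[OF e0] e(1), THEN iffD2] bexI[OF _ c(2)]) (simp add: es(2))
    then show "X \<in> (\<lambda>(e, c). eclass (\<psi> c e)) ` (R \<times> transversal)"
      using es(1) c(1) e(2) by (intro image_eqI[of _ _ "(e0, c)"]) simp_all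
  qed
  then show "finite (edges Q)" by (rule finite_subset) (intro finite_imageI finite_cartesian_product R(1) finite_transversal)
qed

text \<open>An edge of the quotient between two distinct vertices lifts to exactly one edge with its
  first endpoint at \<open>\<phi> a (r i)\<close>. Translating that endpoint back to
  \<open>r i\<close> gives an arc whose exponent is known modulo \<Lambda>.\<close>

lemma adj_Q:
  assumes ij: "i < n" "j < n" and ne: "vx i a \<noteq> vx j b"
  shows "adj Q (vx i a) (vx j b) = card {(e, s) \<in> arcs i j. s - (b - a) \<in> \<Lambda>}"
proof -
  have ri: "r i \<in> verts G" and rj: "r j \<in> verts G" using ij r_in by auto
  have nL: "\<not> (i = j \<and> b - a \<in> \<Lambda>)" using ne vx_eq[OF ij] by simp
  let ?S = "{(e, s) \<in> arcs i j. s - (b - a) \<in> \<Lambda>}"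
  let ?g = "\<lambda>(e, s). eclass (\<psi> a e)"
  have "bij_betw ?g ?S {X \<in> edges Q. ends Q X = {vx i a, vx j b}}"
    unfolding bij_betw_def
  proof
    show "inj_on ?g ?S"
    proof (rule inj_onI)
      fix p q assume pq: "p \<in> ?S" "q \<in> ?S" "?g p = ?g q"
      obtain e s e' s' where p: "p = (e, s)" and q: "q = (e', s')" by (cases p, cases q) auto
      have e: "e \<in> edges G" "ends G e = {r i, \<phi> s (r j)}" "\<phi> s (r j) \<noteq> r i" "s - (b - a) \<in> \<Lambda>"
        and e': "e' \<in> edges G" "ends G e' = {r i, \<phi> s' (r j)}" "\<phi> s' (r j) \<noteq> r i"
        using pq(1,2) by (auto simp: p q arcs_def)
      have "eclass (\<psi> a e) = eclass (\<psi> a e')" using pq(3) by (simp add: p q)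
      then obtain l where l: "l \<in> \<Lambda>" "\<psi> a e' = \<psi> l (\<psi> a e)"
        unfolding eclass_eq[OF E.closed[OF e(1)] E.closed[OF e'(1)]] by (rule bexE)
      have "\<psi> a e' = \<psi> a (\<psi> l e)"
        unfolding l(2) E.add[OF e(1), symmetric] by (simp add: add.commute)
      then have el: "e' = \<psi> l e" using E.inject_elem[OF e'(1) E.closed[OF e(1)]] by simp
      have "ends G e' = {\<phi> l (r i), \<phi> (l + s) (r j)}"
        unfolding el ends_act[OF e(1)] e(2) V.add[OF rj] by simp
      then have "r i \<in> {\<phi> l (r i), \<phi> (l + s) (r j)}" using e'(2) by auto
      then consider "\<phi> l (r i) = r i" | "\<phi> (l + s) (r j) = \<phi> 0 (r i)" using V.zero[OF ri] by auto
      then show "p = q"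
      proof cases
        case 1
        then have "l = 0" by (rule V.free[OF ri])
        then have ee: "e' = e" using el E.zero[OF e(1)] by simp
        then have "{r i, \<phi> s (r j)} = {r i, \<phi> s' (r j)}" using e(2) e'(2) by simp
        then have "\<phi> s (r j) = \<phi> s' (r j)" using e(3) e'(3) by (simp add: doubleton_eq_iff)
        then show ?thesis using V.inject[OF rj] ee by (simp add: p q)
      next
        case 2
        \<comment> \<open>Translation by \<open>l\<close> carries the far endpoint to the near one,
          so both lie in one \<Lambda>-orbit; this is the loop case excluded by
          \<open>ne\<close>.\<close>
        have eqs: "j = i" "l + s = 0" using vertex_unique[OF ij(2,1) 2] by auto
        then have "s = - l" by (simp add: eq_neg_iff_add_eq_0 add.commute)
        then have "s \<in> \<Lambda>" using L_uminus[OF l(1)] by simp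
        then have "b - a \<in> \<Lambda>" using L_diff[OF _ e(4), of s] by simp
        then show ?thesis using nL eqs by simp
      qed
    qed
    show "?g ` ?S = {X \<in> edges Q. ends Q X = {vx i a, vx j b}}"
    proof (intro equalityI subsetI)
      fix X assume "X \<in> ?g ` ?S"
      then obtain e s where X: "X = eclass (\<psi> a e)" and e: "e \<in> edges G" "ends G e = {r i, \<phi> s (r j)}" "s - (b - a) \<in> \<Lambda>"
        by (auto simp: arcs_def)
      have "ends Q X = {vx i a, vx j (a + s)}"
        unfolding X ends_Q[OF E.closed[OF e(1)]] ends_act[OF e(1)] e(2) vx_def by (simp add: V.add[OF rj])
      also have "vx j (a + s) = vx j b"
        using vx_eq[OF ij(2) ij(2), of "a + s" b] L_uminus[OF e(3)] by (simp add: algebra_simps)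
      finally show "X \<in> {X \<in> edges Q. ends Q X = {vx i a, vx j b}}"
        using E.closed[OF e(1)] by (simp add: X edges_Q)
    next
      fix X assume "X \<in> {X \<in> edges Q. ends Q X = {vx i a, vx j b}}"
      then have XQ: "X \<in> eclass ` edges G" and en: "ends Q X = {vx i a, vx j b}" by (simp_all add: edges_Q)
      from XQ obtain e0 where e0: "e0 \<in> edges G" "X = eclass e0" by (elim imageE)
      obtain u' v' where uv': "u' \<in> verts G" "v' \<in> verts G" "ends G e0 = {u', v'}" by (rule edge_ends[OF e0(1)])
      have "{vclass u', vclass v'} = {vx i a, vx j b}" using ends_Q[OF e0(1)] uv'(3) e0(2) en by simp
      then consider "vclass u' = vx i a" "vclass v' = vx j b" | "vclass v' = vx i a" "vclass u' = vx j b"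
        unfolding doubleton_eq_iff by argo
      then obtain u v where uv: "u \<in> verts G" "v \<in> verts G" "ends G e0 = {u, v}" "vclass u = vx i a" "vclass v = vx j b"
      proof cases
        case 1
        show ?thesis by (rule that[OF uv' 1])
      next
        case 2
        show ?thesis by (rule that[OF uv'(2,1) _ 2]) (simp add: uv'(3) insert_commute)
      qed
      obtain l where l: "l \<in> \<Lambda>" "u = \<phi> l (\<phi> a (r i))"
        by (rule bexE[OF vclass_eq[OF V.closed[OF ri] uv(1), THEN iffD1, OF uv(4)[symmetric, unfolded vx_def]]])
      obtain m where m: "m \<in> \<Lambda>" "v = \<phi> m (\<phi> b (r j))"
        by (rule bexE[OF vclass_eq[OF V.closed[OF rj] uv(2), THEN iffD1, OF uv(5)[symmetric, unfolded vx_def]]])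
      \<comment> \<open>The lift is moved so that its endpoint in the class \<open>vx i a\<close>
        becomes \<open>r i\<close>.\<close>
      define e where "e = \<psi> (- (l + a)) e0"
      define s where "s = - (l + a) + (m + b)"
      have eE: "e \<in> edges G" unfolding e_def by (rule E.closed[OF e0(1)])
      have u: "u = \<phi> (l + a) (r i)" and v: "v = \<phi> (m + b) (r j)"
        unfolding V.add[OF ri] V.add[OF rj] by (rule l(2), rule m(2))
      have u0: "\<phi> (- (l + a)) u = r i" unfolding u V.add[OF ri, symmetric] left_minus by (rule V.zero[OF ri])
      have v0: "\<phi> (- (l + a)) v = \<phi> s (r j)" unfolding v V.add[OF rj, symmetric] s_def ..
      have ends_e: "ends G e = {r i, \<phi> s (r j)}" unfolding e_def ends_act[OF e0(1)] uv(3) using u0 v0 by simp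
      have sL: "s - (b - a) \<in> \<Lambda>" using L_diff[OF m(1) l(1)] by (simp add: s_def algebra_simps)
      have "\<phi> s (r j) \<noteq> r i"
      proof
        assume "\<phi> s (r j) = r i"
        then have "\<phi> s (r j) = \<phi> 0 (r i)" using V.zero[OF ri] by simp
        then have "j = i" "s = 0" using vertex_unique[OF ij(2,1)] by auto
        then show False using nL sL L_uminus[OF sL] by simp
      qed
      then have inS: "(e, s) \<in> ?S" using eE ends_e sL by (simp add: arcs_def)
      have "\<psi> a e = \<psi> (- l) e0" unfolding e_def E.add[OF e0(1), symmetric] by (simp add: algebra_simps)
      then have "eclass e0 = eclass (\<psi> a e)"
        by (intro eclass_eq[OF e0(1) E.closed[OF eE], THEN iffD2] bexI[OF _ L_uminus[OF l(1)]])
      then show "X \<in> ?g ` ?S" using e0(2) inS by (intro image_eqI[of _ _ "(e, s)"]) simp_all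
    qed
  qed
  from bij_betw_same_card[OF this] show ?thesis using ne by (simp add: adj_def)
qed

lemma push_nonneg: "i < n \<Longrightarrow> j < n \<Longrightarrow> push u (walk_mat $$ (i, j)) \<ge> 0"
  unfolding push_def lin_ext_walk_mat by (intro add_nonneg_nonneg sum_nonneg) (auto split: prod.split)

lemma push_row_sum: "i < n \<Longrightarrow> (\<Sum>j<n. \<Sum>b\<in>transversal. push (b - a) (walk_mat $$ (i, j))) = real total_degree"
  using laurent_chain.row_sums[OF laurent_chain_walk_mat] by (simp add: push_total)

lemma adj_push:
  assumes ij: "i < n" "j < n" and ne: "vx i a \<noteq> vx j b"
  shows "real (adj Q (vx i a) (vx j b)) = push (b - a) (walk_mat $$ (i, j))"
proof -
  have "(if i = j then of_nat (total_degree - nonloop_degree G (r i)) * (if 0 - (b - a) \<in> \<Lambda> then 1 else 0) else 0) = (0::real)"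
    using ne vx_eq[OF ij, of a b] L_uminus_iff[of "b - a"] by simp
  moreover have "(\<Sum>(e, s)\<in>arcs i j. if s - (b - a) \<in> \<Lambda> then 1 else (0::real)) = real (card {(e, s) \<in> arcs i j. s - (b - a) \<in> \<Lambda>})"
    using finite_arcs[OF ij] by (simp add: case_prod_unfold sum.If_cases Int_def)
  ultimately show ?thesis unfolding adj_Q[OF assms] push_def lin_ext_walk_mat[OF ij] by simp
qed

text \<open>An edge between \<Lambda>-equivalent vertices becomes a loop and drops out of the
  degree; \<open>push 0\<close> on the diagonal counts exactly these arcs together with the lazy
  part.\<close>

lemma degree_Q:
  assumes i: "i < n"
  shows "real (nonloop_degree Q (vx i a)) = real total_degree - push 0 (walk_mat $$ (i, i))"
proof -
  interpret Q: finite_multigraph Q by (rule finite_multigraph_Q)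
  have vin: "vx i a \<in> verts Q" by (rule vx_in[OF i])
  \<comment> \<open>The representative of \<open>a\<close>, hence the one index in the sum whose
    vertex is \<open>vx i a\<close> itself.\<close>
  obtain c where c: "c \<in> transversal" "a - c \<in> \<Lambda>" by (rule transversal_ex)
  have ca: "c - a \<in> \<Lambda>" using L_uminus[OF c(2)] by simp
  define f where "f y = (if y = vx i a then 0 else real (adj Q (vx i a) y))" for y
  define g where "g j b = push (b - a) (walk_mat $$ (i, j))" for j b
  have "real (nonloop_degree Q (vx i a)) = (\<Sum>y\<in>verts Q. f y)"
    unfolding Q.sum_adj[symmetric] of_nat_sum f_def by (intro sum.cong refl) (auto simp: adj_def)
  also have "\<dots> = (\<Sum>j<n. \<Sum>b\<in>transversal. f (vx j b))" by (rule sum_verts_Q)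
  also have "\<dots> = (\<Sum>j<n. \<Sum>b\<in>transversal. g j b - (if j = i \<and> b = c then g i c else 0))"
  proof (intro sum.cong refl)
    fix j b assume j: "j \<in> {..<n}" and b: "b \<in> transversal"
    have iff: "vx j b = vx i a \<longleftrightarrow> j = i \<and> b = c"
    proof
      assume "vx j b = vx i a"
      then have ji: "j = i" and ab: "a - b \<in> \<Lambda>" using vx_eq[of j i b a] i j by auto
      have "b - c \<in> \<Lambda>" using L_diff[OF c(2) ab] by (simp add: algebra_simps)
      then show "j = i \<and> b = c" using transversal_unique[OF b c(1)] ji by simp
    next
      assume "j = i \<and> b = c"
      then show "vx j b = vx i a" using vx_eq[of i i c a] i c(2) by simp
    qed
    show "f (vx j b) = g j b - (if j = i \<and> b = c then g i c else 0)"
    proof (cases "vx j b = vx i a")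
      case True
      then show ?thesis using iff by (simp add: f_def)
    next
      case False
      then have "f (vx j b) = g j b" using adj_push[of i j a b] i j by (simp add: f_def g_def)
      then show ?thesis using False unfolding iff by auto
    qed
  qed
  also have "\<dots> = (\<Sum>j<n. \<Sum>b\<in>transversal. g j b) - (\<Sum>j<n. \<Sum>b\<in>transversal. if j = i \<and> b = c then g i c else 0)"
    by (simp add: sum_subtractf)
  also have "(\<Sum>j<n. \<Sum>b\<in>transversal. if j = i \<and> b = c then g i c else 0) = (\<Sum>j<n. if j = i then g i c else 0)"
  proof (intro sum.cong refl)
    fix j
    show "(\<Sum>b\<in>transversal. if j = i \<and> b = c then g i c else 0) = (if j = i then g i c else 0)"
      using finite_transversal c(1) by (cases "j = i") simp_all
  qed
  also have "\<dots> = g i c" using i by simp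
  also have "(\<Sum>j<n. \<Sum>b\<in>transversal. g j b) = real total_degree" unfolding g_def by (rule push_row_sum[OF i])
  also have "g i c = push 0 (walk_mat $$ (i, i))"
  proof -
    have "s - (c - a) \<in> \<Lambda> \<longleftrightarrow> s - 0 \<in> \<Lambda>" for s
      using L_add[OF _ ca, of "s - (c - a)"] L_diff[OF _ ca, of s] by auto
    then show ?thesis unfolding g_def push_def by simp
  qed
  finally show ?thesis .
qed

lemma degree_Q_le: "x \<in> verts Q \<Longrightarrow> real (nonloop_degree Q x) \<le> real total_degree"
proof -
  assume "x \<in> verts Q"
  then have "x \<in> (\<lambda>(i, a). vx i a) ` ({..<n} \<times> transversal)" using verts_Q_bij by (simp add: bij_betw_def)
  then obtain i a where "i < n" "x = vx i a" by auto
  then show ?thesis using degree_Q[of i a] push_nonneg[of i i 0] by simp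
qed

abbreviation w_Q where "w_Q \<equiv> lazy_weight Q (real total_degree)"

text \<open>On the diagonal the degree lost to loops is returned by the lazy part, so the quotient
  weights are the pushed entries for every \<Lambda>, however short its vectors.\<close>

lemma lazy_weight_Q:
  assumes ij: "i < n" "j < n"
  shows "w_Q (vx i a) (vx j b) = push (b - a) (walk_mat $$ (i, j))"
proof (cases "vx i a = vx j b")
  case True
  then have eq: "i = j" "b - a \<in> \<Lambda>" using vx_eq[OF ij] by auto
  have "s - (b - a) \<in> \<Lambda> \<longleftrightarrow> s - 0 \<in> \<Lambda>" for s
    using L_add[OF _ eq(2), of "s - (b - a)"] L_diff[OF _ eq(2), of s] by auto
  then have "push (b - a) (walk_mat $$ (i, j)) = push 0 (walk_mat $$ (i, i))" unfolding push_def eq(1) by simp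
  then show ?thesis using True degree_Q[OF ij(1), of a] by (simp add: lazy_weight_def adj_def)
next
  case False
  then show ?thesis using adj_push[OF ij False] by (simp add: lazy_weight_def)
qed

text \<open>By \<open>push_mult\<close>, walks in the quotient are obtained from walks in the
  infinite graph by summing over the \<Lambda>-translates of the final vertex.\<close>

lemma walks_Q:
  assumes ij: "i < n" "j < n"
  shows "walks (verts Q) w_Q k (vx i a) (vx j b) = push (b - a) ((walk_mat ^\<^sub>m k) $$ (i, j))"
  using ij
proof (induction k arbitrary: j b)
  case 0
  have "push (b - a) ((walk_mat ^\<^sub>m 0) $$ (i, j)) = (if i = j then (if - (b - a) \<in> \<Lambda> then 1 else 0) else 0)"
    using 0 lin_ext_of_int[of "\<lambda>s. if s - (b - a) \<in> \<Lambda> then 1 else (0::real)" 1]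
    by (simp add: push_def walk_mat_def)
  then show ?case using vx_eq[OF 0, of a b] L_uminus_iff[of "b - a"] by auto
next
  case (Suc k)
  interpret Q: finite_multigraph Q by (rule finite_multigraph_Q)
  have W: "walk_mat \<in> carrier_mat n n" by (simp add: walk_mat_def)
  have "walks (verts Q) w_Q (Suc k) (vx i a) (vx j b)
      = (\<Sum>z\<in>verts Q. walks (verts Q) w_Q k (vx i a) z * w_Q z (vx j b))"
    by (rule walks_Suc_right[OF Q.fin_verts]) (use Suc.prems vx_in in auto)
  also have "\<dots> = (\<Sum>l<n. \<Sum>c\<in>transversal. walks (verts Q) w_Q k (vx i a) (vx l c) * w_Q (vx l c) (vx j b))"
    by (rule sum_verts_Q)
  also have "\<dots> = (\<Sum>l<n. \<Sum>c\<in>transversal. push (c - a) ((walk_mat ^\<^sub>m k) $$ (i, l)) * push (b - c) (walk_mat $$ (l, j)))"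
    using Suc by (intro sum.cong refl) (simp add: lazy_weight_Q)
  also have "\<dots> = (\<Sum>l<n. push (b - a) ((walk_mat ^\<^sub>m k) $$ (i, l) * walk_mat $$ (l, j)))"
    by (simp add: push_mult)
  also have "\<dots> = push (b - a) (\<Sum>l<n. (walk_mat ^\<^sub>m k) $$ (i, l) * walk_mat $$ (l, j))"
    unfolding push_def lin_ext_sum ..
  also have "(\<Sum>l<n. (walk_mat ^\<^sub>m k) $$ (i, l) * walk_mat $$ (l, j)) = (walk_mat ^\<^sub>m Suc k) $$ (i, j)"
    using W Suc.prems by (simp add: scalar_prod_def atLeast0LessThan)
  finally show ?case .
qed

text \<open>The translation \<open>a\<close> of the base vertex has disappeared, so the index of
  \<Lambda> factors out of the sum over all vertices.\<close>

definition log_density_Q :: "real \<Rightarrow> nat \<Rightarrow> real" where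
  "log_density_Q c i = ln c - suminf (\<lambda>k. push 0 ((walk_mat ^\<^sub>m Suc k) $$ (i, i)) / (real (Suc k) * c ^ Suc k))"

lemma sum_log_density_Q:
  "(\<Sum>x\<in>verts Q. log_density (verts Q) w_Q c x) = real (lattice_index \<Lambda>) * (\<Sum>i<n. log_density_Q c i)"
proof -
  have "log_density (verts Q) w_Q c (vx i a) = log_density_Q c i" if i: "i < n" for i a
    unfolding log_density_def log_density_Q_def walks_Q[OF i i] by simp
  then show ?thesis unfolding sum_verts_Q by (simp add: card_transversal sum_distrib_left)
qed

end

section \<open>Convergence\<close>

lemma euclidean_length_smult: "euclidean_length (of_nat m *s s) = real m * euclidean_length s"
proof -
  have "(\<chi> i. real_of_int (vec_nth (of_nat m *s s) i)) = real m *\<^sub>R (\<chi> i. real_of_int (vec_nth s i))"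
    by (simp add: Finite_Cartesian_Product.vec_eq_iff)
  then show ?thesis by (simp add: euclidean_length_def)
qed

lemma finite_bounded_lattice: "finite {s :: int ^ 'd::finite. euclidean_length s \<le> R}"
proof -
  let ?I = "{- \<lceil>R\<rceil>..\<lceil>R\<rceil>}"
  have "vec_nth s i \<in> ?I" if s: "euclidean_length s \<le> R" for s :: "int ^ 'd" and i
  proof -
    have "\<bar>real_of_int (vec_nth s i)\<bar> \<le> euclidean_length s"
      using component_le_norm_cart[of "\<chi> i. real_of_int (vec_nth s i)" i] by (simp add: euclidean_length_def)
    then have "\<bar>real_of_int (vec_nth s i)\<bar> \<le> R" using s by linarith
    then show ?thesis by (simp add: abs_le_iff) linarith
  qed
  then have "vec_nth ` {s :: int ^ 'd. euclidean_length s \<le> R} \<subseteq> PiE UNIV (\<lambda>_. ?I)" by auto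
  moreover have "finite (PiE (UNIV :: 'd set) (\<lambda>_. ?I))" by (intro finite_PiE) auto
  ultimately have "finite (vec_nth ` {s :: int ^ 'd. euclidean_length s \<le> R})" by (rule finite_subset)
  then show ?thesis by (rule finite_imageD) (auto simp: inj_on_def Finite_Cartesian_Product.vec_eq_iff fun_eq_iff)
qed

text \<open>A \<open>LEAST\<close> over the reals is informative only for an attained minimum; the
  finitely many nonzero vectors of \<Lambda> up to the length of \<open>s\<close> provide
  one.\<close>

lemma min_length_le:
  assumes s: "s \<in> \<Lambda>" "s \<noteq> 0"
  shows "min_length \<Lambda> \<le> euclidean_length s"
proof -
  define A where "A = euclidean_length ` {t \<in> \<Lambda>. t \<noteq> 0 \<and> euclidean_length t \<le> euclidean_length s}"
  have fin: "finite A" unfolding A_def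
    by (rule finite_imageI, rule finite_subset[OF _ finite_bounded_lattice[of "euclidean_length s"]]) auto
  have sA: "euclidean_length s \<in> A" unfolding A_def using s by auto
  then have "Min A \<in> A" using fin by (intro Min_in) auto
  then have P: "\<exists>t\<in>\<Lambda>. t \<noteq> 0 \<and> Min A = euclidean_length t" unfolding A_def by auto
  have "min_length \<Lambda> = Min A"
    unfolding min_length_def
  proof (rule Least_equality)
    show "\<exists>t\<in>\<Lambda>. t \<noteq> 0 \<and> Min A = euclidean_length t" by (rule P)
    fix y assume "\<exists>t\<in>\<Lambda>. t \<noteq> 0 \<and> y = euclidean_length t"
    then obtain t where t: "t \<in> \<Lambda>" "t \<noteq> 0" "y = euclidean_length t" by blast
    show "Min A \<le> y"
    proof (cases "euclidean_length t \<le> euclidean_length s")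
      case True
      then have "y \<in> A" unfolding A_def using t by auto
      then show ?thesis using fin by simp
    next
      case False
      have "Min A \<le> euclidean_length s" using fin sA by simp
      then show ?thesis using False t by simp
    qed
  qed
  then show ?thesis using fin sA by simp
qed

section \<open>Nonzero translations that preserve a component\<close>

context lattice_graph
begin

definition joined :: "('v \<times> 'v) set" where
  "joined = {(a, b). \<exists>e\<in>edges G. ends G e = {a, b}}"

lemma joined_sym: "(a, b) \<in> joined\<^sup>* \<Longrightarrow> (b, a) \<in> joined\<^sup>*"
proof -
  have "sym joined" by (auto simp: sym_def joined_def insert_commute)
  then have "sym (joined\<^sup>*)" by (rule sym_rtrancl)
  then show "(a, b) \<in> joined\<^sup>* \<Longrightarrow> (b, a) \<in> joined\<^sup>*" by (rule symD)
qed

lemma joined_act: "(a, b) \<in> joined \<Longrightarrow> (\<phi> s a, \<phi> s b) \<in> joined"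
proof -
  assume "(a, b) \<in> joined"
  then obtain e where e: "e \<in> edges G" "ends G e = {a, b}" by (auto simp: joined_def)
  have "\<psi> s e \<in> edges G" by (rule E.closed[OF e(1)])
  moreover have "ends G (\<psi> s e) = {\<phi> s a, \<phi> s b}" unfolding ends_act[OF e(1)] e(2) by simp
  ultimately show ?thesis unfolding joined_def by blast
qed

lemma joined_rtrancl_act: "(a, b) \<in> joined\<^sup>* \<Longrightarrow> (\<phi> s a, \<phi> s b) \<in> joined\<^sup>*"
  by (induction rule: rtrancl_induct) (auto intro: rtrancl_into_rtrancl joined_act)

text \<open>
  A component meeting each vertex orbit at most once would give a kernel vector of the Laplacian
  matrix: the exponents of its vertices, as monomials.
\<close>

lemma component_translation:
  assumes \<Delta>: "laplacian_polynomial G \<phi> n r \<noteq> 0" and i0: "i0 < n"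
  obtains s where "s \<noteq> 0" "(r i0, \<phi> s (r i0)) \<in> joined\<^sup>*"
proof (rule ccontr)
  assume contra: "\<not> thesis"
  note witness = that
  have no: "s = 0" if conn: "(r i0, \<phi> s (r i0)) \<in> joined\<^sup>*" for s
    using witness[OF _ conn] contra by blast
  define C where "C = {v. (r i0, v) \<in> joined\<^sup>*}"
  \<comment> \<open>By equivariance, two different translates of \<open>r j\<close> in the component
    would put a nontrivial translate of \<open>r i0\<close> into it.\<close>
  have uniq: "s = t" if j: "j < n" and C: "\<phi> s (r j) \<in> C" "\<phi> t (r j) \<in> C" for s t j
  proof -
    have rj: "r j \<in> verts G" and ri: "r i0 \<in> verts G" by (rule r_in[OF j], rule r_in[OF i0])
    have "(\<phi> (s - t) (r i0), \<phi> (s - t) (\<phi> t (r j))) \<in> joined\<^sup>*"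
      using C(2) by (intro joined_rtrancl_act) (simp add: C_def)
    moreover have "\<phi> (s - t) (\<phi> t (r j)) = \<phi> s (r j)" using V.add[OF rj, of "s - t" t] by simp
    ultimately have "(\<phi> (s - t) (r i0), \<phi> s (r j)) \<in> joined\<^sup>*" by simp
    then have "(\<phi> s (r j), \<phi> (s - t) (r i0)) \<in> joined\<^sup>*" by (rule joined_sym)
    moreover have "(r i0, \<phi> s (r j)) \<in> joined\<^sup>*" using C(1) by (simp add: C_def)
    ultimately have "(r i0, \<phi> (s - t) (r i0)) \<in> joined\<^sup>*" by (meson rtrancl_trans)
    then have "s - t = 0" by (rule no)
    then show ?thesis by simp
  qed
  define meets where "meets j \<longleftrightarrow> (\<exists>s. \<phi> s (r j) \<in> C)" for j
  define \<sigma> where "\<sigma> j = (SOME s. \<phi> s (r j) \<in> C)" for j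
  have \<sigma>: "\<phi> (\<sigma> j) (r j) \<in> C" if "meets j" for j
    using that unfolding meets_def \<sigma>_def by (rule someI_ex)
  \<comment> \<open>The minus sign fits the rule \<open>\<sigma> j = \<sigma> k + s\<close> along an
    arc: the monomial with exponent \<open>s\<close> times \<open>u j\<close> is then
    \<open>u k\<close>.\<close>
  define u :: "nat \<Rightarrow> 'd laurent" where "u j = (if meets j then Poly_Mapping.single (- \<sigma> j) 1 else 0)" for j
  have step: "\<phi> (a + s) (r j) \<in> C \<longleftrightarrow> \<phi> a (r k) \<in> C" if kj: "k < n" "j < n" and arc: "(e, s) \<in> arcs k j" for e s k j a
  proof -
    have "(r k, \<phi> s (r j)) \<in> joined" using arc by (auto simp: arcs_def joined_def)
    then have "(\<phi> a (r k), \<phi> a (\<phi> s (r j))) \<in> joined\<^sup>*" by (intro r_into_rtrancl joined_act)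
    then have "(\<phi> a (r k), \<phi> (a + s) (r j)) \<in> joined\<^sup>*" unfolding V.add[OF r_in[OF kj(2)]] .
    then show ?thesis using joined_sym rtrancl_trans unfolding C_def mem_Collect_eq by metis
  qed
  have arc_term: "Poly_Mapping.single s 1 * u j = u k" if kj: "k < n" "j < n" and arc: "(e, s) \<in> arcs k j" for e s k j
  proof (cases "meets k")
    case True
    have "\<phi> (\<sigma> k + s) (r j) \<in> C" using step[OF kj arc] \<sigma>[OF True] by simp
    then have mj: "meets j" and eq: "\<sigma> j = \<sigma> k + s" using uniq[OF kj(2) \<sigma>] by (auto simp: meets_def)
    show ?thesis using True mj by (simp add: u_def mult_single eq)
  next
    case False
    have "\<not> meets j"
    proof
      assume mj: "meets j"
      have "\<phi> ((\<sigma> j - s) + s) (r j) \<in> C" using \<sigma>[OF mj] by simp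
      then have "\<phi> (\<sigma> j - s) (r k) \<in> C" using step[OF kj arc] by blast
      then show False using False by (auto simp: meets_def)
    qed
    then show ?thesis using False by (simp add: u_def)
  qed
  let ?L = "laplacian_matrix G \<phi> n r"
  let ?u = "vec n u"
  have L: "?L \<in> carrier_mat n n" by (simp add: laplacian_matrix_def)
  have ker: "?L *\<^sub>v ?u = 0\<^sub>v n"
  proof (rule eq_vecI)
    fix k assume "k < dim_vec (0\<^sub>v n :: 'd laurent vec)"
    then have k: "k < n" by simp
    have "vec_index (?L *\<^sub>v ?u) k = (\<Sum>j<n. ?L $$ (k, j) * u j)"
      using k L by (simp add: scalar_prod_def atLeast0LessThan)
    also have "\<dots> = (\<Sum>j<n. (if k = j then of_nat (nonloop_degree G (r k)) * u k else 0) - of_nat (card (arcs k j)) * u k)"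
    proof (intro sum.cong refl)
      fix j assume "j \<in> {..<n}"
      then have j: "j < n" by simp
      have "(\<Sum>(e, s)\<in>arcs k j. Poly_Mapping.single s 1) * u j = (\<Sum>(e, s)\<in>arcs k j. Poly_Mapping.single s 1 * u j)"
        by (simp add: sum_distrib_right case_prod_unfold)
      also have "\<dots> = (\<Sum>p\<in>arcs k j. u k)"
        using arc_term[OF k j] by (intro sum.cong refl) (auto split: prod.split)
      finally have "(\<Sum>(e, s)\<in>arcs k j. Poly_Mapping.single s 1) * u j = of_nat (card (arcs k j)) * u k" by simp
      then show "?L $$ (k, j) * u j = (if k = j then of_nat (nonloop_degree G (r k)) * u k else 0) - of_nat (card (arcs k j)) * u k"
        using k j by (auto simp: laplacian_matrix_def adjacency_arcs left_diff_distrib)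
    qed
    also have "\<dots> = of_nat (nonloop_degree G (r k)) * u k - of_nat (\<Sum>j<n. card (arcs k j)) * u k"
      using k by (simp add: sum_subtractf sum_distrib_right)
    also have "\<dots> = 0" unfolding sum_card_arcs[OF k] by simp
    finally show "vec_index (?L *\<^sub>v ?u) k = vec_index (0\<^sub>v n) k" using k by simp
  qed (simp add: laplacian_matrix_def)
  \<comment> \<open>Multiplication by the adjugate stays inside the Laurent ring and annihilates
    each entry of \<open>u\<close> by the determinant; the entry at \<open>i0\<close> is 1, which
    forces the determinant to vanish.\<close>
  have A: "adj_mat ?L \<in> carrier_mat n n" "adj_mat ?L * ?L = det ?L \<cdot>\<^sub>m 1\<^sub>m n" by (rule adj_mat[OF L])+
  have "(det ?L \<cdot>\<^sub>m 1\<^sub>m n) *\<^sub>v ?u = adj_mat ?L *\<^sub>v (?L *\<^sub>v ?u)"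
    unfolding A(2)[symmetric] by (rule assoc_mult_mat_vec[OF A(1) L]) simp
  also have "\<dots> = 0\<^sub>v n" unfolding ker using A(1) by auto
  finally have "vec_index ((det ?L \<cdot>\<^sub>m 1\<^sub>m n) *\<^sub>v ?u) i0 = 0" using i0 by simp
  moreover have "vec_index ((det ?L \<cdot>\<^sub>m 1\<^sub>m n) *\<^sub>v ?u) i0 = (\<Sum>j<n. (if i0 = j then det ?L else 0) * u j)"
    using i0 by (simp add: scalar_prod_def atLeast0LessThan) (intro sum.cong refl; simp)
  moreover have "\<dots> = (\<Sum>j<n. if i0 = j then det ?L * u i0 else 0)" by (intro sum.cong refl) auto
  moreover have "\<dots> = det ?L * u i0" using i0 by simp
  moreover have "u i0 = 1"
  proof -
    have "\<phi> 0 (r i0) \<in> C" using V.zero[OF r_in[OF i0]] by (simp add: C_def)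
    then have m: "meets i0" by (auto simp: meets_def)
    then have "\<sigma> i0 = 0" using uniq[OF i0 \<sigma>[OF m]] \<open>\<phi> 0 (r i0) \<in> C\<close> by simp
    then show ?thesis using m by (simp add: u_def)
  qed
  ultimately have "det ?L = 0" by simp
  then show False using \<Delta> by (simp add: laplacian_polynomial_def)
qed

end

context quotient_lattice_graph
begin

lemma joined_Q:
  assumes "(a, b) \<in> joined\<^sup>*" and a: "a \<in> verts G"
  shows "(vclass a, vclass b) \<in> connected_rel Q"
proof -
  interpret Q: finite_multigraph Q by (rule finite_multigraph_Q)
  show ?thesis using assms(1)
  proof (induction rule: rtrancl_induct)
    case base
    show ?case using a by (simp add: connected_rel_def verts_Q)
  next
    case (step y z)
    obtain e where e: "e \<in> edges G" "ends G e = {y, z}" using step.hyps(2) by (auto simp: joined_def)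
    have "ends Q (eclass e) = {vclass y, vclass z}" unfolding ends_Q[OF e(1)] e(2) by simp
    moreover have "eclass e \<in> edges Q" using e(1) by (simp add: edges_Q)
    ultimately have "(vclass y, vclass z) \<in> connected_rel Q" by (intro Q.connected_edge)
    then show ?case using step.IH Q.equiv_connected by (meson equiv_def transD)
  qed
qed

text \<open>Multiples of \<open>\<sigma> i\<close> move a vertex through its component. The first
  \<open>M\<close> vertices so obtained stay distinct in the quotient, since a coincidence would put
  a nonzero vector shorter than \<open>min_length \<Lambda>\<close> into \<Lambda>.\<close>

lemma component_size:
  assumes shift: "\<And>i. i < n \<Longrightarrow> \<sigma> i \<noteq> 0 \<and> (r i, \<phi> (\<sigma> i) (r i)) \<in> joined\<^sup>*"
    and large: "\<And>i. i < n \<Longrightarrow> real M * euclidean_length (\<sigma> i) < min_length \<Lambda>"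
    and C: "C \<in> verts Q // connected_rel Q"
  shows "M \<le> card C"
proof -
  interpret Q: finite_multigraph Q by (rule finite_multigraph_Q)
  obtain X where X: "X \<in> C" "X \<in> verts Q"
    using in_quotient_imp_non_empty[OF Q.equiv_connected C] Q.class_subset[OF C] by blast
  then have "X \<in> (\<lambda>(i, a). vx i a) ` ({..<n} \<times> transversal)" using verts_Q_bij by (simp add: bij_betw_def)
  then obtain i a where i: "i < n" "X = vx i a" by auto
  have ri: "r i \<in> verts G" by (rule r_in[OF i(1)])
  have orb: "(r i, \<phi> (of_nat m *s \<sigma> i) (r i)) \<in> joined\<^sup>*" for m
  proof (induction m)
    case 0
    show ?case using V.zero[OF ri] by simp
  next
    case (Suc m)
    have "(\<phi> (of_nat m *s \<sigma> i) (r i), \<phi> (of_nat m *s \<sigma> i) (\<phi> (\<sigma> i) (r i))) \<in> joined\<^sup>*"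
      using shift[OF i(1)] by (intro joined_rtrancl_act) simp
    moreover have "\<phi> (of_nat m *s \<sigma> i) (\<phi> (\<sigma> i) (r i)) = \<phi> (of_nat (Suc m) *s \<sigma> i) (r i)"
      unfolding V.add[OF ri, symmetric]
      by (rule arg_cong[where f = "\<lambda>s. \<phi> s (r i)"]) (simp add: Finite_Cartesian_Product.vec_eq_iff algebra_simps)
    ultimately show ?case using Suc.IH by simp
  qed
  define g where "g m = vx i (a + of_nat m *s \<sigma> i)" for m :: nat
  have gC: "g m \<in> C" for m
  proof -
    have "(\<phi> a (r i), \<phi> a (\<phi> (of_nat m *s \<sigma> i) (r i))) \<in> joined\<^sup>*" by (rule joined_rtrancl_act[OF orb])
    then have "(vclass (\<phi> a (r i)), vclass (\<phi> a (\<phi> (of_nat m *s \<sigma> i) (r i)))) \<in> connected_rel Q"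
      by (rule joined_Q) (rule V.closed[OF ri])
    then have "(X, g m) \<in> connected_rel Q" by (simp add: i(2) g_def vx_def V.add[OF ri])
    then show ?thesis using in_quotient_imp_closed[OF Q.equiv_connected C X(1)] by simp
  qed
  have no: "\<not> (m < m' \<and> m' < M \<and> g m = g m')" for m m'
  proof
    assume h: "m < m' \<and> m' < M \<and> g m = g m'"
    then have "a + of_nat m' *s \<sigma> i - (a + of_nat m *s \<sigma> i) \<in> \<Lambda>"
      using vx_eq[OF i(1) i(1)] by (simp add: g_def)
    moreover have "a + of_nat m' *s \<sigma> i - (a + of_nat m *s \<sigma> i) = of_nat (m' - m) *s \<sigma> i"
      using h by (simp add: Finite_Cartesian_Product.vec_eq_iff of_nat_diff algebra_simps)
    ultimately have inL: "of_nat (m' - m) *s \<sigma> i \<in> \<Lambda>" by simp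
    have "of_nat (m' - m) *s \<sigma> i \<noteq> 0"
    proof
      assume z: "of_nat (m' - m) *s \<sigma> i = 0"
      have "vec_nth (\<sigma> i) k = 0" for k
        using arg_cong[OF z, of "\<lambda>v. vec_nth v k"] h by simp
      then show False using shift[OF i(1)] by (simp add: Finite_Cartesian_Product.vec_eq_iff)
    qed
    then have "min_length \<Lambda> \<le> euclidean_length (of_nat (m' - m) *s \<sigma> i)" by (rule min_length_le[OF inL])
    also have "\<dots> = real (m' - m) * euclidean_length (\<sigma> i)" by (rule euclidean_length_smult)
    also have "\<dots> \<le> real M * euclidean_length (\<sigma> i)"
      using h by (intro mult_right_mono) (auto simp: euclidean_length_def)
    finally show False using large[OF i(1)] by simp
  qed
  have "inj_on g {..<M}"
  proof (rule inj_onI)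
    fix m m' assume "m \<in> {..<M}" "m' \<in> {..<M}" "g m = g m'"
    then show "m = m'" using no[of m m'] no[of m' m] by (cases m m' rule: linorder_cases) auto
  qed
  then have "M = card (g ` {..<M})" by (simp add: card_image)
  also have "\<dots> \<le> card C"
    using gC finite_subset[OF Q.class_subset[OF C] Q.fin_verts] by (intro card_mono) auto
  finally show ?thesis .
qed

text \<open>For powers of \<open>walk_mat\<close> this is the lifting of closed walks: when
  \<Lambda> contains no nonzero exponent that occurs, a walk closed in the quotient is closed in the
  infinite graph.\<close>

lemma push_eq_lookup:
  assumes "\<And>s. s \<in> Poly_Mapping.keys f \<Longrightarrow> s \<in> \<Lambda> \<Longrightarrow> s = 0"
  shows "push 0 f = real_of_int (Poly_Mapping.lookup f 0)"
proof -
  have "push 0 f = (\<Sum>s\<in>Poly_Mapping.keys f. if s = 0 then real_of_int (Poly_Mapping.lookup f 0) else 0)"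
    unfolding push_def lin_ext_def using assms L_zero by (intro sum.cong refl) auto
  also have "\<dots> = real_of_int (Poly_Mapping.lookup f 0)"
    by (simp add: sum.delta' in_keys_iff)
  finally show ?thesis .
qed

lemma finite_chain_Q: "finite_chain (verts Q) w_Q (real total_degree)"
proof -
  interpret Q: finite_multigraph Q by (rule finite_multigraph_Q)
  show ?thesis 
    by (rule Q.finite_chain_lazy[OF degree_Q_le laurent_chain.B_pos[OF laurent_chain_walk_mat]])
qed

text \<open>As a weighted count of closed walks in the quotient, the coefficient sum inherits bounds
  that do not depend on \<Lambda>.\<close>

lemma push_pow_bounds:
  assumes i: "i < n"
  shows "0 \<le> push 0 ((walk_mat ^\<^sub>m k) $$ (i, i))" "push 0 ((walk_mat ^\<^sub>m k) $$ (i, i)) \<le> real total_degree ^ k"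
proof -
  interpret Q: finite_chain "verts Q" w_Q "real total_degree" by (rule finite_chain_Q)
  have v: "vx i 0 \<in> verts Q" by (rule vx_in[OF i])
  have "walks (verts Q) w_Q k (vx i 0) (vx i 0) = push 0 ((walk_mat ^\<^sub>m k) $$ (i, i))"
    unfolding walks_Q[OF i i] by simp
  then show "0 \<le> push 0 ((walk_mat ^\<^sub>m k) $$ (i, i))" "push 0 ((walk_mat ^\<^sub>m k) $$ (i, i)) \<le> real total_degree ^ k"
    using Q.walks_nonneg[OF v, of k "vx i 0"] Q.walks_le[OF v v, of k] by simp_all
qed

lemma lattice_index_pos: "lattice_index \<Lambda> > 0"
proof -
  obtain c where "c \<in> transversal" by (rule transversal_ex[of 0])
  then show ?thesis unfolding card_transversal[symmetric] using finite_transversal by (auto simp: card_gt_0_iff)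
qed

end

text \<open>In the application \<open>b\<close> is a fixed series while \<open>a\<close> varies with
  \<Lambda>; the tail of \<open>a\<close> is controlled through the fixed majorant
  \<open>g\<close>.\<close>

lemma suminf_close_tails:
  fixes a b g :: "nat \<Rightarrow> real"
  assumes "summable a" "summable b" "summable g" "\<And>k. \<bar>a k\<bar> \<le> g k" "\<And>k. k < K \<Longrightarrow> a k = b k"
    and "\<bar>suminf (\<lambda>k. b (k + K))\<bar> < \<eta>" "\<bar>suminf (\<lambda>k. g (k + K))\<bar> < \<eta>"
  shows "\<bar>suminf a - suminf b\<bar> < 2 * \<eta>"
proof -
  have sg: "summable (\<lambda>k. g (k + K))" by (rule summable_ignore_initial_segment) fact
  have sa: "summable (\<lambda>k. \<bar>a (k + K)\<bar>)"
    by (rule summable_comparison_test'[OF sg]) (use assms(4) in auto)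
  have "suminf a - suminf b = suminf (\<lambda>k. a (k + K)) - suminf (\<lambda>k. b (k + K))"
    using suminf_split_initial_segment[OF assms(1), of K] suminf_split_initial_segment[OF assms(2), of K] assms(5)
    by simp
  moreover have "\<bar>suminf (\<lambda>k. a (k + K))\<bar> \<le> suminf (\<lambda>k. \<bar>a (k + K)\<bar>)" by (rule summable_rabs[OF sa])
  moreover have "\<dots> \<le> suminf (\<lambda>k. g (k + K))" by (rule suminf_le[OF _ sa sg]) (rule assms(4))
  ultimately show ?thesis using assms(6,7) by linarith
qed

section \<open>Comparison of quotients with the Mahler measure\<close>

context lattice_graph
begin

text \<open>For \<open>t = 0\<close> the formula gives the Mahler measure of \<Delta>, since
  \<open>total_degree - walk_mat\<close> is the Laplacian matrix.\<close>

definition regularized_mahler :: "real \<Rightarrow> real" where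
  "regularized_mahler t = (LINT \<theta>|cube_measure. laurent_chain.log_det walk_mat n (real total_degree + t) \<theta>)"

lemma quotient_log_density_limit:
  assumes t: "t > 0" and \<eta>: "\<eta> > 0"
  obtains N where "\<And>\<Lambda>. finite_index_sublattice \<Lambda> \<Longrightarrow> min_length \<Lambda> > N \<Longrightarrow>
     \<bar>(\<Sum>i<n. quotient_lattice_graph.log_density_Q G \<phi> n r \<Lambda> (real total_degree + t) i) - regularized_mahler t\<bar> < \<eta>"
proof -
  interpret C: laurent_chain walk_mat n "real total_degree" by (rule laurent_chain_walk_mat)
  define B where "B = real total_degree"
  define c where "c = B + t"
  have Bp: "B > 0" unfolding B_def by (rule C.B_pos)
  have cB: "c > B" and cp: "c > 0" using t Bp by (auto simp: c_def)
  define b where "b k = C.moment (Suc k) / (real (Suc k) * c ^ Suc k)" for k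
  define g where "g k = real n * (B / c) ^ Suc k" for k
  have bs: "b sums (real n * ln c - regularized_mahler t)"
    using C.integral_log_det(2)[of c] cB unfolding b_def[abs_def] regularized_mahler_def c_def B_def by simp
  have gs: "summable g"
    unfolding g_def[abs_def] using summable_mult[OF summable_geometric[of "B / c"], of "real n * (B / c)"] cB cp Bp
    by (simp add: mult.assoc)
  obtain K1 where K1: "\<And>k. k \<ge> K1 \<Longrightarrow> norm (suminf (\<lambda>i. b (i + k))) < \<eta> / 2"
    using suminf_exist_split[of "\<eta> / 2" b] \<eta> sums_summable[OF bs] by auto
  obtain K2 where K2: "\<And>k. k \<ge> K2 \<Longrightarrow> norm (suminf (\<lambda>i. g (i + k))) < \<eta> / 2"
    using suminf_exist_split[of "\<eta> / 2" g] \<eta> gs by auto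
  define K where "K = max K1 K2"
  \<comment> \<open>Powers up to \<open>K\<close> inclusive, because the term with index
    \<open>k < K\<close> involves the power \<open>Suc k\<close>.\<close>
  define S where "S = (\<Union>k\<in>{..K}. \<Union>i\<in>{..<n}. Poly_Mapping.keys ((walk_mat ^\<^sub>m k) $$ (i, i)))"
  \<comment> \<open>A sum of lengths bounds each of them and makes sense for empty \<open>S\<close>
    as well.\<close>
  define N where "N = (\<Sum>s\<in>S. euclidean_length s)"
  have finS: "finite S" by (auto simp: S_def)
  show ?thesis
  proof (rule that[of N])
    fix \<Lambda> :: "(int ^ 'd) set" assume \<Lambda>: "finite_index_sublattice \<Lambda>" and big: "min_length \<Lambda> > N"
    interpret quotient_lattice_graph G \<phi> \<psi> n r \<Lambda> by unfold_locales (rule \<Lambda>)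
    have eqpush: "push 0 ((walk_mat ^\<^sub>m k) $$ (i, i)) = real_of_int (Poly_Mapping.lookup ((walk_mat ^\<^sub>m k) $$ (i, i)) 0)"
      if k: "k \<le> K" and i: "i < n" for k i
    proof (rule push_eq_lookup, rule ccontr)
      fix s assume s: "s \<in> Poly_Mapping.keys ((walk_mat ^\<^sub>m k) $$ (i, i))" "s \<in> \<Lambda>" "s \<noteq> 0"
      have "s \<in> S" unfolding S_def using s(1) k i by blast
      then have "euclidean_length s \<le> N"
        unfolding N_def using finS by (intro member_le_sum) (auto simp: euclidean_length_def)
      then show False using min_length_le[OF s(2,3)] big by simp
    qed
    define a where "a k = (\<Sum>i<n. push 0 ((walk_mat ^\<^sub>m Suc k) $$ (i, i)) / (real (Suc k) * c ^ Suc k))" for k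
    have pb: "\<bar>push 0 ((walk_mat ^\<^sub>m Suc k) $$ (i, i)) / (real (Suc k) * c ^ Suc k)\<bar> \<le> (B / c) ^ Suc k" if i: "i < n" for k i
    proof -
      have "\<bar>push 0 ((walk_mat ^\<^sub>m Suc k) $$ (i, i)) / (real (Suc k) * c ^ Suc k)\<bar>
          = push 0 ((walk_mat ^\<^sub>m Suc k) $$ (i, i)) / (real (Suc k) * c ^ Suc k)"
        using push_pow_bounds(1)[OF i, of "Suc k"] cp by (intro abs_of_nonneg divide_nonneg_nonneg) auto
      also have "\<dots> \<le> B ^ Suc k / (1 * c ^ Suc k)"
        unfolding B_def using cp by (intro frac_le push_pow_bounds(2)[OF i] mult_right_mono) auto
      finally show ?thesis by (simp only: power_divide mult_1)
    qed
    have sq: "summable (\<lambda>k. (B / c) ^ Suc k)"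
      using summable_mult[OF summable_geometric[of "B / c"], of "B / c"] cB cp Bp by simp
    have summ: "summable (\<lambda>k. push 0 ((walk_mat ^\<^sub>m Suc k) $$ (i, i)) / (real (Suc k) * c ^ Suc k))" if i: "i < n" for i
      by (rule summable_comparison_test'[OF sq]) (simp only: real_norm_def pb[OF i])
    have ld: "(\<Sum>i<n. log_density_Q c i) = real n * ln c - suminf a"
      unfolding log_density_Q_def a_def[abs_def] using summ by (subst suminf_sum) (auto simp: sum_subtractf)
    have asum: "summable a" unfolding a_def[abs_def] using summ by (intro summable_sum) auto
    have ag: "\<bar>a k\<bar> \<le> g k" for k
    proof -
      have "\<bar>a k\<bar> \<le> (\<Sum>i<n. (B / c) ^ Suc k)"
        unfolding a_def by (rule order_trans[OF sum_abs sum_mono]) (use pb in auto)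
      then show ?thesis by (simp add: g_def)
    qed
    have ab: "a k = b k" if k: "k < K" for k
      unfolding a_def b_def C.moment_def sum_divide_distrib
      by (intro sum.cong refl arg_cong2[where f = "(/)"] eqpush) (use k in auto)
    have "\<bar>suminf a - suminf b\<bar> < 2 * (\<eta> / 2)"
      by (rule suminf_close_tails[OF asum sums_summable[OF bs] gs ag ab])
        (use K1[of K] K2[of K] in \<open>auto simp: K_def\<close>)
    moreover have "suminf b = real n * ln c - regularized_mahler t" using bs by (simp add: sums_iff)
    ultimately have "\<bar>(\<Sum>i<n. log_density_Q c i) - regularized_mahler t\<bar> < \<eta>" unfolding ld by simp
    then show "\<bar>(\<Sum>i<n. log_density_Q (real total_degree + t) i) - regularized_mahler t\<bar> < \<eta>"
      unfolding c_def B_def .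
  qed
qed

text \<open>The order of choices matters: \<open>t\<close> is fixed first, then a component size
  \<open>M\<close> makes \<open>2 / sqrt M\<close> and \<open>|ln t| / M\<close> small, and only
  then is \<Lambda> required to have large minimal length. The part \<open>16 n sqrt t\<close> is
  the same for all \<Lambda> and vanishes with \<open>t\<close>.\<close>

lemma complexity_regularized:
  assumes \<Delta>: "laplacian_polynomial G \<phi> n r \<noteq> 0" and t: "0 < t" "t \<le> 1" and \<eta>: "\<eta> > 0"
  obtains N where "\<And>\<Lambda>. finite_index_sublattice \<Lambda> \<Longrightarrow> min_length \<Lambda> > N \<Longrightarrow>
     \<bar>ln (real (complexity (quotient_graph G \<phi> \<psi> \<Lambda>))) / real (lattice_index \<Lambda>) - regularized_mahler t\<bar>
       < 16 * real n * sqrt t + \<eta>"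
proof -
  have "\<exists>s. s \<noteq> 0 \<and> (r i, \<phi> s (r i)) \<in> joined\<^sup>*" if i: "i < n" for i
    by (rule component_translation[OF \<Delta> i]) blast
  then have "\<exists>\<sigma>. \<forall>i\<in>{..<n}. \<sigma> i \<noteq> 0 \<and> (r i, \<phi> (\<sigma> i) (r i)) \<in> joined\<^sup>*" by (intro bchoice) auto
  then obtain \<sigma> where \<sigma>: "\<And>i. i < n \<Longrightarrow> \<sigma> i \<noteq> 0 \<and> (r i, \<phi> (\<sigma> i) (r i)) \<in> joined\<^sup>*" by auto
  have "(\<lambda>M. real n * (2 * sqrt (1 / real M) + \<bar>ln t\<bar> * (1 / real M))) \<longlonglongrightarrow> real n * (2 * sqrt 0 + \<bar>ln t\<bar> * 0)"
    by (intro tendsto_intros lim_1_over_n)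
  then have "eventually (\<lambda>M. real n * (2 * sqrt (1 / real M) + \<bar>ln t\<bar> * (1 / real M)) < \<eta> / 2) sequentially"
    using \<eta> by (intro order_tendstoD(2)) auto
  then have "eventually (\<lambda>M. real n * (2 * sqrt (1 / real M) + \<bar>ln t\<bar> * (1 / real M)) < \<eta> / 2 \<and> M > 0) sequentially"
    using eventually_gt_at_top[of 0] by (rule eventually_conj)
  then obtain M where M: "real n * (2 * sqrt (1 / real M) + \<bar>ln t\<bar> * (1 / real M)) < \<eta> / 2" "M > 0"
    using eventually_happens by force
  obtain N1 where N1: "\<And>\<Lambda>. finite_index_sublattice \<Lambda> \<Longrightarrow> min_length \<Lambda> > N1 \<Longrightarrow>
     \<bar>(\<Sum>i<n. quotient_lattice_graph.log_density_Q G \<phi> n r \<Lambda> (real total_degree + t) i) - regularized_mahler t\<bar> < \<eta> / 2"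
    by (rule quotient_log_density_limit[OF t(1), of "\<eta> / 2"]) (use \<eta> in auto)
  define N where "N = max N1 (\<Sum>i<n. real M * euclidean_length (\<sigma> i))"
  show ?thesis
  proof (rule that[of N])
    fix \<Lambda> :: "(int ^ 'd) set" assume \<Lambda>: "finite_index_sublattice \<Lambda>" and big: "min_length \<Lambda> > N"
    interpret quotient_lattice_graph G \<phi> \<psi> n r \<Lambda> by unfold_locales (rule \<Lambda>)
    interpret Q: finite_multigraph Q by (rule finite_multigraph_Q)
    have large: "real M * euclidean_length (\<sigma> i) < min_length \<Lambda>" if i: "i < n" for i
    proof -
      have "real M * euclidean_length (\<sigma> i) \<le> (\<Sum>i<n. real M * euclidean_length (\<sigma> i))"
        using i by (intro member_le_sum) (auto simp: euclidean_length_def)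
      then show ?thesis using big by (simp add: N_def)
    qed
    define I where "I = real (lattice_index \<Lambda>)"
    have I: "I > 0" using lattice_index_pos by (simp add: I_def)
    define D where "D = (\<Sum>i<n. log_density_Q (real total_degree + t) i)"
    have "\<bar>ln (real (complexity Q)) - I * D\<bar> \<le> real (card (verts Q)) * (2 / sqrt M + \<bar>ln t\<bar> / M + 16 * sqrt t)"
      unfolding I_def D_def sum_log_density_Q[symmetric]
      by (rule Q.ln_complexity_approx[OF degree_Q_le laurent_chain.B_pos[OF laurent_chain_walk_mat] t M(2) component_size[OF \<sigma> large]])
    also have "real (card (verts Q)) = I * real n" by (simp add: card_verts_Q I_def)
    finally have "\<bar>ln (real (complexity Q)) - I * D\<bar> \<le> I * (real n * (2 / sqrt M + \<bar>ln t\<bar> / M + 16 * sqrt t))"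
      by (simp only: mult.assoc)
    then have "\<bar>ln (real (complexity Q)) - I * D\<bar> / I \<le> real n * (2 / sqrt M + \<bar>ln t\<bar> / M + 16 * sqrt t)"
      using I by (simp add: divide_le_eq mult.commute)
    moreover have "\<bar>ln (real (complexity Q)) - I * D\<bar> / I = \<bar>ln (real (complexity Q)) / I - D\<bar>"
    proof -
      have "ln (real (complexity Q)) / I - D = (ln (real (complexity Q)) - I * D) / I"
        using I by (simp add: field_simps)
      then show ?thesis using I by (simp add: abs_divide)
    qed
    moreover have "real n * (2 / sqrt M + \<bar>ln t\<bar> / M + 16 * sqrt t)
        = real n * (2 * sqrt (1 / real M) + \<bar>ln t\<bar> * (1 / real M)) + 16 * real n * sqrt t"
      by (simp add: real_sqrt_divide algebra_simps)
    ultimately have "\<bar>ln (real (complexity Q)) / I - D\<bar> < \<eta> / 2 + 16 * real n * sqrt t" using M(1) by linarith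
    moreover have "\<bar>D - regularized_mahler t\<bar> < \<eta> / 2"
      unfolding D_def by (rule N1[OF \<Lambda>]) (use big in \<open>simp add: N_def\<close>)
    ultimately show "\<bar>ln (real (complexity Q)) / real (lattice_index \<Lambda>) - regularized_mahler t\<bar> < 16 * real n * sqrt t + \<eta>"
      unfolding I_def by linarith
  qed
qed

lemma regularized_mahler_limit:
  assumes K: "\<And>t. 0 < t \<Longrightarrow> t \<le> 1 \<Longrightarrow> regularized_mahler t \<ge> K"
  shows "(\<lambda>m. regularized_mahler (1 / real (Suc m))) \<longlonglongrightarrow> mahler_measure (laplacian_polynomial G \<phi> n r)"
proof -
  interpret C: laurent_chain walk_mat n "real total_degree" by (rule laurent_chain_walk_mat)
  have ld: "C.log_det (real total_degree) = (\<lambda>\<theta>. ln (cmod (laurent_eval (laplacian_polynomial G \<phi> n r) (torus_point \<theta>))))"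
    by (rule ext) (rule log_det_total_degree)
  have "mahler_measure (laplacian_polynomial G \<phi> n r) = (LINT \<theta>|cube_measure. C.log_det (real total_degree) \<theta>)"
    unfolding ld integral_cube_measure mahler_measure_def unit_cube_def torus_point_def ..
  moreover have "C.log_det (real total_degree) \<in> borel_measurable cube_measure"
    unfolding ld
    by (intro borel_measurable_ln borel_measurable_cubeI continuous_on_norm continuous_laurent_torus)
  ultimately show ?thesis
    using C.integral_log_det_limit[of K] K unfolding regularized_mahler_def by simp
qed

theorem complexity_growth:
  assumes \<Delta>: "laplacian_polynomial G \<phi> n r \<noteq> 0" and \<epsilon>: "\<epsilon> > 0"
  shows "\<exists>N. \<forall>\<Lambda>. finite_index_sublattice \<Lambda> \<and> min_length \<Lambda> > N \<longrightarrow>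
           \<bar>ln (real (complexity (quotient_graph G \<phi> \<psi> \<Lambda>))) / real (lattice_index \<Lambda>)
              - mahler_measure (laplacian_polynomial G \<phi> n r)\<bar> < \<epsilon>"
proof (cases "\<exists>N. \<forall>\<Lambda> :: (int ^ 'd) set. \<not> (finite_index_sublattice \<Lambda> \<and> min_length \<Lambda> > N)")
  case True
  then show ?thesis by blast
next
  \<comment> \<open>The lower bound below is read off from quotients of large minimal length.\<close>
  case False
  have lower: "regularized_mahler t \<ge> - (16 * real n + 1)" if t: "0 < t" "t \<le> 1" for t
  proof -
    obtain N where N: "\<And>\<Lambda>. finite_index_sublattice \<Lambda> \<Longrightarrow> min_length \<Lambda> > N \<Longrightarrow>
     \<bar>ln (real (complexity (quotient_graph G \<phi> \<psi> \<Lambda>))) / real (lattice_index \<Lambda>) - regularized_mahler t\<bar>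
       < 16 * real n * sqrt t + 1"
      by (rule complexity_regularized[OF \<Delta> t, of 1]) auto
    obtain \<Lambda> :: "(int ^ 'd) set" where \<Lambda>: "finite_index_sublattice \<Lambda>" "min_length \<Lambda> > N" using False by blast
    \<comment> \<open>The complexity is a natural number, so its logarithm is nonnegative;
      \<open>ln 0 = 0\<close> covers the value 0.\<close>
    have "ln (real (complexity (quotient_graph G \<phi> \<psi> \<Lambda>))) \<ge> 0"
      by (cases "complexity (quotient_graph G \<phi> \<psi> \<Lambda>)") auto
    then have "ln (real (complexity (quotient_graph G \<phi> \<psi> \<Lambda>))) / real (lattice_index \<Lambda>) \<ge> 0" by simp
    moreover have "16 * real n * sqrt t \<le> 16 * real n * 1" using t by (intro mult_left_mono) auto
    ultimately show ?thesis using N[OF \<Lambda>] by linarith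
  qed
  have "eventually (\<lambda>m. \<bar>regularized_mahler (1 / real (Suc m)) - mahler_measure (laplacian_polynomial G \<phi> n r)\<bar> < \<epsilon> / 3) sequentially"
    using tendstoD[OF regularized_mahler_limit[OF lower], of "\<epsilon> / 3"] \<epsilon> by (simp add: dist_real_def)
  moreover have "eventually (\<lambda>m. 16 * real n * sqrt (1 / real (Suc m)) < \<epsilon> / 3) sequentially"
  proof -
    have "(\<lambda>m. 16 * real n * sqrt (1 / real (Suc m))) \<longlonglongrightarrow> 16 * real n * sqrt 0"
      by (intro tendsto_intros LIMSEQ_Suc[OF lim_1_over_n])
    then show ?thesis using \<epsilon> by (intro order_tendstoD(2)) auto
  qed
  ultimately have "eventually (\<lambda>m. \<bar>regularized_mahler (1 / real (Suc m)) - mahler_measure (laplacian_polynomial G \<phi> n r)\<bar> < \<epsilon> / 3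
      \<and> 16 * real n * sqrt (1 / real (Suc m)) < \<epsilon> / 3) sequentially" by (rule eventually_conj)
  then obtain m where m: "\<bar>regularized_mahler (1 / real (Suc m)) - mahler_measure (laplacian_polynomial G \<phi> n r)\<bar> < \<epsilon> / 3"
    "16 * real n * sqrt (1 / real (Suc m)) < \<epsilon> / 3" using eventually_happens by force
  obtain N where N: "\<And>\<Lambda>. finite_index_sublattice \<Lambda> \<Longrightarrow> min_length \<Lambda> > N \<Longrightarrow>
     \<bar>ln (real (complexity (quotient_graph G \<phi> \<psi> \<Lambda>))) / real (lattice_index \<Lambda>) - regularized_mahler (1 / real (Suc m))\<bar>
       < 16 * real n * sqrt (1 / real (Suc m)) + \<epsilon> / 3"
    by (rule complexity_regularized[OF \<Delta>, of "1 / real (Suc m)" "\<epsilon> / 3"]) (use \<epsilon> in auto)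
  show ?thesis
  proof (intro exI[of _ N] allI impI)
    fix \<Lambda> :: "(int ^ 'd) set" assume \<Lambda>: "finite_index_sublattice \<Lambda> \<and> min_length \<Lambda> > N"
    show "\<bar>ln (real (complexity (quotient_graph G \<phi> \<psi> \<Lambda>))) / real (lattice_index \<Lambda>)
              - mahler_measure (laplacian_polynomial G \<phi> n r)\<bar> < \<epsilon>"
      using N[of \<Lambda>] \<Lambda> m by linarith
  qed
qed

end

theorem theorem3p6:
  fixes G :: "('v, 'e) multigraph"
    and \<phi> :: "int ^ 'd::finite \<Rightarrow> 'v \<Rightarrow> 'v"
    and \<psi> :: "int ^ 'd \<Rightarrow> 'e \<Rightarrow> 'e"
    and n :: nat
    and r :: "nat \<Rightarrow> 'v"
  assumes "wf_multigraph G"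
    and "cofinite_free_symmetry G \<phi> \<psi>"
    and "orbit_representatives G \<phi> n r"
    and "laplacian_polynomial G \<phi> n r \<noteq> 0"
  shows "\<forall>\<epsilon>>0. \<exists>N::real. \<forall>\<Lambda> :: (int ^ 'd) set.
           finite_index_sublattice \<Lambda> \<and> min_length \<Lambda> > N \<longrightarrow>
           \<bar>ln (real (complexity (quotient_graph G \<phi> \<psi> \<Lambda>))) / real (lattice_index \<Lambda>)
              - mahler_measure (laplacian_polynomial G \<phi> n r)\<bar> < \<epsilon>"
proof -
  have "free_action (verts G) \<phi>" "free_action (edges G) \<psi>"
    using assms(2) by (auto simp: cofinite_free_symmetry_def intro!: free_actionI)
  then interpret lattice_graph G \<phi> \<psi> n r
    using assms(1-3) by (intro lattice_graph.intro lattice_graph_axioms.intro) (auto simp: cofinite_free_symmetry_def)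
  show ?thesis using complexity_growth[OF assms(4)] by blast
qed

end
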